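(* Let $k$ be a field and let $A$ be a short local $k$-algebra of Hilbert type $(e,a)$. If there exists a non-zero Koszul $A$-module $M$ of Loewy length at most $2$, then $A$ is a left Koszul algebra, $a\le\frac14e^2$ and $\gamma_A=\frac12\bigl(e+\sqrt{e^2-4a}\bigr)$. In addition, either $\gamma(M)=\gamma_A$, or else $a>0$ and $\gamma(M)=\frac12\bigl(e-\sqrt{e^2-4a}\bigr)$.
   Context: A short local $k$-algebra is a finite-dimensional local $k$-algebra $A$ whose radical $J$ satisfies $J^3=0$; we assume $A/J=k$ and write $S=A/J$ for the simple module. Its Hilbert type is $(e,a)$ with $e=|J/J^2|$, $a=|J^2|$ (lengths). Modules are left modules of finite length. A module $M$ has Loewy length at most $2$ iff $J^2M=0$. $\Omega M$ is the kernel of a projective cover $P(M)\to M$, $\Omega^0M=M$, $\Omega^{n+1}M=\Omega(\Omega^nM)$. Put $t(M)=|M/JM|$, $t_n(M)=t(\Omega^nM)$, $\gamma(M)=\limsup_n\sqrt[n]{t_n(M)}$ and $\gamma_A=\gamma(S)$. A module $M$ is a Koszul module if a minimal projective resolution $\cdots\to P_n\to P_{n-1}\to\cdots\to P_0\to M\to 0$ induces for every $n\ge 0$ an exact sequence $$0\to P_n/JP_n\to JP_{n-1}/J^2P_{n-1}\to\cdots\to J^nP_0/J^{n+1}P_0\to J^nM/J^{n+1}M\to 0.$$ $A$ is a left Koszul algebra if $S$ is a Koszul module.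
   Formalization: In the second alternative, "a>0" is replaced by "a>0 or M is projective", because the original fails for M=A=k[x]/(x^2), where a=0, γ(M)=0 and γ_A=1; for non-projective M, or a>0, the claim is unchanged. *)

theory Defs
  imports
    "HOL-Library.Extended_Nat"
    "HOL-Library.Extended_Real"
    "HOL-Algebra.Algebra"
begin

section \<open>Left modules over a not necessarily commutative ring\<close>

text \<open>The library locale \<^locale>\<open>module\<close> requires a commutative base ring, so left modules are
  introduced here on the same record type. The multiplicative fields
  of that record play no role for a module; the constructions below leave them undefined
  or inherit them. The library predicate \<^const>\<open>submodule\<close> makes no assumption on the base ring
  and is reused.\<close>

locale left_module = R?: ring R + M?: abelian_group M
  for R :: "('a, 'r) ring_scheme" (structure) and M :: "('a, 'm, 'z) module_scheme" (structure) +
  assumes smult_closed: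
      "\<lbrakk>a \<in> carrier R; x \<in> carrier M\<rbrakk> \<Longrightarrow> a \<odot>\<^bsub>M\<^esub> x \<in> carrier M"
    and smult_l_distr:
      "\<lbrakk>a \<in> carrier R; b \<in> carrier R; x \<in> carrier M\<rbrakk> \<Longrightarrow>
        (a \<oplus>\<^bsub>R\<^esub> b) \<odot>\<^bsub>M\<^esub> x = a \<odot>\<^bsub>M\<^esub> x \<oplus>\<^bsub>M\<^esub> b \<odot>\<^bsub>M\<^esub> x"
    and smult_r_distr:
      "\<lbrakk>a \<in> carrier R; x \<in> carrier M; y \<in> carrier M\<rbrakk> \<Longrightarrow>
        a \<odot>\<^bsub>M\<^esub> (x \<oplus>\<^bsub>M\<^esub> y) = a \<odot>\<^bsub>M\<^esub> x \<oplus>\<^bsub>M\<^esub> a \<odot>\<^bsub>M\<^esub> y"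
    and smult_assoc1:
      "\<lbrakk>a \<in> carrier R; b \<in> carrier R; x \<in> carrier M\<rbrakk> \<Longrightarrow>
        (a \<otimes>\<^bsub>R\<^esub> b) \<odot>\<^bsub>M\<^esub> x = a \<odot>\<^bsub>M\<^esub> (b \<odot>\<^bsub>M\<^esub> x)"
    and smult_one:
      "x \<in> carrier M \<Longrightarrow> \<one>\<^bsub>R\<^esub> \<odot>\<^bsub>M\<^esub> x = x"

definition left_module_hom ::
    "('a, 'r) ring_scheme \<Rightarrow> ('a, 'm) module \<Rightarrow> ('a, 'n) module \<Rightarrow> ('m \<Rightarrow> 'n) set" where
  "left_module_hom R M N =
    {f \<in> carrier M \<rightarrow> carrier N.
      (\<forall>x\<in>carrier M. \<forall>y\<in>carrier M. f (x \<oplus>\<^bsub>M\<^esub> y) = f x \<oplus>\<^bsub>N\<^esub> f y) \<and>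
      (\<forall>a\<in>carrier R. \<forall>x\<in>carrier M. f (a \<odot>\<^bsub>M\<^esub> x) = a \<odot>\<^bsub>N\<^esub> f x)}"

definition restrict_module :: "('a, 'm) module \<Rightarrow> 'm set \<Rightarrow> ('a, 'm) module" where
  "restrict_module M N = M\<lparr>carrier := N\<rparr>"

definition quotient_module :: "('a, 'm) module \<Rightarrow> 'm set \<Rightarrow> ('a, 'm set) module" where
  "quotient_module M N =
    \<lparr>carrier = a_rcosets\<^bsub>M\<^esub> N, monoid.mult = undefined, one = undefined,
     ring.zero = N, add = set_add M,
     smult = (\<lambda>a C. \<Union>x\<in>C. N +>\<^bsub>M\<^esub> (a \<odot>\<^bsub>M\<^esub> x))\<rparr>"

definition regular_module :: "('a, 'r) ring_scheme \<Rightarrow> ('a, 'a) module" where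
  "regular_module R =
    \<lparr>carrier = carrier R, monoid.mult = monoid.mult R, one = one R,
     ring.zero = ring.zero R, add = add R, smult = monoid.mult R\<rparr>"

definition free_module :: "('a, 'r) ring_scheme \<Rightarrow> nat \<Rightarrow> ('a, nat \<Rightarrow> 'a) module" where
  "free_module R n =
    \<lparr>carrier = {..<n} \<rightarrow>\<^sub>E carrier R, monoid.mult = undefined, one = undefined,
     ring.zero = (\<lambda>i\<in>{..<n}. \<zero>\<^bsub>R\<^esub>),
     add = (\<lambda>f g. \<lambda>i\<in>{..<n}. f i \<oplus>\<^bsub>R\<^esub> g i),
     smult = (\<lambda>a f. \<lambda>i\<in>{..<n}. a \<otimes>\<^bsub>R\<^esub> f i)\<rparr>"

text \<open>The length is the supremum of the lengths of chains of submodules; by Jordan--Hoelder it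
  is the length of any composition series when one exists, and infinite otherwise.\<close>

definition submodule_chain ::
    "('a, 'r) ring_scheme \<Rightarrow> ('a, 'm) module \<Rightarrow> nat \<Rightarrow> (nat \<Rightarrow> 'm set) \<Rightarrow> bool" where
  "submodule_chain R M n N \<longleftrightarrow>
    (\<forall>i\<le>n. submodule (N i) R M) \<and> (\<forall>i<n. N i \<subset> N (Suc i))"

definition module_length :: "('a, 'r) ring_scheme \<Rightarrow> ('a, 'm) module \<Rightarrow> enat" where
  "module_length R M = (SUP n\<in>{n. \<exists>N. submodule_chain R M n N}. enat n)"

definition finite_length_module :: "('a, 'r) ring_scheme \<Rightarrow> ('a, 'm) module \<Rightarrow> bool" where
  "finite_length_module R M \<longleftrightarrow> left_module R M \<and> module_length R M < \<infinity>"

section \<open>Radical and radical powers\<close>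

definition maximal_left_ideal :: "('a, 'r) ring_scheme \<Rightarrow> 'a set \<Rightarrow> bool" where
  "maximal_left_ideal R I \<longleftrightarrow>
    submodule I R (regular_module R) \<and> I \<noteq> carrier R \<and>
    (\<forall>K. submodule K R (regular_module R) \<and> I \<subseteq> K \<longrightarrow> K = I \<or> K = carrier R)"

definition jradical :: "('a, 'r) ring_scheme \<Rightarrow> 'a set" where
  "jradical R = carrier R \<inter> \<Inter>{I. maximal_left_ideal R I}"

definition local_ring :: "('a, 'r) ring_scheme \<Rightarrow> bool" where
  "local_ring R \<longleftrightarrow> ring R \<and> (\<exists>!I. maximal_left_ideal R I)"

text \<open>\<open>rad_power R M i\<close> is \<open>J\<^sup>i M\<close>, computed as \<open>J (J (\<dots> (J M)))\<close>, where \<open>J X\<close> is the additive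
  group generated by the products. For the regular module and \<open>i \<ge> 1\<close> this is the ideal
  \<open>J\<^sup>i\<close>.\<close>

fun rad_power :: "('a, 'r) ring_scheme \<Rightarrow> ('a, 'm) module \<Rightarrow> nat \<Rightarrow> 'm set" where
  "rad_power R M 0 = carrier M"
| "rad_power R M (Suc i) =
    generate (add_monoid M) {a \<odot>\<^bsub>M\<^esub> x | a x. a \<in> jradical R \<and> x \<in> rad_power R M i}"

definition loewy_length :: "('a, 'r) ring_scheme \<Rightarrow> ('a, 'm) module \<Rightarrow> nat" where
  "loewy_length R M = (LEAST n. rad_power R M n = {\<zero>\<^bsub>M\<^esub>})"

definition simple_top :: "('a, 'r) ring_scheme \<Rightarrow> ('a, 'a set) module" where
  "simple_top R = quotient_module (regular_module R) (jradical R)"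

definition top_length :: "('a, 'r) ring_scheme \<Rightarrow> ('a, 'm) module \<Rightarrow> nat" where
  "top_length R M = the_enat (module_length R (quotient_module M (rad_power R M 1)))"

section \<open>Short local algebras\<close>

text \<open>An algebra is a single record \<open>A\<close> which carries both a ring structure and, through
  \<open>smult\<close>, a vector space structure over \<open>k\<close>. The last condition below says that the
  structure map \<open>k \<rightarrow> A/J\<close> is bijective.\<close>

definition fin_dim_algebra :: "('k, 'l) ring_scheme \<Rightarrow> ('k, 'a) module \<Rightarrow> bool" where
  "fin_dim_algebra k A \<longleftrightarrow>
    field k \<and> ring A \<and> Module.module k A \<and>
    (\<forall>c\<in>carrier k. \<forall>x\<in>carrier A. \<forall>y\<in>carrier A.
      (c \<odot>\<^bsub>A\<^esub> x) \<otimes>\<^bsub>A\<^esub> y = c \<odot>\<^bsub>A\<^esub> (x \<otimes>\<^bsub>A\<^esub> y) \<and>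
      x \<otimes>\<^bsub>A\<^esub> (c \<odot>\<^bsub>A\<^esub> y) = c \<odot>\<^bsub>A\<^esub> (x \<otimes>\<^bsub>A\<^esub> y)) \<and>
    (\<exists>n b. b \<in> {..<n::nat} \<rightarrow> carrier A \<and>
      (\<forall>x\<in>carrier A. \<exists>c\<in>{..<n} \<rightarrow> carrier k. x = (\<Oplus>\<^bsub>A\<^esub>i\<in>{..<n}. c i \<odot>\<^bsub>A\<^esub> b i)))"

definition short_local_algebra :: "('k, 'l) ring_scheme \<Rightarrow> ('k, 'a) module \<Rightarrow> bool" where
  "short_local_algebra k A \<longleftrightarrow>
    fin_dim_algebra k A \<and> local_ring A \<and>
    rad_power A (regular_module A) 3 = {\<zero>\<^bsub>A\<^esub>} \<and>
    bij_betw (\<lambda>c. jradical A +>\<^bsub>A\<^esub> (c \<odot>\<^bsub>A\<^esub> \<one>\<^bsub>A\<^esub>)) (carrier k) (a_rcosets\<^bsub>A\<^esub> (jradical A))"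

definition hilbert_type :: "('a, 'r) ring_scheme \<Rightarrow> nat \<Rightarrow> nat \<Rightarrow> bool" where
  "hilbert_type A e a \<longleftrightarrow>
    module_length A (quotient_module (restrict_module (regular_module A) (jradical A))
      (rad_power A (regular_module A) 2)) = enat e \<and>
    module_length A (restrict_module (regular_module A) (rad_power A (regular_module A) 2))
      = enat a"

section \<open>Projective covers, syzygies, growth\<close>

text \<open>Only projective modules of finite length occur, so direct summands of finite free
  modules suffice.\<close>

definition projective_module :: "('a, 'r) ring_scheme \<Rightarrow> ('a, 'm) module \<Rightarrow> bool" where
  "projective_module R P \<longleftrightarrow> left_module R P \<and>
    (\<exists>n. \<exists>p\<in>left_module_hom R (free_module R n) P. \<exists>s\<in>left_module_hom R P (free_module R n).
      \<forall>x\<in>carrier P. p (s x) = x)"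

definition projective_cover ::
    "('a, 'r) ring_scheme \<Rightarrow> ('a, 'p) module \<Rightarrow> ('a, 'm) module \<Rightarrow> ('p \<Rightarrow> 'm) \<Rightarrow> bool" where
  "projective_cover R P M p \<longleftrightarrow>
    projective_module R P \<and> p \<in> left_module_hom R P M \<and> p ` carrier P = carrier M \<and>
    (\<forall>N. submodule N R P \<and> p ` N = carrier M \<longrightarrow> N = carrier P)"

definition kernel_module ::
    "('a, 'p) module \<Rightarrow> ('a, 'm) module \<Rightarrow> ('p \<Rightarrow> 'm) \<Rightarrow> ('a, 'p) module" where
  "kernel_module P M p = restrict_module P (a_kernel P M p)"

text \<open>The syzygy module is determined up to isomorphism; one representative is chosen. Over a
  finite-dimensional local algebra every projective module of finite length is isomorphic to
  some \<open>free_module R n\<close>, whose elements have type \<^typ>\<open>nat \<Rightarrow> 'a\<close>, so fixing this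
  type for projective covers loses nothing. Because the syzygy has a different type than \<open>M\<close>,
  the zeroth syzygy is treated separately in \<open>syzygy_top\<close>.\<close>

definition syzygy :: "('a, 'r) ring_scheme \<Rightarrow> ('a, 'm) module \<Rightarrow> ('a, nat \<Rightarrow> 'a) module" where
  "syzygy R M =
    (SOME N. \<exists>(P :: ('a, nat \<Rightarrow> 'a) module) p. projective_cover R P M p \<and> N = kernel_module P M p)"

fun syzygy_top :: "('a, 'r) ring_scheme \<Rightarrow> ('a, 'm) module \<Rightarrow> nat \<Rightarrow> nat" where
  "syzygy_top R M 0 = top_length R M"
| "syzygy_top R M (Suc n) = top_length R ((syzygy R ^^ n) (syzygy R M))"

definition growth :: "('a, 'r) ring_scheme \<Rightarrow> ('a, 'm) module \<Rightarrow> ereal" where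
  "growth R M = limsup (\<lambda>n. ereal (root n (real (syzygy_top R M n))))"

section \<open>Koszul modules\<close>

text \<open>In a resolution, \<open>d n\<close> is the map \<open>P (n + 1) \<rightarrow> P n\<close> and \<open>p\<close> is the augmentation
  \<open>P 0 \<rightarrow> M\<close>.\<close>

fun resolution_kernel ::
    "('a, 'm) module \<Rightarrow> (nat \<Rightarrow> ('a, 'p) module) \<Rightarrow> (nat \<Rightarrow> 'p \<Rightarrow> 'p) \<Rightarrow> ('p \<Rightarrow> 'm) \<Rightarrow>
      nat \<Rightarrow> ('a, 'p) module" where
  "resolution_kernel M P d p 0 = kernel_module (P 0) M p"
| "resolution_kernel M P d p (Suc n) = kernel_module (P (Suc n)) (P n) (d n)"

definition minimal_projective_resolution ::
    "('a, 'r) ring_scheme \<Rightarrow> ('a, 'm) module \<Rightarrow> (nat \<Rightarrow> ('a, 'p) module) \<Rightarrow>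
      (nat \<Rightarrow> 'p \<Rightarrow> 'p) \<Rightarrow> ('p \<Rightarrow> 'm) \<Rightarrow> bool" where
  "minimal_projective_resolution R M P d p \<longleftrightarrow>
    projective_cover R (P 0) M p \<and>
    (\<forall>n. projective_cover R (P (Suc n)) (resolution_kernel M P d p n) (d n))"

definition graded_piece ::
    "('a, 'r) ring_scheme \<Rightarrow> ('a, 'm) module \<Rightarrow> nat \<Rightarrow> ('a, 'm set) module" where
  "graded_piece R M i = quotient_module (restrict_module M (rad_power R M i)) (rad_power R M (Suc i))"

text \<open>The map into \<open>J\<^sup>j N / J\<^sup>j\<^sup>+\<^sup>1 N\<close> induced on cosets by \<open>f\<close>.\<close>

definition graded_map ::
    "('a, 'r) ring_scheme \<Rightarrow> ('a, 'n) module \<Rightarrow> nat \<Rightarrow> ('m \<Rightarrow> 'n) \<Rightarrow> 'm set \<Rightarrow> 'n set" where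
  "graded_map R N j f C = (\<Union>x\<in>C. rad_power R N (Suc j) +>\<^bsub>N\<^esub> f x)"

text \<open>Exactness of
  \<open>0 \<rightarrow> P\<^sub>n/JP\<^sub>n \<rightarrow> JP\<^sub>n\<^sub>-\<^sub>1/J\<^sup>2P\<^sub>n\<^sub>-\<^sub>1 \<rightarrow> \<dots> \<rightarrow> J\<^sup>nP\<^sub>0/J\<^sup>n\<^sup>+\<^sup>1P\<^sub>0 \<rightarrow> J\<^sup>nM/J\<^sup>n\<^sup>+\<^sup>1M \<rightarrow> 0\<close>.
  The four clauses give exactness, in this order, at \<open>P\<^sub>n/JP\<^sub>n\<close>, at
  \<open>J\<^sup>i\<^sup>+\<^sup>1P\<^sub>m\<^sub>+\<^sub>1/J\<^sup>i\<^sup>+\<^sup>2P\<^sub>m\<^sub>+\<^sub>1\<close> with \<open>n = i + m + 2\<close>, at \<open>J\<^sup>nP\<^sub>0/J\<^sup>n\<^sup>+\<^sup>1P\<^sub>0\<close> with \<open>n \<ge> 1\<close>,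
  and at \<open>J\<^sup>nM/J\<^sup>n\<^sup>+\<^sup>1M\<close>.\<close>

definition koszul_exact ::
    "('a, 'r) ring_scheme \<Rightarrow> ('a, 'm) module \<Rightarrow> (nat \<Rightarrow> ('a, 'p) module) \<Rightarrow>
      (nat \<Rightarrow> 'p \<Rightarrow> 'p) \<Rightarrow> ('p \<Rightarrow> 'm) \<Rightarrow> nat \<Rightarrow> bool" where
  "koszul_exact R M P d p n \<longleftrightarrow>
    (case n of
       0 \<Rightarrow> inj_on (graded_map R M 0 p) (carrier (graded_piece R (P 0) 0))
     | Suc m \<Rightarrow> inj_on (graded_map R (P m) 1 (d m)) (carrier (graded_piece R (P (Suc m)) 0))) \<and>
    (\<forall>i m. n = i + m + 2 \<longrightarrow>
       graded_map R (P (m + 1)) (i + 1) (d (m + 1)) ` carrier (graded_piece R (P (m + 2)) i) =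
       a_kernel (graded_piece R (P (m + 1)) (i + 1)) (graded_piece R (P m) (i + 2))
         (graded_map R (P m) (i + 2) (d m))) \<and>
    (\<forall>m. n = Suc m \<longrightarrow>
       graded_map R (P 0) n (d 0) ` carrier (graded_piece R (P 1) m) =
       a_kernel (graded_piece R (P 0) n) (graded_piece R M n) (graded_map R M n p)) \<and>
    graded_map R M n p ` carrier (graded_piece R (P 0) n) = carrier (graded_piece R M n)"

text \<open>Minimal projective resolutions are unique up to isomorphism, so it does not matter
  which one is used.\<close>

definition koszul_module :: "('a, 'r) ring_scheme \<Rightarrow> ('a, 'm) module \<Rightarrow> bool" where
  "koszul_module R M \<longleftrightarrow>
    (\<exists>(P :: nat \<Rightarrow> ('a, nat \<Rightarrow> 'a) module) d p.
      minimal_projective_resolution R M P d p \<and> (\<forall>n. koszul_exact R M P d p n))"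

definition left_koszul_algebra :: "('a, 'r) ring_scheme \<Rightarrow> bool" where
  "left_koszul_algebra A \<longleftrightarrow> koszul_module A (simple_top A)"

end

(* A module M with J^2 M = 0 is Koszul if and only if every kernel K in a minimal projective
   resolution of M, as a submodule of its projective P, is aligned: J K = J^2 P. If K is the kernel
   of an aligned cover of N by a free module of rank n, then |K/JK| = e n - |JN| and |JK| = a n.
   Hence t_(n+2) = e t_(n+1) - a t_n, and for a > 0 the ratios t_(n+1)/t_n are positive and monotone,
   with a root of x^2 - e x + a as limit; for M = S they start at e, so the limit is the larger root.
   To see that S is Koszul, use 0 -> Omega M -> J^t -> JM -> 0, which is exact on tops because M is
   aligned. As JM is semisimple, its syzygy is a power of J, so the horseshoe construction shows by
   induction on k that the first k kernels over J^t, hence over its summand J = Omega S, are aligned. *)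

theory Submission
  imports Defs "HOL-Analysis.Summation_Tests"
begin

text \<open>Because J^3 = 0, comparing the radical filtration of P_n with that of the kernel inside
  it leaves a single non-trivial degree, J^2P_n. This is why one inclusion per kernel encodes the
  whole family of Koszul complexes. The horseshoe construction gives minimal covers only for
  sequences that are exact on tops; alignment at the left end makes the sequence of kernels exact on
  tops again, so the construction can be iterated. The induction has to treat all powers of J at
  once: the syzygy of JM is J^r, where r is the length of JM and unrelated to t. Depth k + 1 is
  first reached for J^t, whose syzygy is an extension of J^r by the second syzygy of M, and needs
  J^r to depth k only; it descends to J as a summand (t is non-zero because M is) and climbs to
  every power by extensions. For a = 0 the ratios may be undefined. The Betti numbers are then
  geometric from index 1 on, and vanish at index 1 only if M is projective; this case is visible in
  the conclusion.\<close>

lemma abelian_groupI_closed_sub: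
  assumes M: "abelian_group M" and sub: "N \<subseteq> carrier M" "\<zero>\<^bsub>M\<^esub> \<in> N"
    and add: "\<And>x y. x \<in> N \<Longrightarrow> y \<in> N \<Longrightarrow> x \<oplus>\<^bsub>M\<^esub> y \<in> N"
    and neg: "\<And>x. x \<in> N \<Longrightarrow> \<ominus>\<^bsub>M\<^esub> x \<in> N"
  shows "abelian_group (M\<lparr>carrier := N\<rparr>)"
proof -
  interpret abelian_group M by fact
  show ?thesis
  proof (rule abelian_groupI, goal_cases)
    case (6 x)
    then show ?case using sub(1) neg[of x] l_neg[of x] by auto
  qed (use sub in \<open>auto simp: add a_ac subset_iff\<close>)
qed

section \<open>Arithmetic of left modules and submodules\<close>

context left_module
begin

lemma lm: "left_module R M"
  by unfold_locales

lemma smult_zero [simp]: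
  assumes "a \<in> carrier R" shows "a \<odot>\<^bsub>M\<^esub> \<zero>\<^bsub>M\<^esub> = \<zero>\<^bsub>M\<^esub>"
proof -
  have "a \<odot>\<^bsub>M\<^esub> \<zero>\<^bsub>M\<^esub> \<oplus>\<^bsub>M\<^esub> a \<odot>\<^bsub>M\<^esub> \<zero>\<^bsub>M\<^esub> = a \<odot>\<^bsub>M\<^esub> \<zero>\<^bsub>M\<^esub>"
    using smult_r_distr[of a "\<zero>\<^bsub>M\<^esub>" "\<zero>\<^bsub>M\<^esub>"] assms by simp
  then show ?thesis using assms smult_closed[of a "\<zero>\<^bsub>M\<^esub>"] by simp
qed

lemma zero_smult [simp]:
  assumes "x \<in> carrier M" shows "\<zero>\<^bsub>R\<^esub> \<odot>\<^bsub>M\<^esub> x = \<zero>\<^bsub>M\<^esub>"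
proof -
  have "\<zero>\<^bsub>R\<^esub> \<odot>\<^bsub>M\<^esub> x \<oplus>\<^bsub>M\<^esub> \<zero>\<^bsub>R\<^esub> \<odot>\<^bsub>M\<^esub> x = \<zero>\<^bsub>R\<^esub> \<odot>\<^bsub>M\<^esub> x"
    using smult_l_distr[of "\<zero>\<^bsub>R\<^esub>" "\<zero>\<^bsub>R\<^esub>" x] assms by simp
  then show ?thesis using assms smult_closed[of "\<zero>\<^bsub>R\<^esub>" x] by simp
qed

lemma smult_l_minus:
  assumes "a \<in> carrier R" "x \<in> carrier M"
  shows "(\<ominus>\<^bsub>R\<^esub> a) \<odot>\<^bsub>M\<^esub> x = \<ominus>\<^bsub>M\<^esub> (a \<odot>\<^bsub>M\<^esub> x)"
proof -
  have "(\<ominus>\<^bsub>R\<^esub> a) \<odot>\<^bsub>M\<^esub> x \<oplus>\<^bsub>M\<^esub> a \<odot>\<^bsub>M\<^esub> x = \<zero>\<^bsub>M\<^esub>"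
    using smult_l_distr[of "\<ominus>\<^bsub>R\<^esub> a" a x] assms by (simp add: R.l_neg)
  then show ?thesis using assms by (intro M.minus_equality[symmetric]) (auto intro: smult_closed)
qed

lemma minus_one_smult:
  "x \<in> carrier M \<Longrightarrow> (\<ominus>\<^bsub>R\<^esub> \<one>\<^bsub>R\<^esub>) \<odot>\<^bsub>M\<^esub> x = \<ominus>\<^bsub>M\<^esub> x"
  by (simp add: smult_l_minus smult_one)

lemma smult_r_minus:
  assumes "a \<in> carrier R" "x \<in> carrier M"
  shows "a \<odot>\<^bsub>M\<^esub> (\<ominus>\<^bsub>M\<^esub> x) = \<ominus>\<^bsub>M\<^esub> (a \<odot>\<^bsub>M\<^esub> x)"
proof -
  have "a \<odot>\<^bsub>M\<^esub> (\<ominus>\<^bsub>M\<^esub> x) \<oplus>\<^bsub>M\<^esub> a \<odot>\<^bsub>M\<^esub> x = \<zero>\<^bsub>M\<^esub>"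
    using smult_r_distr[of a "\<ominus>\<^bsub>M\<^esub> x" x] assms by (simp add: M.l_neg)
  then show ?thesis using assms by (intro M.minus_equality[symmetric]) (auto intro: smult_closed)
qed

text \<open>Closure under negation, which \<open>submodule\<close> demands, is multiplication by the
  scalar -1. So zero, sums and scalar multiples are all that has to be checked later.\<close>

lemma submodule_iff:
  "submodule N R M \<longleftrightarrow> N \<subseteq> carrier M \<and> \<zero>\<^bsub>M\<^esub> \<in> N \<and>
    (\<forall>x\<in>N. \<forall>y\<in>N. x \<oplus>\<^bsub>M\<^esub> y \<in> N) \<and> (\<forall>a\<in>carrier R. \<forall>x\<in>N. a \<odot>\<^bsub>M\<^esub> x \<in> N)" (is "_ = ?r")
proof
  assume "submodule N R M"
  then interpret submodule N R M .
  show ?r using subset one_closed m_closed smult_closed by auto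
next
  assume r: ?r
  have "\<ominus>\<^bsub>M\<^esub> x \<in> N" if "x \<in> N" for x
    using r that minus_one_smult[of x] by (metis R.a_inv_closed R.one_closed subsetD)
  then show "submodule N R M"
    using r by (unfold_locales) (auto simp: a_inv_def[symmetric])
qed

lemma carrier_submodule [simp]: "submodule (carrier M) R M"
  by (simp add: submodule_iff smult_closed)

lemma zero_submodule [simp]: "submodule {\<zero>\<^bsub>M\<^esub>} R M"
  by (simp add: submodule_iff)

lemma submodule_minus: 
  assumes "submodule N R M" "x \<in> N" shows "\<ominus>\<^bsub>M\<^esub> x \<in> N"
  using assms minus_one_smult[of x] unfolding submodule_iff
  by (metis R.a_inv_closed R.one_closed subsetD)

lemma submodule_diff: 
  assumes "submodule N R M" "x \<in> N" "y \<in> N" shows "x \<ominus>\<^bsub>M\<^esub> y \<in> N"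
  using submodule_minus[OF assms(1,3)] assms unfolding submodule_iff a_minus_def by auto

lemma add_diff_cancel: "x \<in> carrier M \<Longrightarrow> y \<in> carrier M \<Longrightarrow> y \<oplus>\<^bsub>M\<^esub> (x \<ominus>\<^bsub>M\<^esub> y) = x"
  by (simp add: a_minus_def M.a_lcomm M.r_neg)

lemma diff_add_cancel: "x \<in> carrier M \<Longrightarrow> y \<in> carrier M \<Longrightarrow> (x \<ominus>\<^bsub>M\<^esub> y) \<oplus>\<^bsub>M\<^esub> y = x"
  by (simp add: a_minus_def M.a_assoc M.l_neg)

lemma diff_zero_iff: "x \<in> carrier M \<Longrightarrow> y \<in> carrier M \<Longrightarrow> x \<ominus>\<^bsub>M\<^esub> y = \<zero>\<^bsub>M\<^esub> \<longleftrightarrow> x = y"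
  using diff_add_cancel[of x y] M.r_neg[of y] by (auto simp: a_minus_def)

end

lemma restrict_left_module:
  assumes "left_module R M" "submodule N R M" shows "left_module R (restrict_module M N)"
proof -
  interpret left_module R M by fact
  have N: "N \<subseteq> carrier M" "\<zero>\<^bsub>M\<^esub> \<in> N" "\<And>x y. x \<in> N \<Longrightarrow> y \<in> N \<Longrightarrow> x \<oplus>\<^bsub>M\<^esub> y \<in> N"
     "\<And>a x. a \<in> carrier R \<Longrightarrow> x \<in> N \<Longrightarrow> a \<odot>\<^bsub>M\<^esub> x \<in> N"
    using assms by (auto simp: submodule_iff)
  note neg = submodule_minus[OF assms(2)]
  have "abelian_group (M\<lparr>carrier := N\<rparr>)"
    by (rule abelian_groupI_closed_sub) (use N neg M.abelian_group_axioms in auto)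
  then show ?thesis unfolding restrict_module_def
    using N by (intro left_module.intro left_module_axioms.intro)
      (auto simp: R.ring_axioms smult_l_distr smult_r_distr smult_assoc1 smult_one subset_iff)
qed

lemma submodule_restrict:
  assumes "left_module R M" "submodule N R M"
  shows "submodule K R (restrict_module M N) \<longleftrightarrow> submodule K R M \<and> K \<subseteq> N"
proof -
  interpret left_module R M by fact
  interpret N: left_module R "restrict_module M N" by (rule restrict_left_module[OF assms])
  show ?thesis using assms unfolding N.submodule_iff submodule_iff
    by (auto simp: restrict_module_def)
qed

lemma restrict_module_simps [simp]:
  "carrier (restrict_module M N) = N"
  "add (restrict_module M N) = add M"
  "\<zero>\<^bsub>restrict_module M N\<^esub> = \<zero>\<^bsub>M\<^esub>"
  "smult (restrict_module M N) = smult M"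
  "restrict_module (restrict_module M N) K = restrict_module M K"
  by (simp_all add: restrict_module_def)

section \<open>Homomorphisms\<close>

context
  fixes R :: "('a, 'r) ring_scheme"
begin

abbreviation "hom_mod \<equiv> left_module_hom R"

lemma hom_closed: "f \<in> hom_mod M N \<Longrightarrow> x \<in> carrier M \<Longrightarrow> f x \<in> carrier N"
  by (auto simp: left_module_hom_def)

lemma hom_add: "f \<in> hom_mod M N \<Longrightarrow> x \<in> carrier M \<Longrightarrow> y \<in> carrier M \<Longrightarrow>
    f (x \<oplus>\<^bsub>M\<^esub> y) = f x \<oplus>\<^bsub>N\<^esub> f y"
  by (auto simp: left_module_hom_def)

lemma hom_smult: "f \<in> hom_mod M N \<Longrightarrow> a \<in> carrier R \<Longrightarrow> x \<in> carrier M \<Longrightarrow>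
    f (a \<odot>\<^bsub>M\<^esub> x) = a \<odot>\<^bsub>N\<^esub> f x"
  by (auto simp: left_module_hom_def)

lemma homI: 
  assumes "\<And>x. x \<in> carrier M \<Longrightarrow> f x \<in> carrier N"
    "\<And>x y. x \<in> carrier M \<Longrightarrow> y \<in> carrier M \<Longrightarrow> f (x \<oplus>\<^bsub>M\<^esub> y) = f x \<oplus>\<^bsub>N\<^esub> f y"
    "\<And>a x. a \<in> carrier R \<Longrightarrow> x \<in> carrier M \<Longrightarrow> f (a \<odot>\<^bsub>M\<^esub> x) = a \<odot>\<^bsub>N\<^esub> f x"
  shows "f \<in> hom_mod M N"
  using assms by (auto simp: left_module_hom_def)

lemma hom_comp: "f \<in> hom_mod M N \<Longrightarrow> g \<in> hom_mod N K \<Longrightarrow> (\<lambda>x. g (f x)) \<in> hom_mod M K"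
  by (rule homI) (simp_all add: hom_closed hom_add hom_smult)

lemma hom_id: "(\<lambda>x. x) \<in> hom_mod M M"
  by (rule homI; simp)

lemma hom_incl: "N \<subseteq> carrier M \<Longrightarrow> (\<lambda>x. x) \<in> hom_mod (restrict_module M N) M"
  by (rule homI) auto

lemma hom_restrict: "f \<in> hom_mod M N \<Longrightarrow> K \<subseteq> carrier M \<Longrightarrow> f ` K \<subseteq> L \<Longrightarrow>
    f \<in> hom_mod (restrict_module M K) (restrict_module N L)"
  by (rule homI) (auto simp: hom_add hom_smult subset_iff)

lemma hom_restrict2: "f \<in> hom_mod M (restrict_module N L) \<Longrightarrow> L \<subseteq> carrier N \<Longrightarrow> f \<in> hom_mod M N"
  by (rule homI) (auto simp: hom_add hom_smult subset_iff dest: hom_closed)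

lemma hom_into: "f \<in> hom_mod M N \<Longrightarrow> (\<And>x. x \<in> carrier M \<Longrightarrow> f x \<in> L) \<Longrightarrow> f \<in> hom_mod M (restrict_module N L)"
  by (rule homI) (auto simp: hom_add hom_smult subset_iff)

end

lemma hom_zero:
  assumes "left_module R M" "left_module R N" "f \<in> left_module_hom R M N"
  shows "f \<zero>\<^bsub>M\<^esub> = \<zero>\<^bsub>N\<^esub>"
proof -
  interpret M: left_module R M by fact
  interpret N: left_module R N by fact
  have "f \<zero>\<^bsub>M\<^esub> = f (\<zero>\<^bsub>R\<^esub> \<odot>\<^bsub>M\<^esub> \<zero>\<^bsub>M\<^esub>)" by simp
  also have "\<dots> = \<zero>\<^bsub>R\<^esub> \<odot>\<^bsub>N\<^esub> f \<zero>\<^bsub>M\<^esub>" using assms by (intro hom_smult) auto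
  also have "\<dots> = \<zero>\<^bsub>N\<^esub>" using assms hom_closed by (intro N.zero_smult) fastforce
  finally show ?thesis .
qed

lemma hom_minus:
  assumes "left_module R M" "left_module R N" "f \<in> left_module_hom R M N" "x \<in> carrier M"
  shows "f (\<ominus>\<^bsub>M\<^esub> x) = \<ominus>\<^bsub>N\<^esub> f x"
proof -
  interpret M: left_module R M by fact
  interpret N: left_module R N by fact
  have "f ((\<ominus>\<^bsub>R\<^esub> \<one>\<^bsub>R\<^esub>) \<odot>\<^bsub>M\<^esub> x) = (\<ominus>\<^bsub>R\<^esub> \<one>\<^bsub>R\<^esub>) \<odot>\<^bsub>N\<^esub> f x"
    using assms by (intro hom_smult) auto
  then show ?thesis using assms by (simp add: M.minus_one_smult N.minus_one_smult hom_closed)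
qed

lemma hom_diff:
  assumes "left_module R M" "left_module R N" "f \<in> left_module_hom R M N" "x \<in> carrier M" "y \<in> carrier M"
  shows "f (x \<ominus>\<^bsub>M\<^esub> y) = f x \<ominus>\<^bsub>N\<^esub> f y"
proof -
  interpret M: left_module R M by fact
  show ?thesis using assms by (simp add: a_minus_def hom_minus[OF assms(1-3)] hom_add)
qed

lemma a_kernel_eq: "a_kernel M N f = {x \<in> carrier M. f x = \<zero>\<^bsub>N\<^esub>}"
  by (simp add: a_kernel_def kernel_def)

text \<open>The preimage is cut down to a submodule \<open>L\<close>, so that a map can be studied
  on a part of its domain, such as the radical of a free module, without changing the
  record.\<close>

lemma submodule_preimage:
  assumes "left_module R M" "left_module R N" "f \<in> left_module_hom R M N"
    and "submodule L R M" "submodule K R N"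
  shows "submodule {x \<in> L. f x \<in> K} R M"
proof -
  interpret M: left_module R M by fact
  interpret N: left_module R N by fact
  have L: "L \<subseteq> carrier M" "\<zero>\<^bsub>M\<^esub> \<in> L" "\<And>x y. x \<in> L \<Longrightarrow> y \<in> L \<Longrightarrow> x \<oplus>\<^bsub>M\<^esub> y \<in> L"
     "\<And>a x. a \<in> carrier R \<Longrightarrow> x \<in> L \<Longrightarrow> a \<odot>\<^bsub>M\<^esub> x \<in> L"
    using assms(4) by (auto simp: M.submodule_iff)
  have K: "K \<subseteq> carrier N" "\<zero>\<^bsub>N\<^esub> \<in> K" "\<And>x y. x \<in> K \<Longrightarrow> y \<in> K \<Longrightarrow> x \<oplus>\<^bsub>N\<^esub> y \<in> K"
     "\<And>a x. a \<in> carrier R \<Longrightarrow> x \<in> K \<Longrightarrow> a \<odot>\<^bsub>N\<^esub> x \<in> K"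
    using assms(5) by (auto simp: N.submodule_iff)
  show ?thesis unfolding M.submodule_iff
    using L K by (auto simp: hom_zero[OF assms(1-3)] hom_add[OF assms(3)] hom_smult[OF assms(3)] subsetD[OF L(1)])
qed

lemma submodule_kernel:
  assumes "left_module R M" "left_module R N" "f \<in> left_module_hom R M N"
  shows "submodule (a_kernel M N f) R M"
  using submodule_preimage[OF assms left_module.carrier_submodule left_module.zero_submodule] assms(1,2)
  by (simp add: a_kernel_eq)

lemma submodule_image:
  assumes "left_module R M" "left_module R N" "f \<in> left_module_hom R M N"
    and "submodule L R M"
  shows "submodule (f ` L) R N"
proof -
  interpret M: left_module R M by fact
  interpret N: left_module R N by fact
  have L: "L \<subseteq> carrier M" "\<zero>\<^bsub>M\<^esub> \<in> L" "\<And>x y. x \<in> L \<Longrightarrow> y \<in> L \<Longrightarrow> x \<oplus>\<^bsub>M\<^esub> y \<in> L"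
     "\<And>a x. a \<in> carrier R \<Longrightarrow> x \<in> L \<Longrightarrow> a \<odot>\<^bsub>M\<^esub> x \<in> L"
    using assms(4) by (auto simp: M.submodule_iff)
  show ?thesis unfolding N.submodule_iff
  proof (intro conjI ballI)
    show "f ` L \<subseteq> carrier N" using L(1) hom_closed[OF assms(3)] by auto
    show "\<zero>\<^bsub>N\<^esub> \<in> f ` L" using L(2) hom_zero[OF assms(1-3)] by (metis imageI)
  next
    fix x y assume "x \<in> f ` L" "y \<in> f ` L"
    then obtain u v where "u \<in> L" "v \<in> L" "x = f u" "y = f v" by auto
    then have "x \<oplus>\<^bsub>N\<^esub> y = f (u \<oplus>\<^bsub>M\<^esub> v)" "u \<oplus>\<^bsub>M\<^esub> v \<in> L"
      using L(3) by (auto simp: hom_add[OF assms(3)] subsetD[OF L(1)])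
    then show "x \<oplus>\<^bsub>N\<^esub> y \<in> f ` L" by blast
  next
    fix a x assume "x \<in> f ` L" "a \<in> carrier R"
    then obtain u where "u \<in> L" "x = f u" by auto
    then have "a \<odot>\<^bsub>N\<^esub> x = f (a \<odot>\<^bsub>M\<^esub> u)" "a \<odot>\<^bsub>M\<^esub> u \<in> L"
      using L(4) \<open>a \<in> carrier R\<close> by (auto simp: hom_smult[OF assms(3)] subsetD[OF L(1)])
    then show "a \<odot>\<^bsub>N\<^esub> x \<in> f ` L" by blast
  qed
qed

lemma submodule_subset: "left_module R M \<Longrightarrow> submodule N R M \<Longrightarrow> N \<subseteq> carrier M"
  by (simp add: left_module.submodule_iff)

lemma submodule_inter:
  assumes "left_module R M" "submodule K R M" "submodule L R M"
  shows "submodule (K \<inter> L) R M"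
  using assms(2,3) by (auto simp: left_module.submodule_iff[OF assms(1)])

lemma submodule_sum:
  assumes "left_module R M" "submodule K R M" "submodule L R M"
  shows "submodule {x \<oplus>\<^bsub>M\<^esub> y | x y. x \<in> K \<and> y \<in> L} R M"
proof -
  interpret M: left_module R M by fact
  have K: "K \<subseteq> carrier M" "\<zero>\<^bsub>M\<^esub> \<in> K" "\<And>x y. x \<in> K \<Longrightarrow> y \<in> K \<Longrightarrow> x \<oplus>\<^bsub>M\<^esub> y \<in> K"
     "\<And>a x. a \<in> carrier R \<Longrightarrow> x \<in> K \<Longrightarrow> a \<odot>\<^bsub>M\<^esub> x \<in> K"
    and L: "L \<subseteq> carrier M" "\<zero>\<^bsub>M\<^esub> \<in> L" "\<And>x y. x \<in> L \<Longrightarrow> y \<in> L \<Longrightarrow> x \<oplus>\<^bsub>M\<^esub> y \<in> L"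
     "\<And>a x. a \<in> carrier R \<Longrightarrow> x \<in> L \<Longrightarrow> a \<odot>\<^bsub>M\<^esub> x \<in> L"
    using assms(2,3) by (auto simp: M.submodule_iff)
  show ?thesis unfolding M.submodule_iff
  proof (intro conjI ballI)
    show "{x \<oplus>\<^bsub>M\<^esub> y | x y. x \<in> K \<and> y \<in> L} \<subseteq> carrier M" using K(1) L(1) by auto
    show "\<zero>\<^bsub>M\<^esub> \<in> {x \<oplus>\<^bsub>M\<^esub> y | x y. x \<in> K \<and> y \<in> L}" using K(2) L(2) by (auto intro!: exI[of _ "\<zero>\<^bsub>M\<^esub>"])
  next
    fix u v assume "u \<in> {x \<oplus>\<^bsub>M\<^esub> y | x y. x \<in> K \<and> y \<in> L}" "v \<in> {x \<oplus>\<^bsub>M\<^esub> y | x y. x \<in> K \<and> y \<in> L}"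
    then obtain x y x' y' where e: "u = x \<oplus>\<^bsub>M\<^esub> y" "v = x' \<oplus>\<^bsub>M\<^esub> y'" and m: "x \<in> K" "x' \<in> K" "y \<in> L" "y' \<in> L" by auto
    then have c: "x \<in> carrier M" "x' \<in> carrier M" "y \<in> carrier M" "y' \<in> carrier M" using K(1) L(1) by auto
    have "u \<oplus>\<^bsub>M\<^esub> v = (x \<oplus>\<^bsub>M\<^esub> x') \<oplus>\<^bsub>M\<^esub> (y \<oplus>\<^bsub>M\<^esub> y')" using c e by (simp add: M.M.a_ac)
    then show "u \<oplus>\<^bsub>M\<^esub> v \<in> {x \<oplus>\<^bsub>M\<^esub> y | x y. x \<in> K \<and> y \<in> L}" using K(3) L(3) m by blast
  next
    fix a u assume "a \<in> carrier R" "u \<in> {x \<oplus>\<^bsub>M\<^esub> y | x y. x \<in> K \<and> y \<in> L}"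
    then obtain x y where e: "u = x \<oplus>\<^bsub>M\<^esub> y" "x \<in> K" "y \<in> L" by auto
    then have "a \<odot>\<^bsub>M\<^esub> u = a \<odot>\<^bsub>M\<^esub> x \<oplus>\<^bsub>M\<^esub> a \<odot>\<^bsub>M\<^esub> y"
      using K(1) L(1) \<open>a \<in> carrier R\<close> by (simp add: M.smult_r_distr subset_iff)
    then show "a \<odot>\<^bsub>M\<^esub> u \<in> {x \<oplus>\<^bsub>M\<^esub> y | x y. x \<in> K \<and> y \<in> L}" using K(4) L(4) e \<open>a \<in> carrier R\<close> by blast
  qed
qed

lemma kernel_module_left_module:
  assumes "left_module R M" "left_module R N" "f \<in> left_module_hom R M N"
  shows "left_module R (kernel_module M N f)"
  unfolding kernel_module_def by (intro restrict_left_module submodule_kernel assms)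

lemma hom_inj_iff:
  assumes "left_module R M" "left_module R N" "f \<in> left_module_hom R M N"
  shows "inj_on f (carrier M) \<longleftrightarrow> (\<forall>x\<in>carrier M. f x = \<zero>\<^bsub>N\<^esub> \<longrightarrow> x = \<zero>\<^bsub>M\<^esub>)"
proof -
  interpret M: left_module R M by fact
  interpret N: left_module R N by fact
  show ?thesis
  proof
    assume "inj_on f (carrier M)"
    then show "\<forall>x\<in>carrier M. f x = \<zero>\<^bsub>N\<^esub> \<longrightarrow> x = \<zero>\<^bsub>M\<^esub>"
      using hom_zero[OF assms] by (metis M.M.zero_closed inj_onD)
  next
    assume z: "\<forall>x\<in>carrier M. f x = \<zero>\<^bsub>N\<^esub> \<longrightarrow> x = \<zero>\<^bsub>M\<^esub>"
    show "inj_on f (carrier M)"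
    proof (rule inj_onI)
      fix x y assume xy: "x \<in> carrier M" "y \<in> carrier M" "f x = f y"
      then have "f (x \<ominus>\<^bsub>M\<^esub> y) = \<zero>\<^bsub>N\<^esub>"
        using hom_diff[OF assms] hom_closed[OF assms(3)] by (simp add: N.diff_zero_iff)
      then show "x = y" using z xy M.diff_zero_iff M.M.minus_closed by blast
    qed
  qed
qed

section \<open>Length of intervals of submodules\<close>

text \<open>Chains between two submodules stand in for chains in the quotient. The ends are bounded
  by inclusions instead of equations, so an initial segment of a chain is again admissible.\<close>

definition has_chain :: "('a, 'r) ring_scheme \<Rightarrow> ('a, 'm) module \<Rightarrow> 'm set \<Rightarrow> 'm set \<Rightarrow> nat \<Rightarrow> bool" where
  "has_chain R M N L n \<longleftrightarrow> (\<exists>C. submodule_chain R M n C \<and> N \<subseteq> C 0 \<and> C n \<subseteq> L)"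

text \<open>For \<open>N \<subseteq> L\<close> this is the length of L/N, measured inside
  \<open>M\<close>.\<close>

definition ilen :: "('a, 'r) ring_scheme \<Rightarrow> ('a, 'm) module \<Rightarrow> 'm set \<Rightarrow> 'm set \<Rightarrow> enat" where
  "ilen R M N L = (SUP n\<in>{n. has_chain R M N L n}. enat n)"

lemma submodule_chain_le:
  assumes "submodule_chain R M n C" "m \<le> n" shows "submodule_chain R M m C"
  using assms by (auto simp: submodule_chain_def)

lemma submodule_chain_mono:
  assumes "submodule_chain R M n C" "i \<le> j" "j \<le> n" shows "C i \<subseteq> C j"
  using assms(2,3)
proof (induction j rule: dec_induct)
  case (step j)
  then have "C j \<subset> C (Suc j)" using assms(1) by (auto simp: submodule_chain_def)
  with step show ?case by auto
qed simp

lemma has_chain_le: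
  assumes "has_chain R M N L n" "m \<le> n" shows "has_chain R M N L m"
proof -
  obtain C where C: "submodule_chain R M n C" "N \<subseteq> C 0" "C n \<subseteq> L"
    using assms(1) by (auto simp: has_chain_def)
  have "submodule_chain R M m C" "C m \<subseteq> L"
    using submodule_chain_le[OF C(1) assms(2)] submodule_chain_mono[OF C(1) assms(2)] C(3) by auto
  then show ?thesis using C(2) by (auto simp: has_chain_def)
qed

lemma has_chain_0:
  assumes "submodule N R M" "N \<subseteq> L" shows "has_chain R M N L 0"
  unfolding has_chain_def submodule_chain_def
  by (rule exI[of _ "\<lambda>_. N"]) (use assms in auto)

text \<open>Truncation makes the set of chain lengths downward closed, so the supremum, finite or
  infinite, determines which chains exist. Lengths can therefore be compared through finite
  chains.\<close>

lemma has_chain_iff: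
  assumes "submodule N R M" "N \<subseteq> L"
  shows "has_chain R M N L n \<longleftrightarrow> enat n \<le> ilen R M N L"
proof
  assume "has_chain R M N L n"
  then show "enat n \<le> ilen R M N L" unfolding ilen_def by (intro SUP_upper) simp
next
  assume le: "enat n \<le> ilen R M N L"
  show "has_chain R M N L n"
  proof (rule ccontr)
    assume no: "\<not> has_chain R M N L n"
    then have "n \<noteq> 0" using has_chain_0[OF assms] by (metis)
    have "ilen R M N L \<le> enat (n - 1)" unfolding ilen_def
    proof (rule SUP_least)
      fix m assume "m \<in> {n. has_chain R M N L n}"
      then have "m < n" using has_chain_le[of R M N L m n] no by (meson mem_Collect_eq not_le)
      then show "enat m \<le> enat (n - 1)" by simp
    qed
    with le have "enat n \<le> enat (n - 1)" by (rule order_trans)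
    then show False using \<open>n \<noteq> 0\<close> by simp
  qed
qed

lemma ilen_le:
  assumes "\<And>n. has_chain R M N L n \<Longrightarrow> enat n \<le> x" shows "ilen R M N L \<le> x"
  unfolding ilen_def by (rule SUP_least) (use assms in auto)

text \<open>An extended natural number is determined by the natural numbers below it. This and the
  next two facts turn constructions on finite chains into inequalities between possibly infinite
  lengths.\<close>

lemma enat_le_if_nat_le:
  fixes x y :: enat
  assumes "\<And>n. enat n \<le> x \<Longrightarrow> enat n \<le> y" shows "x \<le> y"
proof (cases x)
  case (enat n) then show ?thesis using assms[of n] by simp
next
  case infinity
  then have "enat n \<le> y" for n using assms by simp
  then show ?thesis by (cases y) (simp_all, metis Suc_n_not_le_n enat_ord_simps(1))
qed

lemma enat_plus_one_le:
  fixes x y :: enat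
  assumes "\<And>n. enat n \<le> x \<Longrightarrow> enat (Suc n) \<le> y" shows "x + 1 \<le> y"
proof (rule enat_le_if_nat_le)
  fix n assume n: "enat n \<le> x + 1"
  show "enat n \<le> y"
  proof (cases n)
    case 0
    have "enat 0 \<le> y" by (simp add: zero_enat_def[symmetric])
    then show ?thesis using 0 by simp
  next
    case (Suc m)
    have "enat m \<le> x" using n Suc by (cases x) (auto simp: one_enat_def)
    then show ?thesis using assms Suc by simp
  qed
qed

lemma enat_plus_le:
  fixes x y z :: enat
  assumes "\<And>m n. enat m \<le> x \<Longrightarrow> enat n \<le> y \<Longrightarrow> enat (m + n) \<le> z" shows "x + y \<le> z"
proof (rule enat_le_if_nat_le)
  fix k assume k: "enat k \<le> x + y"
  have "\<exists>m n. enat m \<le> x \<and> enat n \<le> y \<and> k \<le> m + n"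
  proof (cases x)
    case x: (enat m)
    show ?thesis
    proof (cases y)
      case (enat n) then show ?thesis using x k by auto
    next
      case infinity then show ?thesis using x by (intro exI[of _ 0] exI[of _ k]) auto
    qed
  next
    case infinity then show ?thesis
      by (intro exI[of _ k] exI[of _ 0]) (auto simp: zero_enat_def[symmetric])
  qed
  then obtain m n where "enat m \<le> x" "enat n \<le> y" "k \<le> m + n" by blast
  then show "enat k \<le> z" using assms[of m n] by (metis enat_ord_simps(1) order_trans)
qed

lemma enat_Suc_le_add:
  fixes x y :: enat
  assumes "enat n \<le> x + y" shows "enat (Suc n) \<le> x + y + 1"
proof -
  have "enat (Suc n) = enat n + 1" by (simp add: eSuc_enat[symmetric] plus_1_eSuc)
  then show ?thesis using assms by (simp add: add_right_mono)
qed

lemma ilen_mono: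
  assumes "L \<subseteq> L'" shows "ilen R M N L \<le> ilen R M N L'"
  unfolding ilen_def has_chain_def by (rule SUP_subset_mono) (use assms in blast)+

lemma ilen_self [simp]:
  shows "ilen R M N N = 0"
proof -
  have "ilen R M N N \<le> 0"
  proof (rule ilen_le)
    fix n assume "has_chain R M N N n"
    then obtain C where C: "submodule_chain R M n C" "N \<subseteq> C 0" "C n \<subseteq> N"
      by (auto simp: has_chain_def)
    have "n = 0"
    proof (rule ccontr)
      assume "n \<noteq> 0"
      then have "C 0 \<subset> C (Suc 0)" "C (Suc 0) \<subseteq> C n"
        using C(1) submodule_chain_mono[OF C(1), of "Suc 0" n] by (auto simp: submodule_chain_def)
      then show False using C by auto
    qed
    then show "enat n \<le> 0" by (simp add: zero_enat_def)
  qed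
  then show ?thesis by simp
qed

lemma has_chain_Suc:
  assumes "has_chain R M N K n" "submodule L R M" "K \<subset> L"
  shows "has_chain R M N L (Suc n)"
proof -
  obtain C where C: "submodule_chain R M n C" "N \<subseteq> C 0" "C n \<subseteq> K"
    using assms(1) by (auto simp: has_chain_def)
  have "submodule_chain R M (Suc n) (\<lambda>i. if i \<le> n then C i else L)"
    unfolding submodule_chain_def
  proof (intro conjI allI impI)
    fix i assume "i \<le> Suc n"
    then show "submodule (if i \<le> n then C i else L) R M"
      using C(1) assms(2) by (auto simp: submodule_chain_def)
  next
    fix i assume "i < Suc n"
    then show "(if i \<le> n then C i else L) \<subset> (if Suc i \<le> n then C (Suc i) else L)"
      using C(1,3) assms(3) by (cases "i = n") (auto simp: submodule_chain_def)
  qed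
  then show ?thesis unfolding has_chain_def using C(2)
    by (intro exI[of _ "\<lambda>i. if i \<le> n then C i else L"]) auto
qed

lemma ilen_Suc:
  assumes "submodule N R M" "N \<subseteq> K" "submodule L R M" "K \<subset> L"
  shows "ilen R M N K + 1 \<le> ilen R M N L"
proof (rule enat_plus_one_le)
  fix n assume "enat n \<le> ilen R M N K"
  then have "has_chain R M N K n" using has_chain_iff[OF assms(1,2)] by simp
  then have "has_chain R M N L (Suc n)" by (rule has_chain_Suc) (use assms in auto)
  then show "enat (Suc n) \<le> ilen R M N L" using has_chain_iff[of N R M L] assms by auto
qed

lemma has_chain_append:
  assumes "has_chain R M N K m" "has_chain R M K L n"
  shows "has_chain R M N L (m + n)"
proof -
  obtain C where C: "submodule_chain R M m C" "N \<subseteq> C 0" "C m \<subseteq> K"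
    using assms(1) by (auto simp: has_chain_def)
  obtain D where D: "submodule_chain R M n D" "K \<subseteq> D 0" "D n \<subseteq> L"
    using assms(2) by (auto simp: has_chain_def)
  let ?E = "\<lambda>i. if i \<le> m then C i else D (i - m)"
  have "C m \<subseteq> D 0" using C D by auto
  have "submodule_chain R M (m + n) ?E"
    unfolding submodule_chain_def
  proof (intro conjI allI impI)
    fix i assume "i \<le> m + n"
    then show "submodule (?E i) R M"
      using C(1) D(1) by (auto simp: submodule_chain_def)
  next
    fix i assume i: "i < m + n"
    consider "i < m" | "i = m" "0 < n" | "m < i" using i by linarith
    then show "?E i \<subset> ?E (Suc i)"
    proof cases
      case 1 then show ?thesis using C(1) by (auto simp: submodule_chain_def)
    next
      case 2 then have "D 0 \<subset> D (Suc 0)" using D(1) by (auto simp: submodule_chain_def)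
      then show ?thesis using 2 \<open>C m \<subseteq> D 0\<close> by auto
    next
      case 3
      then have "D (i - m) \<subset> D (Suc (i - m))" using D(1) i by (auto simp: submodule_chain_def)
      then show ?thesis using 3 by (simp add: Suc_diff_le)
    qed
  qed
  moreover have "?E (m + n) \<subseteq> L" using C(3) D \<open>C m \<subseteq> D 0\<close> by auto
  ultimately show ?thesis unfolding has_chain_def using C(2)
    by (intro exI[of _ ?E]) auto
qed

context left_module
begin

text \<open>Consequence: a strict inclusion of submodules stays strict after intersecting with
  \<open>N\<close> or after adding \<open>N\<close>. This is what makes length additive.\<close>

lemma modular_law:
  assumes "submodule K R M" "submodule L R M" "K \<subseteq> L" 
    and "L \<inter> N \<subseteq> K" "L \<subseteq> {x \<oplus>\<^bsub>M\<^esub> y | x y. x \<in> K \<and> y \<in> N}" "submodule N R M"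
  shows "L \<subseteq> K"
proof
  fix x assume x: "x \<in> L"
  then obtain y z where yz: "x = y \<oplus>\<^bsub>M\<^esub> z" "y \<in> K" "z \<in> N" using assms(5) by auto
  have c: "y \<in> carrier M" "z \<in> carrier M" "x \<in> carrier M"
    using yz x assms by (auto simp: submodule_iff)
  have "x \<ominus>\<^bsub>M\<^esub> y \<in> L" using submodule_diff[OF assms(2)] x yz assms(3) by auto
  moreover have "x \<ominus>\<^bsub>M\<^esub> y = z"
    using c yz M.a_comm[of y z] by (simp add: a_minus_def M.a_assoc M.r_neg)
  ultimately have "z \<in> K" using yz assms(4) by auto
  then show "x \<in> K" using yz assms(1) by (auto simp: submodule_iff)
qed

end

text \<open>Concatenation of chains gives one inequality. For the other, a chain from
  \<open>N\<close> to \<open>L\<close> is intersected with \<open>K\<close> and also added to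
  \<open>K\<close>; by the modular law each strict step survives on at least one side. No finiteness
  enters, and no Jordan-Hoelder theorem.\<close>

lemma ilen_add:
  assumes M: "left_module R M" and sub: "submodule N R M" "submodule K R M" "submodule L R M"
    and le: "N \<subseteq> K" "K \<subseteq> L"
  shows "ilen R M N L = ilen R M N K + ilen R M K L"
proof (rule antisym)
  interpret left_module R M by fact
  have NL: "N \<subseteq> L" using le by auto
  show "ilen R M N K + ilen R M K L \<le> ilen R M N L"
  proof (rule enat_plus_le)
    fix m n assume "enat m \<le> ilen R M N K" "enat n \<le> ilen R M K L"
    then have "has_chain R M N L (m + n)"
      using has_chain_iff[OF sub(1) le(1)] has_chain_iff[OF sub(2) le(2)] has_chain_append by blast
    then show "enat (m + n) \<le> ilen R M N L" using has_chain_iff[OF sub(1) NL] by simp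
  qed
  let ?s = "\<lambda>U. {x \<oplus>\<^bsub>M\<^esub> y | x y. x \<in> U \<and> y \<in> K}"
  have ssub: "submodule (?s U) R M" if "submodule U R M" for U
    using submodule_sum[OF M that sub(2)] .
  have Ks: "K \<subseteq> ?s U" if "submodule U R M" for U
  proof
    fix x assume "x \<in> K"
    then have "x = \<zero>\<^bsub>M\<^esub> \<oplus>\<^bsub>M\<^esub> x" "\<zero>\<^bsub>M\<^esub> \<in> U" using that sub(2) by (auto simp: submodule_iff)
    then show "x \<in> ?s U" using \<open>x \<in> K\<close> by blast
  qed
  have Us: "U \<subseteq> ?s U" if "submodule U R M" for U
  proof
    fix x assume "x \<in> U"
    then have "x = x \<oplus>\<^bsub>M\<^esub> \<zero>\<^bsub>M\<^esub>" "\<zero>\<^bsub>M\<^esub> \<in> K" using that sub(2) by (auto simp: submodule_iff)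
    then show "x \<in> ?s U" using \<open>x \<in> U\<close> by blast
  qed
  have main: "enat n \<le> ilen R M N (C n \<inter> K) + ilen R M K (?s (C n))"
    if "submodule_chain R M n C" "N \<subseteq> C 0" for n C
    using that
  proof (induction n)
    case 0 show ?case by (simp add: zero_enat_def[symmetric])
  next
    case (Suc n)
    have IH: "enat n \<le> ilen R M N (C n \<inter> K) + ilen R M K (?s (C n))"
      using Suc submodule_chain_le[OF Suc(2), of n] by simp
    have C: "submodule (C n) R M" "submodule (C (Suc n)) R M" "C n \<subset> C (Suc n)"
      using Suc(2) by (auto simp: submodule_chain_def)
    have NC: "N \<subseteq> C n" using submodule_chain_mono[OF Suc(2), of 0 n] Suc(3) by auto
    have le1: "ilen R M N (C n \<inter> K) \<le> ilen R M N (C (Suc n) \<inter> K)"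
      using C by (intro ilen_mono) auto
    have le2: "ilen R M K (?s (C n)) \<le> ilen R M K (?s (C (Suc n)))"
      using C by (intro ilen_mono) auto
    show ?case
    proof (cases "C n \<inter> K = C (Suc n) \<inter> K")
      case False
      then have "C n \<inter> K \<subset> C (Suc n) \<inter> K" using C by auto
      then have "ilen R M N (C n \<inter> K) + 1 \<le> ilen R M N (C (Suc n) \<inter> K)"
        using NC le by (intro ilen_Suc sub submodule_inter M C) auto
      then have "(ilen R M N (C n \<inter> K) + 1) + ilen R M K (?s (C n))
          \<le> ilen R M N (C (Suc n) \<inter> K) + ilen R M K (?s (C (Suc n)))"
        using le2 by (rule add_mono)
      moreover have "enat (Suc n) \<le> (ilen R M N (C n \<inter> K) + 1) + ilen R M K (?s (C n))"
        using enat_Suc_le_add[OF IH] by (simp add: ac_simps)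
      ultimately show ?thesis by (rule order_trans[rotated])
    next
      case True
      have "?s (C n) \<noteq> ?s (C (Suc n))"
      proof
        assume "?s (C n) = ?s (C (Suc n))"
        then have "C (Suc n) \<subseteq> ?s (C n)" using Us[OF C(2)] by simp
        then have "C (Suc n) \<subseteq> C n"
          by (intro modular_law[OF C(1,2) _ _ _ sub(2)]) (use C True in auto)
        then show False using C(3) by auto
      qed
      then have "?s (C n) \<subset> ?s (C (Suc n))" using C(3) by blast
      then have "ilen R M K (?s (C n)) + 1 \<le> ilen R M K (?s (C (Suc n)))"
        by (intro ilen_Suc sub ssub Ks C)
      then have "ilen R M N (C n \<inter> K) + (ilen R M K (?s (C n)) + 1)
          \<le> ilen R M N (C (Suc n) \<inter> K) + ilen R M K (?s (C (Suc n)))"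
        using le1 by (intro add_mono)
      moreover have "enat (Suc n) \<le> ilen R M N (C n \<inter> K) + (ilen R M K (?s (C n)) + 1)"
        using enat_Suc_le_add[OF IH] by (simp add: ac_simps)
      ultimately show ?thesis by (rule order_trans[rotated])
    qed
  qed
  show "ilen R M N L \<le> ilen R M N K + ilen R M K L"
  proof (rule ilen_le)
    fix n assume "has_chain R M N L n"
    then obtain C where C: "submodule_chain R M n C" "N \<subseteq> C 0" "C n \<subseteq> L"
      by (auto simp: has_chain_def)
    have "?s (C n) \<subseteq> L"
      using sub(3) subsetD[OF C(3)] subsetD[OF le(2)] by (auto simp: submodule_iff)
    then have "ilen R M N (C n \<inter> K) + ilen R M K (?s (C n)) \<le> ilen R M N K + ilen R M K L"
      by (intro add_mono ilen_mono) auto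
    with main[OF C(1,2)] show "enat n \<le> ilen R M N K + ilen R M K L" by (rule order_trans)
  qed
qed

text \<open>Correspondence of submodules along f: images and preimages carry strict chains to strict
  chains. The lengths of quotients, of free modules and of isomorphic copies are all read off from
  this identity.\<close>

lemma ilen_hom:
  assumes M: "left_module R M" and N: "left_module R N" and f: "f \<in> left_module_hom R M N"
    and L: "submodule L R M" and K: "submodule K R N" "K \<subseteq> f ` L"
  shows "ilen R M {x \<in> L. f x \<in> K} L = ilen R N K (f ` L)"
proof -
  interpret M: left_module R M by fact
  interpret N: left_module R N by fact
  have Lc: "L \<subseteq> carrier M" using L by (simp add: M.submodule_iff)
  have "has_chain R M {x \<in> L. f x \<in> K} L n \<longleftrightarrow> has_chain R N K (f ` L) n" for n
  proof
    assume "has_chain R M {x \<in> L. f x \<in> K} L n"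
    then obtain C where C: "submodule_chain R M n C" "{x \<in> L. f x \<in> K} \<subseteq> C 0" "C n \<subseteq> L"
      by (auto simp: has_chain_def)
    have CL: "C i \<subseteq> L" "{x \<in> L. f x \<in> K} \<subseteq> C i" if "i \<le> n" for i
      using submodule_chain_mono[OF C(1), of i n] submodule_chain_mono[OF C(1), of 0 i] that C(2,3) by auto
    have "submodule_chain R N n (\<lambda>i. f ` C i)"
      unfolding submodule_chain_def
    proof (intro conjI allI impI)
      fix i assume "i \<le> n"
      then show "submodule (f ` C i) R N"
        using C(1) by (intro submodule_image[OF M N f]) (auto simp: submodule_chain_def)
    next
      fix i assume i: "i < n"
      have s: "submodule (C i) R M" "submodule (C (Suc i)) R M" "C i \<subset> C (Suc i)"
        using C(1) i by (auto simp: submodule_chain_def)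
      have "f ` C i \<noteq> f ` C (Suc i)"
      proof
        assume eq: "f ` C i = f ` C (Suc i)"
        have "C (Suc i) \<subseteq> C i"
        proof
          fix x assume x: "x \<in> C (Suc i)"
          then obtain y where y: "y \<in> C i" "f x = f y" using eq by (metis imageE imageI)
          have xy: "x \<in> L" "y \<in> L" using x y CL(1)[of i] CL(1)[of "Suc i"] i by auto
          then have c: "x \<in> carrier M" "y \<in> carrier M" using Lc by auto
          have "f (x \<ominus>\<^bsub>M\<^esub> y) = \<zero>\<^bsub>N\<^esub>"
            using c y hom_closed[OF f] by (simp add: hom_diff[OF M N f] N.diff_zero_iff)
          \<comment> \<open>The difference lies in the part of \<open>L\<close> that f maps into
            \<open>K\<close>, which every member of the chain contains; hence taking images loses no
            strict step.\<close>
          then have "f (x \<ominus>\<^bsub>M\<^esub> y) \<in> K" using K(1) by (simp add: N.submodule_iff)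
          moreover have "x \<ominus>\<^bsub>M\<^esub> y \<in> L" using M.submodule_diff[OF L] xy by auto
          ultimately have "x \<ominus>\<^bsub>M\<^esub> y \<in> C i" using CL(2)[of i] i by auto
          then have "y \<oplus>\<^bsub>M\<^esub> (x \<ominus>\<^bsub>M\<^esub> y) \<in> C i" using y s(1) by (auto simp: M.submodule_iff)
          then show "x \<in> C i" using c by (simp add: M.add_diff_cancel)
        qed
        then show False using s(3) by auto
      qed
      then show "f ` C i \<subset> f ` C (Suc i)" using s(3) by auto
    qed
    moreover have "K \<subseteq> f ` C 0"
    proof
      fix y assume "y \<in> K"
      moreover then obtain x where "x \<in> L" "y = f x" using K(2) by auto
      ultimately have "x \<in> C 0" using C(2) by auto
      then show "y \<in> f ` C 0" using \<open>y = f x\<close> by auto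
    qed
    moreover have "f ` C n \<subseteq> f ` L" using C(3) by auto
    ultimately show "has_chain R N K (f ` L) n" unfolding has_chain_def by blast
  next
    assume "has_chain R N K (f ` L) n"
    then obtain C where C: "submodule_chain R N n C" "K \<subseteq> C 0" "C n \<subseteq> f ` L"
      by (auto simp: has_chain_def)
    have CL: "C i \<subseteq> f ` L" if "i \<le> n" for i
      using submodule_chain_mono[OF C(1), of i n] that C(3) by auto
    have "submodule_chain R M n (\<lambda>i. {x \<in> L. f x \<in> C i})"
      unfolding submodule_chain_def
    proof (intro conjI allI impI)
      fix i assume "i \<le> n"
      then show "submodule {x \<in> L. f x \<in> C i} R M"
        using C(1) by (intro submodule_preimage[OF M N f L]) (auto simp: submodule_chain_def)
    next
      fix i assume i: "i < n"
      have s: "C i \<subset> C (Suc i)" using C(1) i by (auto simp: submodule_chain_def)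
      then obtain y where "y \<in> C (Suc i)" "y \<notin> C i" by auto
      moreover then obtain x where "x \<in> L" "y = f x" using CL[of "Suc i"] i by auto
      ultimately show "{x \<in> L. f x \<in> C i} \<subset> {x \<in> L. f x \<in> C (Suc i)}" using s by auto
    qed
    then show "has_chain R M {x \<in> L. f x \<in> K} L n" unfolding has_chain_def using C(2) 
      by (intro exI[of _ "\<lambda>i. {x \<in> L. f x \<in> C i}"]) auto
  qed
  then show ?thesis by (simp add: ilen_def)
qed

lemma module_length_ilen:
  assumes "left_module R M" shows "module_length R M = ilen R M {\<zero>\<^bsub>M\<^esub>} (carrier M)"
proof -
  interpret left_module R M by fact
  have "(\<exists>C. submodule_chain R M n C) \<longleftrightarrow> has_chain R M {\<zero>\<^bsub>M\<^esub>} (carrier M) n" for n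
  proof -
    have "{\<zero>\<^bsub>M\<^esub>} \<subseteq> C 0 \<and> C n \<subseteq> carrier M" if "submodule_chain R M n C" for C
    proof -
      have "submodule (C 0) R M" "submodule (C n) R M" using that by (simp_all add: submodule_chain_def)
      then show ?thesis by (simp add: submodule_iff)
    qed
    then show ?thesis unfolding has_chain_def by blast
  qed
  then show ?thesis by (simp add: module_length_def ilen_def)
qed

lemma ilen_eq_0:
  assumes "submodule N R M" "submodule L R M" "N \<subseteq> L" "ilen R M N L = 0"
  shows "N = L"
proof (rule ccontr)
  assume "N \<noteq> L"
  then have "ilen R M N N + 1 \<le> ilen R M N L" using assms by (intro ilen_Suc) auto
  then show False using assms(4) by simp
qed

lemma ilen_restrict:
  assumes M: "left_module R M" and U: "submodule U R M" and sub: "submodule N R M" "submodule L R M"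
    and le: "N \<subseteq> L" "L \<subseteq> U"
  shows "ilen R (restrict_module M U) N L = ilen R M N L"
proof -
  have h: "(\<lambda>x. x) \<in> left_module_hom R (restrict_module M U) M"
    using U M by (intro hom_incl) (simp add: submodule_subset)
  have L: "submodule L R (restrict_module M U)" using submodule_restrict[OF M U] assms by auto
  have "{x \<in> L. x \<in> N} = N" using assms by auto
  then show ?thesis
    using ilen_hom[OF restrict_left_module[OF M U] M h L assms(3)] assms(5) by simp
qed

section \<open>Quotient modules\<close>

lemma coset_eq: "N +>\<^bsub>M\<^esub> x = (\<lambda>n. n \<oplus>\<^bsub>M\<^esub> x) ` N"
  by (auto simp: a_r_coset_def r_coset_def)

lemma cosets_eq: "a_rcosets\<^bsub>M\<^esub> N = (\<lambda>x. N +>\<^bsub>M\<^esub> x) ` carrier M"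
  by (auto simp: A_RCOSETS_def')

lemma quotient_module_simps [simp]:
  "carrier (quotient_module M N) = (\<lambda>x. N +>\<^bsub>M\<^esub> x) ` carrier M"
  "\<zero>\<^bsub>quotient_module M N\<^esub> = N"
  by (simp_all add: quotient_module_def cosets_eq)

context left_module
begin

lemma coset_mem_iff:
  assumes "submodule N R M" "x \<in> carrier M" "y \<in> carrier M"
  shows "y \<in> N +>\<^bsub>M\<^esub> x \<longleftrightarrow> y \<ominus>\<^bsub>M\<^esub> x \<in> N"
proof
  assume "y \<in> N +>\<^bsub>M\<^esub> x"
  then obtain n where "n \<in> N" "y = n \<oplus>\<^bsub>M\<^esub> x" by (auto simp: coset_eq)
  moreover then have "n \<in> carrier M" using assms(1) by (auto simp: submodule_iff)
  ultimately show "y \<ominus>\<^bsub>M\<^esub> x \<in> N" using assms by (simp add: a_minus_def M.a_assoc M.r_neg)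
next
  assume "y \<ominus>\<^bsub>M\<^esub> x \<in> N"
  then show "y \<in> N +>\<^bsub>M\<^esub> x" 
    using diff_add_cancel[OF assms(3,2)] image_eqI[of y "\<lambda>n. n \<oplus>\<^bsub>M\<^esub> x" "y \<ominus>\<^bsub>M\<^esub> x" N] by (simp add: coset_eq)
qed

lemma coset_eq_iff:
  assumes N: "submodule N R M" and x: "x \<in> carrier M" and y: "y \<in> carrier M"
  shows "N +>\<^bsub>M\<^esub> x = N +>\<^bsub>M\<^esub> y \<longleftrightarrow> x \<ominus>\<^bsub>M\<^esub> y \<in> N"
proof
  assume "N +>\<^bsub>M\<^esub> x = N +>\<^bsub>M\<^esub> y"
  moreover have "x \<in> N +>\<^bsub>M\<^esub> x" 
    using x N coset_mem_iff[OF N x x] by (simp add: submodule_iff diff_zero_iff[THEN iffD2])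
  ultimately show "x \<ominus>\<^bsub>M\<^esub> y \<in> N" using coset_mem_iff[OF N y x] by simp
next
  have sub: "N +>\<^bsub>M\<^esub> u \<subseteq> N +>\<^bsub>M\<^esub> v" if uv: "u \<ominus>\<^bsub>M\<^esub> v \<in> N" "u \<in> carrier M" "v \<in> carrier M" for u v
  proof
    fix z assume z: "z \<in> N +>\<^bsub>M\<^esub> u"
    then obtain n where n: "n \<in> N" "z = n \<oplus>\<^bsub>M\<^esub> u" by (auto simp: coset_eq)
    have c: "n \<in> carrier M" using n N by (auto simp: submodule_iff)
    have "z = n \<oplus>\<^bsub>M\<^esub> ((u \<ominus>\<^bsub>M\<^esub> v) \<oplus>\<^bsub>M\<^esub> v)" using n uv by (simp add: diff_add_cancel)
    also have "\<dots> = (n \<oplus>\<^bsub>M\<^esub> (u \<ominus>\<^bsub>M\<^esub> v)) \<oplus>\<^bsub>M\<^esub> v" using c uv by (simp add: M.a_assoc)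
    finally have "z = (n \<oplus>\<^bsub>M\<^esub> (u \<ominus>\<^bsub>M\<^esub> v)) \<oplus>\<^bsub>M\<^esub> v" .
    moreover have "n \<oplus>\<^bsub>M\<^esub> (u \<ominus>\<^bsub>M\<^esub> v) \<in> N" using n uv N by (simp add: submodule_iff)
    ultimately show "z \<in> N +>\<^bsub>M\<^esub> v" by (auto simp: coset_eq)
  qed
  assume d: "x \<ominus>\<^bsub>M\<^esub> y \<in> N"
  then have "\<ominus>\<^bsub>M\<^esub> (x \<ominus>\<^bsub>M\<^esub> y) \<in> N" using N by (rule submodule_minus[rotated])
  then have "y \<ominus>\<^bsub>M\<^esub> x \<in> N" using x y by (simp add: a_minus_def M.minus_add M.a_comm)
  with d show "N +>\<^bsub>M\<^esub> x = N +>\<^bsub>M\<^esub> y" using sub[of x y] sub[of y x] x y by auto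
qed

lemma coset_zero_iff:
  assumes N: "submodule N R M" and x: "x \<in> carrier M"
  shows "N +>\<^bsub>M\<^esub> x = N \<longleftrightarrow> x \<in> N"
proof -
  have "(\<lambda>n. n \<oplus>\<^bsub>M\<^esub> \<zero>\<^bsub>M\<^esub>) ` N = (\<lambda>n. n) ` N" using N 
    by (intro image_cong) (auto simp: submodule_iff)
  then have "N +>\<^bsub>M\<^esub> \<zero>\<^bsub>M\<^esub> = N" by (simp add: coset_eq)
  moreover have "x \<ominus>\<^bsub>M\<^esub> \<zero>\<^bsub>M\<^esub> = x" using add_diff_cancel[OF x M.zero_closed] x by simp
  ultimately show ?thesis using coset_eq_iff[OF N x, of "\<zero>\<^bsub>M\<^esub>"] by simp
qed

lemma coset_add:
  assumes N: "submodule N R M" and x: "x \<in> carrier M" and y: "y \<in> carrier M"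
  shows "(N +>\<^bsub>M\<^esub> x) <+>\<^bsub>M\<^esub> (N +>\<^bsub>M\<^esub> y) = N +>\<^bsub>M\<^esub> (x \<oplus>\<^bsub>M\<^esub> y)"
proof
  have Nc: "n \<in> carrier M" if "n \<in> N" for n using N that by (auto simp: submodule_iff)
  show "(N +>\<^bsub>M\<^esub> x) <+>\<^bsub>M\<^esub> (N +>\<^bsub>M\<^esub> y) \<subseteq> N +>\<^bsub>M\<^esub> (x \<oplus>\<^bsub>M\<^esub> y)"
  proof
    fix z assume "z \<in> (N +>\<^bsub>M\<^esub> x) <+>\<^bsub>M\<^esub> (N +>\<^bsub>M\<^esub> y)"
    then obtain m n where mn: "m \<in> N" "n \<in> N" "z = (m \<oplus>\<^bsub>M\<^esub> x) \<oplus>\<^bsub>M\<^esub> (n \<oplus>\<^bsub>M\<^esub> y)"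
      by (auto simp: set_add_def set_mult_def coset_eq)
    then have "z = (m \<oplus>\<^bsub>M\<^esub> n) \<oplus>\<^bsub>M\<^esub> (x \<oplus>\<^bsub>M\<^esub> y)" using x y Nc by (simp add: M.a_ac)
    moreover have "m \<oplus>\<^bsub>M\<^esub> n \<in> N" using N mn by (simp add: submodule_iff)
    ultimately show "z \<in> N +>\<^bsub>M\<^esub> (x \<oplus>\<^bsub>M\<^esub> y)" by (auto simp: coset_eq)
  qed
  show "N +>\<^bsub>M\<^esub> (x \<oplus>\<^bsub>M\<^esub> y) \<subseteq> (N +>\<^bsub>M\<^esub> x) <+>\<^bsub>M\<^esub> (N +>\<^bsub>M\<^esub> y)"
  proof
    fix z assume "z \<in> N +>\<^bsub>M\<^esub> (x \<oplus>\<^bsub>M\<^esub> y)"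
    then obtain n where n: "n \<in> N" "z = n \<oplus>\<^bsub>M\<^esub> (x \<oplus>\<^bsub>M\<^esub> y)" by (auto simp: coset_eq)
    then have "z = (n \<oplus>\<^bsub>M\<^esub> x) \<oplus>\<^bsub>M\<^esub> (\<zero>\<^bsub>M\<^esub> \<oplus>\<^bsub>M\<^esub> y)" using x y Nc by (simp add: M.a_assoc)
    moreover have "\<zero>\<^bsub>M\<^esub> \<in> N" using N by (simp add: submodule_iff)
    ultimately show "z \<in> (N +>\<^bsub>M\<^esub> x) <+>\<^bsub>M\<^esub> (N +>\<^bsub>M\<^esub> y)" using n
      by (auto simp: set_add_def set_mult_def coset_eq)
  qed
qed

end

text \<open>All members of the union are the same coset. This evaluates \<open>graded_map\<close>,
  which is defined as such a union.\<close>

lemma coset_image_union: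
  assumes M: "left_module R M" and N: "left_module R N" and f: "f \<in> left_module_hom R M N"
    and U: "submodule U R M" and Y: "submodule Y R N" and UY: "f ` U \<subseteq> Y" and x: "x \<in> carrier M"
  shows "(\<Union>u\<in>U +>\<^bsub>M\<^esub> x. Y +>\<^bsub>N\<^esub> f u) = Y +>\<^bsub>N\<^esub> f x"
proof -
  interpret M: left_module R M by fact
  interpret N: left_module R N by fact
  have Uc: "n \<in> carrier M" if "n \<in> U" for n using U that by (auto simp: M.submodule_iff)
  have *: "Y +>\<^bsub>N\<^esub> f u = Y +>\<^bsub>N\<^esub> f x" if "u \<in> U +>\<^bsub>M\<^esub> x" for u
  proof -
    have uc: "u \<in> carrier M" using that Uc x by (auto simp: coset_eq)
    then have "u \<ominus>\<^bsub>M\<^esub> x \<in> U" using M.coset_mem_iff[OF U x] that by simp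
    then have "f (u \<ominus>\<^bsub>M\<^esub> x) \<in> Y" using UY by auto
    then have "f u \<ominus>\<^bsub>N\<^esub> f x \<in> Y" using hom_diff[OF M N f uc x] by simp
    then show ?thesis using N.coset_eq_iff[OF Y] uc x hom_closed[OF f] by simp
  qed
  moreover have "x \<in> U +>\<^bsub>M\<^esub> x" 
    using x U M.coset_mem_iff[OF U x x] by (simp add: M.submodule_iff M.diff_zero_iff[THEN iffD2])
  ultimately show ?thesis by blast
qed

text \<open>The scalar multiplication of a quotient is a union of the same kind, but over a
  non-commutative ring multiplication by \<open>a\<close> is not linear, so the argument has to be
  repeated for it.\<close>

lemma smult_hom_like:
  assumes M: "left_module R M" and N: "submodule N R M" and a: "a \<in> carrier R" and x: "x \<in> carrier M"
  shows "(\<Union>u\<in>N +>\<^bsub>M\<^esub> x. N +>\<^bsub>M\<^esub> (a \<odot>\<^bsub>M\<^esub> u)) = N +>\<^bsub>M\<^esub> (a \<odot>\<^bsub>M\<^esub> x)"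
proof -
  interpret M: left_module R M by fact
  have Nc: "n \<in> carrier M" if "n \<in> N" for n using N that by (auto simp: M.submodule_iff)
  have *: "N +>\<^bsub>M\<^esub> (a \<odot>\<^bsub>M\<^esub> u) = N +>\<^bsub>M\<^esub> (a \<odot>\<^bsub>M\<^esub> x)" if "u \<in> N +>\<^bsub>M\<^esub> x" for u
  proof -
    have uc: "u \<in> carrier M" using that Nc x by (auto simp: coset_eq)
    then have "u \<ominus>\<^bsub>M\<^esub> x \<in> N" using M.coset_mem_iff[OF N x] that by simp
    then have "a \<odot>\<^bsub>M\<^esub> (u \<ominus>\<^bsub>M\<^esub> x) \<in> N" using N a by (simp add: M.submodule_iff)
    then have "(a \<odot>\<^bsub>M\<^esub> u) \<ominus>\<^bsub>M\<^esub> (a \<odot>\<^bsub>M\<^esub> x) \<in> N" using a uc x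
      by (simp add: a_minus_def M.smult_r_distr M.smult_r_minus)
    then show ?thesis using M.coset_eq_iff[OF N] uc x a M.smult_closed by simp
  qed
  moreover have "x \<in> N +>\<^bsub>M\<^esub> x" 
    using x N M.coset_mem_iff[OF N x x] by (simp add: M.submodule_iff M.diff_zero_iff[THEN iffD2])
  ultimately show ?thesis by blast
qed

lemma quotient_add:
  assumes "left_module R M" "submodule N R M" "x \<in> carrier M" "y \<in> carrier M"
  shows "(N +>\<^bsub>M\<^esub> x) \<oplus>\<^bsub>quotient_module M N\<^esub> (N +>\<^bsub>M\<^esub> y) = N +>\<^bsub>M\<^esub> (x \<oplus>\<^bsub>M\<^esub> y)"
  using left_module.coset_add[OF assms] by (simp add: quotient_module_def)

lemma quotient_smult:
  assumes "left_module R M" "submodule N R M" "a \<in> carrier R" "x \<in> carrier M"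
  shows "a \<odot>\<^bsub>quotient_module M N\<^esub> (N +>\<^bsub>M\<^esub> x) = N +>\<^bsub>M\<^esub> (a \<odot>\<^bsub>M\<^esub> x)"
  using smult_hom_like[OF assms] by (simp add: quotient_module_def)

lemma quotient_left_module:
  assumes M: "left_module R M" and N: "submodule N R M"
  shows "left_module R (quotient_module M N)"
proof -
  interpret M: left_module R M by fact
  have zero: "N = N +>\<^bsub>M\<^esub> \<zero>\<^bsub>M\<^esub>" using M.coset_zero_iff[OF N, of "\<zero>\<^bsub>M\<^esub>"] N by (simp add: M.submodule_iff)
  note s = quotient_add[OF M N] quotient_smult[OF M N] M.smult_closed
  have zin: "N \<in> (\<lambda>x. N +>\<^bsub>M\<^esub> x) ` carrier M" using zero M.M.zero_closed by blast
  have ab: "abelian_group (quotient_module M N)"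
  proof (rule abelian_groupI, goal_cases)
    case (1 x y) then show ?case by (auto simp: s)
  next
    case 2 show ?case using zin by simp
  next
    case (3 x y z) then show ?case by (auto simp: s M.M.a_assoc)
  next
    case (4 x y) then show ?case by (auto simp: s M.M.a_comm)
  next
    case (5 x)
    then obtain u where u: "u \<in> carrier M" "x = N +>\<^bsub>M\<^esub> u" by auto
    have "(N +>\<^bsub>M\<^esub> \<zero>\<^bsub>M\<^esub>) \<oplus>\<^bsub>quotient_module M N\<^esub> x = x" using u by (simp add: s)
    then show ?case using zero by simp
  next
    case (6 x)
    then obtain u where u: "u \<in> carrier M" "x = N +>\<^bsub>M\<^esub> u" by auto
    have "(N +>\<^bsub>M\<^esub> (\<ominus>\<^bsub>M\<^esub> u)) \<oplus>\<^bsub>quotient_module M N\<^esub> x = N" using u zero by (simp add: s M.M.l_neg)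
    then show ?case using u by (intro bexI[of _ "N +>\<^bsub>M\<^esub> (\<ominus>\<^bsub>M\<^esub> u)"]) auto
  qed
  show ?thesis
    by (rule left_module.intro[OF M.R.ring_axioms ab], rule left_module_axioms.intro)
      (auto simp: s M.smult_l_distr M.smult_r_distr M.smult_assoc1 M.smult_one)
qed

lemma quotient_hom:
  assumes M: "left_module R M" and N: "submodule N R M"
  shows "(\<lambda>x. N +>\<^bsub>M\<^esub> x) \<in> left_module_hom R M (quotient_module M N)"
  by (rule homI) (auto simp: quotient_add[OF M N] quotient_smult[OF M N])

lemma module_length_quotient:
  assumes M: "left_module R M" and N: "submodule N R M"
  shows "module_length R (quotient_module M N) = ilen R M N (carrier M)"
proof -
  interpret M: left_module R M by fact
  interpret Q: left_module R "quotient_module M N" using quotient_left_module[OF M N] .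
  have Nc: "N \<subseteq> carrier M" using N by (simp add: M.submodule_iff)
  have "{x \<in> carrier M. N +>\<^bsub>M\<^esub> x \<in> {\<zero>\<^bsub>quotient_module M N\<^esub>}} = N"
    using Nc M.coset_zero_iff[OF N] by auto
  moreover have "{\<zero>\<^bsub>quotient_module M N\<^esub>} \<subseteq> (\<lambda>x. N +>\<^bsub>M\<^esub> x) ` carrier M"
    using Q.M.zero_closed by simp
  ultimately show ?thesis
    using ilen_hom[OF M Q.lm quotient_hom[OF M N] M.carrier_submodule Q.zero_submodule]
    by (simp add: module_length_ilen[OF Q.lm])
qed

section \<open>Multiplication by the radical\<close>

text \<open>This is the product J U, one step of \<open>rad_power\<close>, for an arbitrary subset:
  it is applied to kernels and images inside a larger module.\<close>

definition rmul :: "('a, 'r) ring_scheme \<Rightarrow> ('a, 'm) module \<Rightarrow> 'm set \<Rightarrow> 'm set" where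
  "rmul R M U = generate (add_monoid M) {a \<odot>\<^bsub>M\<^esub> x | a x. a \<in> jradical R \<and> x \<in> U}"

lemma rad_power_Suc: "rad_power R M (Suc i) = rmul R M (rad_power R M i)"
  by (simp add: rmul_def)

declare rad_power.simps(2) [simp del]

lemma rmul_smult: "a \<in> jradical R \<Longrightarrow> x \<in> U \<Longrightarrow> a \<odot>\<^bsub>M\<^esub> x \<in> rmul R M U"
  unfolding rmul_def by (rule generate.incl) blast

lemma regular_module_simps [simp]:
  "carrier (regular_module R) = carrier R"
  "add (regular_module R) = add R"
  "smult (regular_module R) = monoid.mult R"
  "\<zero>\<^bsub>regular_module R\<^esub> = \<zero>\<^bsub>R\<^esub>"
  by (simp_all add: regular_module_def)

lemma (in ring) regular_left_module: "left_module R (regular_module R)"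
proof -
  have "abelian_group (regular_module R)"
  proof (rule abelian_groupI, goal_cases)
    case (6 x) then show ?case by (intro bexI[of _ "\<ominus> x"]) (simp_all add: l_neg)
  qed (simp_all add: a_ac)
  then show ?thesis
    by (intro left_module.intro left_module_axioms.intro ring_axioms)
      (simp_all add: l_distr r_distr m_assoc)
qed

section \<open>Free modules of finite rank\<close>

abbreviation "tuples n A \<equiv> {..<n::nat} \<rightarrow>\<^sub>E A"

lemma free_module_simps:
  "carrier (free_module R n) = tuples n (carrier R)"
  "\<zero>\<^bsub>free_module R n\<^esub> = (\<lambda>i\<in>{..<n}. \<zero>\<^bsub>R\<^esub>)"
  "x \<oplus>\<^bsub>free_module R n\<^esub> y = (\<lambda>i\<in>{..<n}. x i \<oplus>\<^bsub>R\<^esub> y i)"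
  "a \<odot>\<^bsub>free_module R n\<^esub> x = (\<lambda>i\<in>{..<n}. a \<otimes>\<^bsub>R\<^esub> x i)"
  by (simp_all add: free_module_def)

lemma free_eqI:
  assumes "f \<in> tuples n A" "g \<in> tuples n B" "\<And>i. i < n \<Longrightarrow> f i = g i"
  shows "f = g"
proof
  fix i show "f i = g i"
    using assms PiE_arb[OF assms(1), of i] PiE_arb[OF assms(2), of i] by (cases "i < n") auto
qed

context ring
begin

lemma free_left_module: "left_module R (free_module R n)"
proof -
  have "abelian_group (free_module R n)"
  proof (rule abelian_groupI, goal_cases)
    case (6 x) then show ?case
      by (intro bexI[of _ "\<lambda>i\<in>{..<n}. \<ominus> x i"]) (auto simp: free_module_simps l_neg PiE_iff)
  next
    case (5 x)
    then show ?case by (intro free_eqI[of _ n "carrier R" _ "carrier R"]) (auto simp: free_module_simps PiE_iff)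
  qed (auto simp: free_module_simps PiE_iff a_ac)
  then show ?thesis
    by (rule left_module.intro[OF ring_axioms], intro left_module_axioms.intro)
      (auto simp: free_module_simps PiE_iff l_distr r_distr m_assoc extensional_def split: if_splits
         intro!: free_eqI[of _ n "carrier R" _ "carrier R"])
qed

text \<open>Each coordinate of the result is a coordinate of the argument or zero, as
  \<open>s\<close> prescribes. Inclusions, projections and the insertion of a zero are instances, so
  linearity is proved once.\<close>

definition recoord :: "nat \<Rightarrow> (nat \<Rightarrow> nat option) \<Rightarrow> (nat \<Rightarrow> 'a) \<Rightarrow> nat \<Rightarrow> 'a" where
  "recoord m s f = (\<lambda>i\<in>{..<m}. case s i of None \<Rightarrow> \<zero> | Some j \<Rightarrow> f j)"

lemma recoord_mem:
  assumes "\<And>i j. i < m \<Longrightarrow> s i = Some j \<Longrightarrow> j < n" "f \<in> tuples n A" "\<zero> \<in> A"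
  shows "recoord m s f \<in> tuples m A"
  using assms by (auto simp: recoord_def PiE_iff split: option.split)

lemma recoord_hom:
  assumes "\<And>i j. i < m \<Longrightarrow> s i = Some j \<Longrightarrow> j < n"
  shows "recoord m s \<in> left_module_hom R (free_module R n) (free_module R m)"
proof (rule homI, goal_cases)
  case (1 x) then show ?case using recoord_mem[OF assms, where f=x and A="carrier R"] by (simp add: free_module_simps)
next
  case (2 x y)
  show ?case using assms
    by (fastforce simp: recoord_def free_module_simps split: option.split)
next
  case (3 a x)
  then show ?case using assms
    by (fastforce simp: recoord_def free_module_simps split: option.split)
qed

definition single :: "nat \<Rightarrow> nat \<Rightarrow> 'a \<Rightarrow> nat \<Rightarrow> 'a" where
  "single n i c = (\<lambda>j\<in>{..<n}. if j = i then c else \<zero>)"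

lemma single_mem: "c \<in> A \<Longrightarrow> \<zero> \<in> A \<Longrightarrow> single n i c \<in> tuples n A"
  by (auto simp: single_def)

lemma single_hom: "single n i \<in> left_module_hom R (regular_module R) (free_module R n)"
  by (rule homI) (auto simp: single_def free_module_simps)

lemma eval_hom: "i < n \<Longrightarrow> (\<lambda>f. f i) \<in> left_module_hom R (free_module R n) (regular_module R)"
  by (rule homI) (auto simp: free_module_simps)

abbreviation ext where "ext m n \<equiv> recoord n (\<lambda>i. if i < m then Some i else None)"
abbreviation trunc where "trunc m \<equiv> recoord m Some"

lemma trunc_hom: "m \<le> n \<Longrightarrow> trunc m \<in> left_module_hom R (free_module R n) (free_module R m)"
  by (rule recoord_hom) auto

lemma ext_hom: "ext m n \<in> left_module_hom R (free_module R m) (free_module R n)"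
  by (rule recoord_hom) (auto split: if_splits)

lemma free_Suc_decomp:
  assumes "c \<in> carrier (free_module R (Suc n))"
  shows "c = ext n (Suc n) (trunc n c) \<oplus>\<^bsub>free_module R (Suc n)\<^esub>
      (c n \<odot>\<^bsub>free_module R (Suc n)\<^esub> single (Suc n) n \<one>)"
  using assms 
  by (intro free_eqI[of _ "Suc n" "carrier R" _ "carrier R"])
     (auto simp: free_module_simps single_def recoord_def PiE_iff less_Suc_eq)

lemma hom_free_Suc:
  assumes "left_module R M" "\<phi> \<in> left_module_hom R (free_module R n) M" "y \<in> carrier M"
  shows "(\<lambda>c. \<phi> (trunc n c) \<oplus>\<^bsub>M\<^esub> c n \<odot>\<^bsub>M\<^esub> y) \<in> left_module_hom R (free_module R (Suc n)) M"
proof -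
  interpret M: left_module R M by fact
  let ?F = "free_module R (Suc n)"
  have t: "trunc n \<in> left_module_hom R ?F (free_module R n)" by (rule trunc_hom) simp
  have ev: "(\<lambda>f. f n) \<in> left_module_hom R ?F (regular_module R)" by (rule eval_hom) simp
  have ph: "(\<lambda>c. \<phi> (trunc n c)) \<in> left_module_hom R ?F M" using hom_comp[OF t assms(2)] .
  have c1: "c n \<in> carrier R" if "c \<in> carrier ?F" for c using hom_closed[OF ev that] by simp
  show ?thesis
  proof (rule homI, goal_cases)
    case (1 x) then show ?case using hom_closed[OF ph 1] c1[OF 1] assms(3) M.smult_closed by simp
  next
    case (2 x y')
    have e: "(x \<oplus>\<^bsub>?F\<^esub> y') n = x n \<oplus> y' n" using hom_add[OF ev 2] by simp
    show ?case using 2 unfolding e hom_add[OF ph 2] 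
      using hom_closed[OF ph 2(1)] hom_closed[OF ph 2(2)] c1[OF 2(1)] c1[OF 2(2)] assms(3) M.smult_closed
      by (simp add: M.smult_l_distr M.M.a_ac)
  next
    case (3 a x)
    have e: "(a \<odot>\<^bsub>?F\<^esub> x) n = a \<otimes> x n" using hom_smult[OF ev 3] by simp
    show ?case using 3 unfolding e hom_smult[OF ph 3]
      using hom_closed[OF ph 3(2)] c1[OF 3(2)] assms(3) M.smult_closed
      by (simp add: M.smult_assoc1 M.smult_r_distr)
  qed
qed

text \<open>Projectivity of free modules, by choosing an image for one basis vector at a time. Only
  the values of \<pi> have to lie in the image of g, so lifts along non-surjective maps are covered
  too.\<close>

lemma free_lift:
  assumes "left_module R M" "left_module R N" "g \<in> left_module_hom R M N"
    and "\<pi> \<in> left_module_hom R (free_module R n) N"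
    and "\<And>c. c \<in> carrier (free_module R n) \<Longrightarrow> \<pi> c \<in> g ` carrier M"
  shows "\<exists>\<phi>\<in>left_module_hom R (free_module R n) M. \<forall>c\<in>carrier (free_module R n). g (\<phi> c) = \<pi> c"
  using assms(4,5)
proof (induction n arbitrary: \<pi>)
  case 0
  interpret M: left_module R M by fact
  have *: "c = \<zero>\<^bsub>free_module R 0\<^esub>" if "c \<in> carrier (free_module R 0)" for c
    using that by (auto simp: free_module_simps)
  have "(\<lambda>_. \<zero>\<^bsub>M\<^esub>) \<in> left_module_hom R (free_module R 0) M" by (rule homI) auto
  moreover have "g \<zero>\<^bsub>M\<^esub> = \<pi> c" if "c \<in> carrier (free_module R 0)" for c
    using hom_zero[OF assms(1-3)] hom_zero[OF free_left_module assms(2) 0(1)] *[OF that] by simp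
  ultimately show ?case by (intro bexI[of _ "\<lambda>_. \<zero>\<^bsub>M\<^esub>"] ballI)
next
  case (Suc n)
  interpret M: left_module R M by fact
  let ?F = "free_module R (Suc n)" and ?e = "single (Suc n) n \<one>"
  have E: "ext n (Suc n) \<in> left_module_hom R (free_module R n) ?F" by (rule ext_hom)
  have T: "trunc n \<in> left_module_hom R ?F (free_module R n)" by (rule trunc_hom) simp
  have e: "?e \<in> carrier ?F" using single_mem[of \<one> "carrier R"] by (simp add: free_module_simps)
  obtain \<phi>' where \<phi>': "\<phi>' \<in> left_module_hom R (free_module R n) M"
      "\<And>c. c \<in> carrier (free_module R n) \<Longrightarrow> g (\<phi>' c) = \<pi> (ext n (Suc n) c)"
    using Suc.IH[OF hom_comp[OF E Suc.prems(1)]] Suc.prems(2) hom_closed[OF E] by blast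
  obtain y where y: "y \<in> carrier M" "g y = \<pi> ?e" using Suc.prems(2)[OF e] by auto
  have "g (\<phi>' (trunc n c) \<oplus>\<^bsub>M\<^esub> c n \<odot>\<^bsub>M\<^esub> y) = \<pi> c" if c: "c \<in> carrier ?F" for c
  proof -
    have cn: "c n \<in> carrier R" using c by (auto simp: free_module_simps)
    have t: "trunc n c \<in> carrier (free_module R n)" using hom_closed[OF T c] .
    interpret F: left_module R ?F by (rule free_left_module)
    have "g (\<phi>' (trunc n c) \<oplus>\<^bsub>M\<^esub> c n \<odot>\<^bsub>M\<^esub> y) = \<pi> (ext n (Suc n) (trunc n c)) \<oplus>\<^bsub>N\<^esub> c n \<odot>\<^bsub>N\<^esub> \<pi> ?e"
      using t cn y hom_closed[OF \<phi>'(1)]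
      by (simp add: hom_add[OF assms(3)] hom_smult[OF assms(3)] \<phi>'(2) M.smult_closed)
    also have "\<dots> = \<pi> (ext n (Suc n) (trunc n c) \<oplus>\<^bsub>?F\<^esub> c n \<odot>\<^bsub>?F\<^esub> ?e)"
      using t cn e hom_closed[OF E]
      by (simp add: hom_add[OF Suc.prems(1)] hom_smult[OF Suc.prems(1)] F.smult_closed)
    finally show ?thesis using free_Suc_decomp[OF c] by simp
  qed
  then show ?case by (intro bexI[OF _ hom_free_Suc[OF assms(1) \<phi>'(1) y(1)]] ballI)
qed

lemma free_projective: "projective_module R (free_module R n)"
  unfolding projective_module_def
  by (intro conjI free_left_module exI[of _ n] bexI[of _ "\<lambda>x. x"] hom_id) simp

definition fin_gen :: "('a, 'm) module \<Rightarrow> bool" where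
  "fin_gen M \<longleftrightarrow> (\<exists>n. \<exists>\<pi>\<in>left_module_hom R (free_module R n) M. \<pi> ` carrier (free_module R n) = carrier M)"

text \<open>Minimality is expressed by the kernel lying in J F; by the Nakayama argument below this
  makes the map a projective cover, and every projective cover has this form up to isomorphism
  (\<open>cover_free\<close>).\<close>

definition fcover :: "('a, 'm) module \<Rightarrow> nat \<Rightarrow> ((nat \<Rightarrow> 'a) \<Rightarrow> 'm) \<Rightarrow> bool" where
  "fcover M n \<pi> \<longleftrightarrow> \<pi> \<in> left_module_hom R (free_module R n) M \<and>
     \<pi> ` carrier (free_module R n) = carrier M \<and>
     a_kernel (free_module R n) M \<pi> \<subseteq> tuples n (jradical R)"

end

section \<open>Local rings with radical of cube zero\<close>

text \<open>The ground field enters through these consequences alone: J is a two-sided ideal,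
  elements outside J are left invertible, and triple products in J vanish. They are derived in
  \<open>short_local_algebra_cube_zero\<close>.\<close>

locale cube_zero_local = ring R for R :: "('a, 'r) ring_scheme" (structure) +
  assumes J_submodule: "submodule (jradical R) R (regular_module R)"
    and J_mult_right: "a \<in> jradical R \<Longrightarrow> b \<in> carrier R \<Longrightarrow> a \<otimes> b \<in> jradical R"
    and J_unit: "c \<in> carrier R \<Longrightarrow> c \<notin> jradical R \<Longrightarrow> \<exists>u\<in>carrier R. u \<otimes> c = \<one>"
    and one_notin_J: "\<one> \<notin> jradical R"
    and J_cube: "a \<in> jradical R \<Longrightarrow> b \<in> jradical R \<Longrightarrow> c \<in> jradical R \<Longrightarrow> a \<otimes> (b \<otimes> c) = \<zero>"
begin

abbreviation "J \<equiv> jradical R"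
abbreviation "Ker n M \<pi> \<equiv> a_kernel (free_module R n) M \<pi>"
abbreviation "Syz n M \<pi> \<equiv> kernel_module (free_module R n) M \<pi>"
abbreviation "reg \<equiv> regular_module R"
abbreviation "free \<equiv> free_module R"
abbreviation "Hom M N \<equiv> left_module_hom R M N"
abbreviation "J2 \<equiv> rmul R reg J"

lemma J_carrier: "a \<in> J \<Longrightarrow> a \<in> carrier R"
  using submodule_subset[OF regular_left_module J_submodule] by auto

lemma J_zero: "\<zero> \<in> J" and J_add: "a \<in> J \<Longrightarrow> b \<in> J \<Longrightarrow> a \<oplus> b \<in> J"
  and J_mult_left: "a \<in> carrier R \<Longrightarrow> b \<in> J \<Longrightarrow> a \<otimes> b \<in> J"
  using J_submodule unfolding left_module.submodule_iff[OF regular_left_module] by auto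

lemma J_minus: "a \<in> J \<Longrightarrow> \<ominus> a \<in> J"
  using J_mult_left[of "\<ominus> \<one>" a] J_carrier[of a] by (simp add: l_minus)

text \<open>The generated group also contains inverses of generators, but the negative of
  \<open>a x\<close> is \<open>(-a) x\<close> with -a in J, so generators and sums suffice.\<close>

lemma rmul_induct [consumes 3, case_names zero smult add]:
  assumes "left_module R M" "U \<subseteq> carrier M" "x \<in> rmul R M U"
    and "P \<zero>\<^bsub>M\<^esub>" "\<And>a x. a \<in> J \<Longrightarrow> x \<in> U \<Longrightarrow> P (a \<odot>\<^bsub>M\<^esub> x)"
    and "\<And>x y. x \<in> carrier M \<Longrightarrow> y \<in> carrier M \<Longrightarrow> P x \<Longrightarrow> P y \<Longrightarrow> P (x \<oplus>\<^bsub>M\<^esub> y)"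
  shows "P x"
proof -
  interpret M: left_module R M by fact
  have "P x \<and> x \<in> carrier M" using assms(3) unfolding rmul_def
  proof (induction rule: generate.induct)
    case one then show ?case using assms(4) by simp
  next
    case (incl h) then show ?case using assms(2,5) J_carrier M.smult_closed by auto
  next
    case (inv h)
    then obtain a u where "h = a \<odot>\<^bsub>M\<^esub> u" "a \<in> J" "u \<in> U" by auto
    moreover then have "u \<in> carrier M" using assms(2) by auto
    ultimately have "inv\<^bsub>add_monoid M\<^esub> h = (\<ominus> a) \<odot>\<^bsub>M\<^esub> u" 
      using M.smult_l_minus[of a u] J_carrier by (simp add: a_inv_def)
    then show ?case using assms(5)[of "\<ominus> a" u] \<open>a \<in> J\<close> \<open>u \<in> U\<close> \<open>u \<in> carrier M\<close> J_minus J_carrier M.smult_closed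
      by simp
  next
    case (eng h1 h2) then show ?case using assms(6) by simp
  qed
  then show ?thesis ..
qed

lemma rmul_submodule:
  assumes "left_module R M" "U \<subseteq> carrier M" shows "submodule (rmul R M U) R M"
proof -
  interpret M: left_module R M by fact
  have car: "x \<in> carrier M" if "x \<in> rmul R M U" for x
    using assms that by (induction rule: rmul_induct) (use assms(2) J_carrier M.smult_closed in auto)
  have z: "\<zero>\<^bsub>M\<^esub> \<in> rmul R M U" unfolding rmul_def using generate.one[of "add_monoid M"] by simp
  have add: "x \<oplus>\<^bsub>M\<^esub> y \<in> rmul R M U" if "x \<in> rmul R M U" "y \<in> rmul R M U" for x y
    using that unfolding rmul_def using generate.eng[of x "add_monoid M" _ y] by simp
  have "b \<odot>\<^bsub>M\<^esub> x \<in> rmul R M U \<and> x \<in> carrier M" if "b \<in> carrier R" "x \<in> rmul R M U" for x b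
    using assms that(2)
  proof (induction rule: rmul_induct)
    case zero then show ?case using z that(1) by simp
  next
    case (smult a x)
    then have x: "x \<in> carrier M" using assms(2) by auto
    then have "b \<odot>\<^bsub>M\<^esub> (a \<odot>\<^bsub>M\<^esub> x) = (b \<otimes> a) \<odot>\<^bsub>M\<^esub> x"
      using that(1) smult J_carrier by (simp add: M.smult_assoc1)
    moreover have "(b \<otimes> a) \<odot>\<^bsub>M\<^esub> x \<in> rmul R M U"
      using smult that(1) by (intro rmul_smult J_mult_left)
    ultimately show ?case using x smult J_carrier M.smult_closed by simp
  next
    case (add x y)
    then show ?case using \<open>\<And>x y. x \<in> rmul R M U \<Longrightarrow> y \<in> rmul R M U \<Longrightarrow> x \<oplus>\<^bsub>M\<^esub> y \<in> rmul R M U\<close> that(1)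
      by (simp add: M.smult_r_distr)
  qed
  then show ?thesis unfolding M.submodule_iff using car z add by auto
qed

lemma rmul_least:
  assumes "left_module R M" "U \<subseteq> carrier M" "submodule N R M"
    and "\<And>a x. a \<in> J \<Longrightarrow> x \<in> U \<Longrightarrow> a \<odot>\<^bsub>M\<^esub> x \<in> N"
  shows "rmul R M U \<subseteq> N"
proof
  interpret M: left_module R M by fact
  fix x assume "x \<in> rmul R M U"
  with assms(1,2) show "x \<in> N"
    by (induction rule: rmul_induct) (use assms(3,4) in \<open>auto simp: M.submodule_iff\<close>)
qed

lemma rmul_carrier:
  assumes "left_module R M" "U \<subseteq> carrier M" shows "rmul R M U \<subseteq> carrier M"
  using rmul_submodule[OF assms] submodule_subset[OF assms(1)] by simp

lemma rmul_subset:
  assumes "left_module R M" "submodule U R M" shows "rmul R M U \<subseteq> U"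
  using assms submodule_subset[OF assms] J_carrier
  by (intro rmul_least) (auto simp: left_module.submodule_iff)

lemma rmul_mono:
  assumes "left_module R M" "V \<subseteq> carrier M" "U \<subseteq> V" shows "rmul R M U \<subseteq> rmul R M V"
  using assms by (intro rmul_least rmul_submodule) (auto intro: rmul_smult)

lemma rmul_hom:
  assumes M: "left_module R M" and N: "left_module R N" and f: "f \<in> Hom M N" and U: "U \<subseteq> carrier M"
  shows "f ` rmul R M U = rmul R N (f ` U)"
proof
  interpret M: left_module R M by fact
  interpret N: left_module R N by fact
  have fU: "f ` U \<subseteq> carrier N" using U hom_closed[OF f] by auto
  have "submodule {x \<in> carrier M. f x \<in> rmul R N (f ` U)} R M"
    by (intro submodule_preimage[OF M N f] rmul_submodule N fU) simp
  then have "rmul R M U \<subseteq> {x \<in> carrier M. f x \<in> rmul R N (f ` U)}"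
    using U by (intro rmul_least M)
      (auto simp: hom_smult[OF f] J_carrier subset_iff intro: rmul_smult M.smult_closed)
  then show "f ` rmul R M U \<subseteq> rmul R N (f ` U)" by auto
  show "rmul R N (f ` U) \<subseteq> f ` rmul R M U"
  proof (rule rmul_least[OF N fU submodule_image[OF M N f rmul_submodule[OF M U]]])
    fix a x assume a: "a \<in> J" "x \<in> f ` U"
    then obtain u where u: "u \<in> U" "x = f u" by auto
    then have "a \<odot>\<^bsub>N\<^esub> x = f (a \<odot>\<^bsub>M\<^esub> u)" using U a by (simp add: hom_smult[OF f] J_carrier subset_iff)
    then show "a \<odot>\<^bsub>N\<^esub> x \<in> f ` rmul R M U" using rmul_smult[OF a(1) u(1)] by auto
  qed
qed

lemma rmul_restrict:
  assumes M: "left_module R M" and N: "submodule N R M" and U: "U \<subseteq> N"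
  shows "rmul R (restrict_module M N) U = rmul R M U"
  using rmul_hom[OF restrict_left_module[OF M N] M hom_incl, of U] submodule_subset[OF M N] U by simp

text \<open>\<open>J_cube\<close> kills the threefold products of elements; additivity is then used
  one layer at a time, since each layer consists of sums.\<close>

lemma rmul3:
  assumes M: "left_module R M" and U: "U \<subseteq> carrier M"
  shows "rmul R M (rmul R M (rmul R M U)) = {\<zero>\<^bsub>M\<^esub>}"
proof -
  interpret M: left_module R M by fact
  note U1 = rmul_carrier[OF M U]
  note U2 = rmul_carrier[OF M U1]
  have 2: "a \<odot>\<^bsub>M\<^esub> (b \<odot>\<^bsub>M\<^esub> x) = \<zero>\<^bsub>M\<^esub>" if "a \<in> J" "b \<in> J" "x \<in> rmul R M U" for a b x
    using M U that(3)
  proof (induction rule: rmul_induct)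
    case zero then show ?case using that by (simp add: J_carrier)
  next
    case (smult c x)
    then have x: "x \<in> carrier M" using U by auto
    have "a \<odot>\<^bsub>M\<^esub> (b \<odot>\<^bsub>M\<^esub> (c \<odot>\<^bsub>M\<^esub> x)) = (a \<otimes> (b \<otimes> c)) \<odot>\<^bsub>M\<^esub> x"
      using that smult x by (simp add: M.smult_assoc1 J_carrier M.smult_closed)
    then show ?case using J_cube[OF that(1,2) smult(1)] x by simp
  next
    case (add x y)
    then show ?case using that by (simp add: M.smult_r_distr J_carrier M.smult_closed)
  qed
  have 1: "a \<odot>\<^bsub>M\<^esub> x = \<zero>\<^bsub>M\<^esub>" if "a \<in> J" "x \<in> rmul R M (rmul R M U)" for a x
    using M U1 that(2)
  proof (induction rule: rmul_induct)
    case zero then show ?case using that by (simp add: J_carrier)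
  next
    case (smult b x) then show ?case using 2 that(1) by simp
  next
    case (add x y) then show ?case using that by (simp add: M.smult_r_distr J_carrier)
  qed
  have "rmul R M (rmul R M (rmul R M U)) \<subseteq> {\<zero>\<^bsub>M\<^esub>}"
    by (rule rmul_least[OF M U2]) (use 1 in auto)
  then show ?thesis using rmul_submodule[OF M U2] by (auto simp: M.submodule_iff)
qed

text \<open>Nilpotency of J takes the place of finite generation: substituting M = N + JM into
  itself gives M = N + J^3M = N.\<close>

lemma nakayama:
  assumes M: "left_module R M" and N: "submodule N R M"
    and "\<And>x. x \<in> carrier M \<Longrightarrow> \<exists>y\<in>N. x \<ominus>\<^bsub>M\<^esub> y \<in> rmul R M (carrier M)"
  shows "N = carrier M"
proof -
  interpret M: left_module R M by fact
  have Nc: "N \<subseteq> carrier M" using N by (simp add: M.submodule_iff)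
  let ?s = "\<lambda>U. {x \<oplus>\<^bsub>M\<^esub> y | x y. x \<in> N \<and> y \<in> U}"
  \<comment> \<open>From M = N + U follows JM \<subseteq> N + JU, and together with M = N + JM this
    improves U to JU.\<close>
  have step: "carrier M \<subseteq> ?s (rmul R M U)" 
    if U: "U \<subseteq> carrier M" and le: "carrier M \<subseteq> ?s U" and le1: "carrier M \<subseteq> ?s (rmul R M (carrier M))" for U
  proof -
    have "rmul R M (carrier M) \<subseteq> ?s (rmul R M U)"
    proof (rule rmul_least[OF M order_refl submodule_sum[OF M N rmul_submodule[OF M U]]])
      fix a x assume a: "a \<in> J" and "x \<in> carrier M"
      then obtain n u where n: "x = n \<oplus>\<^bsub>M\<^esub> u" "n \<in> N" "u \<in> U" using le by blast
      then have "a \<odot>\<^bsub>M\<^esub> x = a \<odot>\<^bsub>M\<^esub> n \<oplus>\<^bsub>M\<^esub> a \<odot>\<^bsub>M\<^esub> u"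
        using Nc U a by (simp add: M.smult_r_distr J_carrier subset_iff)
      moreover have "a \<odot>\<^bsub>M\<^esub> n \<in> N" using N a n by (simp add: M.submodule_iff J_carrier)
      moreover have "a \<odot>\<^bsub>M\<^esub> u \<in> rmul R M U" using a n by (intro rmul_smult)
      ultimately show "a \<odot>\<^bsub>M\<^esub> x \<in> ?s (rmul R M U)" by blast
    qed
    then have *: "\<exists>n\<in>N. \<exists>v\<in>rmul R M U. y = n \<oplus>\<^bsub>M\<^esub> v" if "y \<in> rmul R M (carrier M)" for y
      using that by blast
    show ?thesis
    proof
      fix x assume "x \<in> carrier M"
      then obtain n y where 1: "x = n \<oplus>\<^bsub>M\<^esub> y" "n \<in> N" "y \<in> rmul R M (carrier M)" using le1 by blast
      then obtain n' v where 2: "y = n' \<oplus>\<^bsub>M\<^esub> v" "n' \<in> N" "v \<in> rmul R M U" using * by blast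
      have "x = (n \<oplus>\<^bsub>M\<^esub> n') \<oplus>\<^bsub>M\<^esub> v" using 1 2 Nc rmul_carrier[OF M U]
        by (simp add: M.M.a_assoc subset_iff)
      moreover have "n \<oplus>\<^bsub>M\<^esub> n' \<in> N" using N 1 2 by (simp add: M.submodule_iff)
      ultimately show "x \<in> ?s (rmul R M U)" using 2 by blast
    qed
  qed
  have 1: "carrier M \<subseteq> ?s (rmul R M (carrier M))"
  proof
    fix x assume x: "x \<in> carrier M"
    then obtain y where y: "y \<in> N" "x \<ominus>\<^bsub>M\<^esub> y \<in> rmul R M (carrier M)" using assms(3) by blast
    then have "x = y \<oplus>\<^bsub>M\<^esub> (x \<ominus>\<^bsub>M\<^esub> y)" using M.add_diff_cancel[OF x, of y] Nc by auto
    then show "x \<in> ?s (rmul R M (carrier M))" using y by blast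
  qed
  have 2: "carrier M \<subseteq> ?s (rmul R M (rmul R M (carrier M)))"
    by (rule step[OF rmul_carrier[OF M order_refl] 1 1])
  have 3: "carrier M \<subseteq> ?s (rmul R M (rmul R M (rmul R M (carrier M))))"
    by (rule step[OF rmul_carrier[OF M rmul_carrier[OF M order_refl]] 2 1])
  have "carrier M \<subseteq> N"
  proof
    fix x assume "x \<in> carrier M"
    then obtain n where "x = n \<oplus>\<^bsub>M\<^esub> \<zero>\<^bsub>M\<^esub>" "n \<in> N" using 3 rmul3[OF M order_refl] by auto
    then show "x \<in> N" using Nc by auto
  qed
  then show ?thesis using Nc by auto
qed

lemma power_submodule:
  assumes "submodule I R reg" shows "submodule (tuples n I) R (free n)"
  using assms unfolding left_module.submodule_iff[OF free_left_module] left_module.submodule_iff[OF regular_left_module]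
  by (auto simp: free_module_simps PiE_iff)

lemma J2_submodule: "submodule J2 R reg"
  using rmul_submodule[OF regular_left_module] J_carrier by auto

lemma J2_J: "J2 \<subseteq> J"
  using rmul_subset[OF regular_left_module J_submodule] .

lemma rmul_reg: "rmul R reg (carrier R) = J"
proof
  show "rmul R reg (carrier R) \<subseteq> J"
    by (rule rmul_least[OF regular_left_module _ J_submodule]) (auto simp: J_mult_right)
  show "J \<subseteq> rmul R reg (carrier R)"
  proof
    fix a assume "a \<in> J"
    then have "a \<odot>\<^bsub>reg\<^esub> \<one> \<in> rmul R reg (carrier R)" by (intro rmul_smult) auto
    then show "a \<in> rmul R reg (carrier R)" using J_carrier[OF \<open>a \<in> J\<close>] by simp
  qed
qed

lemma free_rmul:
  assumes I: "submodule I R reg"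
  shows "rmul R (free n) (tuples n I) = tuples n (rmul R reg I)"
proof
  have Ic: "I \<subseteq> carrier R" using submodule_subset[OF regular_left_module I] by simp
  have PI: "tuples n I \<subseteq> carrier (free n)" using Ic by (auto simp: free_module_simps PiE_iff)
  have rI: "submodule (rmul R reg I) R reg" using Ic by (intro rmul_submodule regular_left_module) simp
  have rIc: "rmul R reg I \<subseteq> carrier R" using submodule_subset[OF regular_left_module rI] by simp
  show "rmul R (free n) (tuples n I) \<subseteq> tuples n (rmul R reg I)"
  proof (rule rmul_least[OF free_left_module PI power_submodule[OF rI]])
    fix a x assume "a \<in> J" "x \<in> tuples n I"
    then show "a \<odot>\<^bsub>free n\<^esub> x \<in> tuples n (rmul R reg I)"
      using rmul_smult[of a R _ I reg] by (auto simp: free_module_simps PiE_iff)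
  qed
  have sub: "submodule (rmul R (free n) (tuples n I)) R (free n)"
    by (intro rmul_submodule free_left_module PI)
  have z: "\<zero> \<in> I" using I by (simp add: left_module.submodule_iff[OF regular_left_module])
  have single: "single n m c \<in> rmul R (free n) (tuples n I)" if "c \<in> rmul R reg I" for m c
  proof -
    have "single n m c \<in> rmul R (free n) (single n m ` I)"
      using rmul_hom[OF regular_left_module free_left_module single_hom, of I n m] Ic that by auto
    moreover have "single n m ` I \<subseteq> tuples n I" by (rule image_subsetI) (rule single_mem[OF _ z])
    ultimately show ?thesis using rmul_mono[OF free_left_module PI] by blast
  qed
  \<comment> \<open>Induction on a bound m for the support: the last coordinate that may be non-zero
    is split off as a \<open>single\<close> vector.\<close>
  have "f \<in> rmul R (free n) (tuples n I)"
    if "f \<in> tuples n (rmul R reg I)" "\<And>i. m \<le> i \<Longrightarrow> i < n \<Longrightarrow> f i = \<zero>" for f m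
    using that
  proof (induction m arbitrary: f)
    case 0
    then have "f = \<zero>\<^bsub>free n\<^esub>"
      by (intro free_eqI[OF 0(1), of _ "carrier R"]) (auto simp: free_module_simps)
    then show ?case using sub by (simp add: left_module.submodule_iff[OF free_left_module])
  next
    case (Suc m)
    show ?case
    proof (cases "m < n")
      case False then show ?thesis using Suc by auto
    next
      case True
      have z': "\<zero> \<in> rmul R reg I" using rI by (simp add: left_module.submodule_iff[OF regular_left_module])
      have fc: "f i \<in> carrier R" if "i < n" for i using Suc(2) rIc that by (auto simp: PiE_iff)
      let ?g = "\<lambda>i\<in>{..<n}. if i = m then \<zero> else f i"
      have "?g \<in> tuples n (rmul R reg I)" using Suc(2) z' by (auto simp: PiE_iff)
      moreover have "?g i = \<zero>" if "m \<le> i" "i < n" for i using Suc(3)[of i] that by auto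
      ultimately have g: "?g \<in> rmul R (free n) (tuples n I)" by (rule Suc.IH)
      have "f m \<in> rmul R reg I" using Suc(2) True by (auto simp: PiE_iff)
      then have s: "single n m (f m) \<in> rmul R (free n) (tuples n I)" by (rule single)
      have f: "f = ?g \<oplus>\<^bsub>free n\<^esub> single n m (f m)"
        by (intro free_eqI[OF Suc(2), of _ "carrier R"]) (auto simp: free_module_simps single_def fc)
      have "?g \<oplus>\<^bsub>free n\<^esub> single n m (f m) \<in> rmul R (free n) (tuples n I)"
        using g s sub by (simp add: left_module.submodule_iff[OF free_left_module])
      then show ?thesis using f by (rule ssubst[rotated])
    qed
  qed
  from this[of _ n] show "tuples n (rmul R reg I) \<subseteq> rmul R (free n) (tuples n I)" by auto
qed

lemma rmul_free: "rmul R (free n) (carrier (free n)) = tuples n J"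
  using free_rmul[of "carrier R" n] left_module.carrier_submodule[OF regular_left_module]
  by (simp add: rmul_reg free_module_simps)

lemma rmul_free_J: "rmul R (free n) (tuples n J) = tuples n J2"
  by (rule free_rmul[OF J_submodule])

lemma ilen_free:
  assumes K: "submodule K R reg" and I: "submodule I R reg" and le: "K \<subseteq> I" and d: "ilen R reg K I = enat d"
  shows "ilen R (free n) (tuples n K) (tuples n I) = enat (n * d)"
proof (induction n)
  case 0
  have "tuples (0::nat) K = tuples 0 I" by simp
  then show ?case by (simp add: zero_enat_def[symmetric])
next
  case (Suc n)
  let ?F = "free (Suc n)" and ?L = "tuples (Suc n) I"
  \<comment> \<open>An intermediate module with restricted last coordinate: evaluation there gives
    ?L/?T = I/K, and truncation identifies the rest with the case of rank n.\<close>
  let ?T = "{f \<in> ?L. f n \<in> K}"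
  have Kz: "\<zero> \<in> K" and Iz: "\<zero> \<in> I" using K I by (simp_all add: left_module.submodule_iff[OF regular_left_module])
  have ev: "(\<lambda>f. f n) \<in> Hom ?F reg" by (rule eval_hom) simp
  have tr: "trunc n \<in> Hom ?F (free n)" by (rule trunc_hom) simp
  have L: "submodule ?L R ?F" by (rule power_submodule[OF I])
  have T: "submodule ?T R ?F" by (rule submodule_preimage[OF free_left_module regular_left_module ev L K])
  have img: "(\<lambda>f. f n) ` ?L = I"
  proof
    show "I \<subseteq> (\<lambda>f. f n) ` ?L"
    proof
      fix c assume "c \<in> I"
      then have "single (Suc n) n c \<in> ?L" "c = single (Suc n) n c n" using Iz by (auto simp: single_def)
      then show "c \<in> (\<lambda>f. f n) ` ?L" by blast
    qed
  qed auto
  have 1: "ilen R ?F ?T ?L = enat d"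
    using ilen_hom[OF free_left_module regular_left_module ev L K] img le d by simp
  have img2: "trunc n ` ?T = tuples n I"
  proof
    show "trunc n ` ?T \<subseteq> tuples n I"
      by (auto simp: recoord_def PiE_iff extensional_def split: if_splits)
    show "tuples n I \<subseteq> trunc n ` ?T"
    proof
      fix f assume f: "f \<in> tuples n I"
      then have "ext n (Suc n) f \<in> ?T" using Kz Iz by (auto simp: recoord_def PiE_iff)
      moreover have "f = trunc n (ext n (Suc n) f)"
        by (rule free_eqI[OF f, of _ UNIV]) (auto simp: recoord_def)
      ultimately show "f \<in> trunc n ` ?T" by blast
    qed
  qed
  have pre: "{f \<in> ?T. trunc n f \<in> tuples n K} = tuples (Suc n) K"
    using le by (auto simp: recoord_def PiE_iff less_Suc_eq extensional_def)
  have KI: "tuples n K \<subseteq> tuples n I" using le by auto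
  have 2: "ilen R ?F (tuples (Suc n) K) ?T = enat (n * d)"
    using ilen_hom[OF free_left_module free_left_module tr T power_submodule[OF K]] Suc.IH KI img2 pre by simp
  have "tuples (Suc n) K \<subseteq> ?T" using pre by blast
  then have "ilen R ?F (tuples (Suc n) K) ?L = enat (n * d) + enat d"
    using ilen_add[OF free_left_module power_submodule[OF K] T L] 1 2 by auto
  then show ?case by (simp add: add.commute)
qed

text \<open>A left ideal strictly above J contains a left invertible element, hence 1, so no chain
  can take two steps.\<close>

lemma ilen_top: "ilen R reg J (carrier R) = 1"
proof -
  have JR: "J \<subset> carrier R" using J_carrier one_notin_J one_closed by blast
  note J = J_submodule and c = left_module.carrier_submodule[OF regular_left_module, simplified]
  have "ilen R reg J J + 1 \<le> ilen R reg J (carrier R)" 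
    using JR by (intro ilen_Suc J c) auto
  moreover have "ilen R reg J (carrier R) \<le> 1"
  proof (rule ilen_le)
    fix n assume "has_chain R reg J (carrier R) n"
    then obtain C where C: "submodule_chain R reg n C" "J \<subseteq> C 0" "C n \<subseteq> carrier R"
      by (auto simp: has_chain_def)
    have "n \<le> 1"
    proof (rule ccontr)
      assume "\<not> n \<le> 1"
      then have 1: "C 0 \<subset> C (Suc 0)" "C (Suc 0) \<subset> C (Suc (Suc 0))" "submodule (C (Suc 0)) R reg"
         "submodule (C (Suc (Suc 0))) R reg"
        using C(1) by (auto simp: submodule_chain_def)
      then obtain c where c: "c \<in> C (Suc 0)" "c \<notin> J" using C(2) by auto
      have "c \<in> carrier R" using c(1) submodule_subset[OF regular_left_module 1(3)] by auto
      then obtain u where u: "u \<in> carrier R" "u \<otimes> c = \<one>" using J_unit c by blast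
      have *: "b \<otimes> x \<in> C (Suc 0)" if "b \<in> carrier R" "x \<in> C (Suc 0)" for b x
        using 1(3) that by (simp add: left_module.submodule_iff[OF regular_left_module])
      then have "\<one> \<in> C (Suc 0)" using u c by metis
      then have "carrier R \<subseteq> C (Suc 0)" using *[of _ \<one>] by auto
      then show False using 1(2) submodule_subset[OF regular_left_module 1(4)] by auto
    qed
    then show "enat n \<le> 1" by (simp add: one_enat_def)
  qed
  ultimately show ?thesis by simp
qed

lemma J_subset: "J \<subseteq> carrier R" using J_carrier by auto

lemma ilen_free_top: "ilen R (free n) (tuples n J) (carrier (free n)) = enat n"
  using ilen_free[OF J_submodule left_module.carrier_submodule[OF regular_left_module], of 1 n]
    ilen_top J_subset by (simp add: one_enat_def free_module_simps)

end

text \<open>The pair (e, l) is the Hilbert type; \<open>l\<close> is the length of J^2, called a in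
  the theorem.\<close>

locale short_local = cube_zero_local R for R :: "('a, 'r) ring_scheme" (structure) +
  fixes e l :: nat
  assumes length_J: "ilen R (regular_module R) (rmul R (regular_module R) (jradical R)) (jradical R) = enat e"
    and length_J2: "ilen R (regular_module R) {\<zero>} (rmul R (regular_module R) (jradical R)) = enat l"
begin

lemma ilen_free_J: "ilen R (free n) (tuples n J2) (tuples n J) = enat (n * e)"
  by (rule ilen_free[OF J2_submodule J_submodule J2_J length_J])

lemma zero_submodule_reg: "submodule {\<zero>} R reg"
  using left_module.zero_submodule[OF regular_left_module] by simp

lemma power_zero: "tuples n {\<zero>} = {\<zero>\<^bsub>free n\<^esub>}"
  by (auto simp: free_module_simps PiE_iff fun_eq_iff extensional_def)

lemma ilen_free_J2: "ilen R (free n) {\<zero>\<^bsub>free n\<^esub>} (tuples n J2) = enat (n * l)"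
  using ilen_free[OF zero_submodule_reg J2_submodule _ length_J2, of n] J2_submodule
  unfolding power_zero by (simp add: left_module.submodule_iff[OF regular_left_module])

end

section \<open>Free covers\<close>

definition miso :: "('a, 'r) ring_scheme \<Rightarrow> ('a, 'm) module \<Rightarrow> ('a, 'n) module \<Rightarrow> ('m \<Rightarrow> 'n) \<Rightarrow> bool" where
  "miso R M N f \<longleftrightarrow> f \<in> left_module_hom R M N \<and> bij_betw f (carrier M) (carrier N)"

context short_local
begin

lemma fcover_hom: "fcover M n \<pi> \<Longrightarrow> \<pi> \<in> Hom (free n) M"
  and fcover_surj: "fcover M n \<pi> \<Longrightarrow> \<pi> ` carrier (free n) = carrier M"
  and fcover_ker: "fcover M n \<pi> \<Longrightarrow> c \<in> carrier (free n) \<Longrightarrow> \<pi> c = \<zero>\<^bsub>M\<^esub> \<Longrightarrow> c \<in> tuples n J"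
  by (auto simp: fcover_def a_kernel_eq)

lemma fcoverI:
  assumes "\<pi> \<in> Hom (free n) M" "\<And>x. x \<in> carrier M \<Longrightarrow> \<exists>c\<in>carrier (free n). \<pi> c = x"
    and "\<And>c i. c \<in> carrier (free n) \<Longrightarrow> \<pi> c = \<zero>\<^bsub>M\<^esub> \<Longrightarrow> i < n \<Longrightarrow> c i \<in> J"
  shows "fcover M n \<pi>"
  unfolding fcover_def a_kernel_eq
proof (intro conjI subsetI)
  show "\<pi> ` carrier (free n) = carrier M" 
  proof
    show "\<pi> ` carrier (free n) \<subseteq> carrier M" using hom_closed[OF assms(1)] by blast
    show "carrier M \<subseteq> \<pi> ` carrier (free n)" using assms(2) by blast
  qed
  fix c assume "c \<in> {x \<in> carrier (free n). \<pi> x = \<zero>\<^bsub>M\<^esub>}"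
  then show "c \<in> tuples n J" using assms(3) by (auto simp: free_module_simps PiE_iff)
qed (rule assms(1))

lemma free_drop:
  assumes M: "left_module R M" and \<pi>: "\<pi> \<in> Hom (free n) M" and surj: "\<pi> ` carrier (free n) = carrier M"
    and c: "c \<in> carrier (free n)" "\<pi> c = \<zero>\<^bsub>M\<^esub>" and j: "j < n" "c j \<notin> J"
  shows "\<pi> ` {b \<in> carrier (free n). b j = \<zero>} = carrier M"
proof
  interpret M: left_module R M by fact
  interpret F: left_module R "free n" by (rule free_left_module)
  show "\<pi> ` {b \<in> carrier (free n). b j = \<zero>} \<subseteq> carrier M" using surj by auto
  show "carrier M \<subseteq> \<pi> ` {b \<in> carrier (free n). b j = \<zero>}"
  proof
    fix x assume "x \<in> carrier M"
    then obtain b where b: "b \<in> carrier (free n)" "x = \<pi> b" using surj by auto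
    have cj: "c j \<in> carrier R" "b j \<in> carrier R" using c b j by (auto simp: free_module_simps)
    then obtain u where u: "u \<in> carrier R" "u \<otimes> c j = \<one>" using J_unit j by blast
    \<comment> \<open>The multiple of the relation c that cancels the j-th coordinate of b: its j-th
      entry is -(b_j u) c_j = -b_j.\<close>
    let ?d = "(\<ominus> (b j \<otimes> u)) \<odot>\<^bsub>free n\<^esub> c"
    have d: "?d \<in> carrier (free n)" using c cj u by (simp add: F.smult_closed)
    have "\<pi> ?d = \<zero>\<^bsub>M\<^esub>" using c cj u by (simp add: hom_smult[OF \<pi>])
    then have "\<pi> (b \<oplus>\<^bsub>free n\<^esub> ?d) = x"
      using b d hom_closed[OF \<pi>] by (simp add: hom_add[OF \<pi>])
    moreover have "(b \<oplus>\<^bsub>free n\<^esub> ?d) j = \<zero>"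
      using j cj u by (simp add: free_module_simps l_minus m_assoc r_neg)
    moreover have "b \<oplus>\<^bsub>free n\<^esub> ?d \<in> carrier (free n)" using b d by simp
    ultimately show "x \<in> \<pi> ` {b \<in> carrier (free n). b j = \<zero>}" by blast
  qed
qed

definition insert_zero :: "nat \<Rightarrow> nat \<Rightarrow> (nat \<Rightarrow> 'a) \<Rightarrow> nat \<Rightarrow> 'a" where
  "insert_zero n j = recoord n (\<lambda>i. if i < j then Some i else if i = j then None else Some (i - 1))"

lemma insert_zero_hom: "j < Suc n \<Longrightarrow> insert_zero (Suc n) j \<in> Hom (free n) (free (Suc n))"
  unfolding insert_zero_def by (rule recoord_hom) (auto split: if_splits)

lemma insert_zero_image:
  assumes "j < Suc n" "b \<in> carrier (free (Suc n))" "b j = \<zero>"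
  shows "b \<in> insert_zero (Suc n) j ` carrier (free n)"
proof
  let ?c = "\<lambda>i\<in>{..<n}. if i < j then b i else b (Suc i)"
  show "?c \<in> carrier (free n)" using assms by (auto simp: free_module_simps PiE_iff)
  have b: "b \<in> tuples (Suc n) UNIV" using assms by (auto simp: free_module_simps PiE_iff)
  show "b = insert_zero (Suc n) j ?c"
    using assms(1,3) by (intro free_eqI[OF b, of _ UNIV]) (auto simp: insert_zero_def recoord_def)
qed

text \<open>A generating map of least rank is minimal: a relation with an entry outside J would, by
  \<open>free_drop\<close>, allow one generator to be discarded.\<close>

lemma fcover_exists:
  assumes M: "left_module R M" and "fin_gen M" shows "\<exists>n \<pi>. fcover M n \<pi>"
proof -
  let ?P = "\<lambda>n. \<exists>\<pi>\<in>Hom (free n) M. \<pi> ` carrier (free n) = carrier M"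
  define n where "n = (LEAST n. ?P n)"
  have "\<exists>n. ?P n" using assms(2) unfolding fin_gen_def .
  then have "?P n" unfolding n_def by (rule LeastI_ex)
  then obtain \<pi> where \<pi>: "\<pi> \<in> Hom (free n) M" "\<pi> ` carrier (free n) = carrier M" by blast
  have "c i \<in> J" if c: "c \<in> carrier (free n)" "\<pi> c = \<zero>\<^bsub>M\<^esub>" "i < n" for c i
  proof (rule ccontr)
    assume ci: "c i \<notin> J"
    obtain m where m: "n = Suc m" using c(3) by (cases n) auto
    let ?\<iota> = "insert_zero n i"
    have h: "?\<iota> \<in> Hom (free m) (free n)" using insert_zero_hom[of i m] c(3) m by simp
    have "carrier M \<subseteq> (\<lambda>c. \<pi> (?\<iota> c)) ` carrier (free m)"
    proof
      fix x assume "x \<in> carrier M"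
      then have "x \<in> \<pi> ` {b \<in> carrier (free n). b i = \<zero>}" using free_drop[OF M \<pi> c ci] by simp
      then obtain b where "b \<in> carrier (free n)" "b i = \<zero>" "x = \<pi> b" by blast
      then show "x \<in> (\<lambda>c. \<pi> (?\<iota> c)) ` carrier (free m)" using insert_zero_image[of i m b] c(3) m by auto
    qed
    moreover have hc: "(\<lambda>c. \<pi> (?\<iota> c)) \<in> Hom (free m) M" by (rule hom_comp[OF h \<pi>(1)])
    moreover have "(\<lambda>c. \<pi> (?\<iota> c)) ` carrier (free m) \<subseteq> carrier M" using hom_closed[OF hc] by blast
    ultimately have "?P m" by (intro bexI[of _ "\<lambda>c. \<pi> (?\<iota> c)"] equalityI)
    then have "n \<le> m" unfolding n_def by (rule Least_le)
    then show False using m by simp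
  qed
  moreover have "\<exists>c\<in>carrier (free n). \<pi> c = x" if "x \<in> carrier M" for x
  proof -
    have "x \<in> \<pi> ` carrier (free n)" using \<pi>(2) that by simp
    then show ?thesis by blast
  qed
  ultimately have "fcover M n \<pi>" using \<pi>(1) by (intro fcoverI)
  then show ?thesis by blast
qed

lemma rmul_free_mem: "c \<in> tuples n J \<longleftrightarrow> c \<in> rmul R (free n) (carrier (free n))"
  by (simp add: rmul_free)

text \<open>Since P is projective, q has a section \<sigma>. The element x - \<sigma> (q x) lies in
  the kernel and hence in J F, so Nakayama makes \<sigma> surjective; a map with a surjective
  section is injective.\<close>

lemma split_inj:
  assumes P: "projective_module R P" and q: "q \<in> Hom (free n) P" "q ` carrier (free n) = carrier P"
    and ker: "\<And>c. c \<in> carrier (free n) \<Longrightarrow> q c = \<zero>\<^bsub>P\<^esub> \<Longrightarrow> c \<in> tuples n J"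
  shows "inj_on q (carrier (free n))"
proof -
  have Pm: "left_module R P" using P by (simp add: projective_module_def)
  interpret P: left_module R P by fact
  interpret F: left_module R "free n" by (rule free_left_module)
  obtain N r s where r: "r \<in> Hom (free N) P" and s: "s \<in> Hom P (free N)" 
    and rs: "\<And>x. x \<in> carrier P \<Longrightarrow> r (s x) = x"
    using P unfolding projective_module_def by blast
  have "\<exists>\<rho>\<in>Hom (free N) (free n). \<forall>c\<in>carrier (free N). q (\<rho> c) = r c"
    using hom_closed[OF r] q by (intro free_lift[OF F.lm Pm q(1) r]) auto
  then obtain \<rho> where \<rho>: "\<rho> \<in> Hom (free N) (free n)" "\<And>c. c \<in> carrier (free N) \<Longrightarrow> q (\<rho> c) = r c" by blast
  let ?\<sigma> = "\<lambda>x. \<rho> (s x)"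
  have \<sigma>: "?\<sigma> \<in> Hom P (free n)" by (rule hom_comp[OF s \<rho>(1)])
  have q\<sigma>: "q (?\<sigma> x) = x" if "x \<in> carrier P" for x
    using \<rho>(2) rs that hom_closed[OF s] by simp
  have "?\<sigma> ` carrier P = carrier (free n)"
  proof (rule nakayama[OF F.lm submodule_image[OF Pm F.lm \<sigma> P.carrier_submodule]])
    fix x assume x: "x \<in> carrier (free n)"
    have qx: "q x \<in> carrier P" using hom_closed[OF q(1) x] .
    have sc: "?\<sigma> (q x) \<in> carrier (free n)" using hom_closed[OF \<sigma> qx] .
    have "q (x \<ominus>\<^bsub>free n\<^esub> ?\<sigma> (q x)) = \<zero>\<^bsub>P\<^esub>"
      using qx by (simp add: hom_diff[OF F.lm Pm q(1) x sc] q\<sigma> P.diff_zero_iff)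
    then have "x \<ominus>\<^bsub>free n\<^esub> ?\<sigma> (q x) \<in> rmul R (free n) (carrier (free n))"
      using ker x sc rmul_free_mem by simp
    then show "\<exists>y\<in>?\<sigma> ` carrier P. x \<ominus>\<^bsub>free n\<^esub> y \<in> rmul R (free n) (carrier (free n))"
      using qx by blast
  qed
  then have im: "\<exists>y\<in>carrier P. x = ?\<sigma> y" if "x \<in> carrier (free n)" for x using that by auto
  show ?thesis
  proof (rule inj_onI)
    fix x y assume xy: "x \<in> carrier (free n)" "y \<in> carrier (free n)" "q x = q y"
    obtain u where u: "u \<in> carrier P" "x = ?\<sigma> u" using im[OF xy(1)] by blast
    obtain v where v: "v \<in> carrier P" "y = ?\<sigma> v" using im[OF xy(2)] by blast
    have "u = v" using xy(3) q\<sigma> u v by simp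
    then show "x = y" using u v by simp
  qed
qed

lemma projective_fin_gen:
  assumes "projective_module R P" shows "fin_gen P"
proof -
  obtain N r s where r: "r \<in> Hom (free N) P" and s: "s \<in> Hom P (free N)" 
    and rs: "\<And>x. x \<in> carrier P \<Longrightarrow> r (s x) = x"
    using assms unfolding projective_module_def by blast
  have "r ` carrier (free N) = carrier P"
  proof
    show "r ` carrier (free N) \<subseteq> carrier P" using hom_closed[OF r] by auto
    show "carrier P \<subseteq> r ` carrier (free N)"
    proof
      fix x assume x: "x \<in> carrier P"
      then show "x \<in> r ` carrier (free N)" using rs[OF x] hom_closed[OF s x] by (metis imageI)
    qed
  qed
  then show ?thesis using r unfolding fin_gen_def by blast
qed

lemma fcover_projective_cover:
  assumes M: "left_module R M" and \<pi>: "fcover M n \<pi>"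
  shows "projective_cover R (free n) M \<pi>"
  unfolding projective_cover_def
proof (intro conjI allI impI free_projective fcover_hom[OF \<pi>] fcover_surj[OF \<pi>])
  interpret M: left_module R M by fact
  interpret F: left_module R "free n" by (rule free_left_module)
  fix N assume N: "submodule N R (free n) \<and> \<pi> ` N = carrier M"
  note h = fcover_hom[OF \<pi>]
  show "N = carrier (free n)"
  proof (rule nakayama[OF F.lm])
    fix x assume x: "x \<in> carrier (free n)"
    then have "\<pi> x \<in> \<pi> ` N" using N hom_closed[OF h] by simp
    then obtain y where y: "y \<in> N" "\<pi> x = \<pi> y" by blast
    then have yc: "y \<in> carrier (free n)" using N by (auto simp: F.submodule_iff)
    have "\<pi> (x \<ominus>\<^bsub>free n\<^esub> y) = \<zero>\<^bsub>M\<^esub>"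
      using y hom_closed[OF h yc] by (simp add: hom_diff[OF F.lm M h x yc] M.diff_zero_iff)
    then have "x \<ominus>\<^bsub>free n\<^esub> y \<in> rmul R (free n) (carrier (free n))"
      using fcover_ker[OF \<pi>] x yc rmul_free_mem by simp
    then show "\<exists>y\<in>N. x \<ominus>\<^bsub>free n\<^esub> y \<in> rmul R (free n) (carrier (free n))" using y by blast
  qed (use N in simp)
qed

text \<open>For a minimal free cover q of P, \<open>split_inj\<close> shows that P is free. If a
  relation of the composite had an entry outside J in place j, the vectors with zero j-th coordinate
  would still map onto M; minimality of p would make them everything, although they miss a unit
  vector.\<close>

lemma cover_free:
  assumes M: "left_module R M" and p: "projective_cover R P M p"
  shows "\<exists>n q. miso R (free n) P q \<and> fcover M n (\<lambda>c. p (q c))"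
proof -
  have Pp: "projective_module R P" and ph: "p \<in> Hom P M" and ps: "p ` carrier P = carrier M"
    and pe: "\<And>N. submodule N R P \<Longrightarrow> p ` N = carrier M \<Longrightarrow> N = carrier P"
    using p by (auto simp: projective_cover_def)
  have P: "left_module R P" using Pp by (simp add: projective_module_def)
  interpret P: left_module R P by fact
  obtain n q where nq: "fcover P n q" using fcover_exists[OF P projective_fin_gen[OF Pp]] by blast
  note qh = fcover_hom[OF nq] and qs = fcover_surj[OF nq]
  have inj: "inj_on q (carrier (free n))" by (rule split_inj[OF Pp qh qs fcover_ker[OF nq]])
  have pqh: "(\<lambda>c. p (q c)) \<in> Hom (free n) M" by (rule hom_comp[OF qh ph])
  have pqs: "(\<lambda>c. p (q c)) ` carrier (free n) = carrier M" using qs ps by (metis image_image)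
  have "fcover M n (\<lambda>c. p (q c))"
  proof (rule fcoverI[OF pqh])
    fix x assume "x \<in> carrier M"
    then have "x \<in> (\<lambda>c. p (q c)) ` carrier (free n)" using pqs by simp
    then show "\<exists>c\<in>carrier (free n). p (q c) = x" by blast
  next
    fix c j assume c: "c \<in> carrier (free n)" "p (q c) = \<zero>\<^bsub>M\<^esub>" "j < n"
    show "c j \<in> J"
    proof (rule ccontr)
      assume cj: "c j \<notin> J"
      let ?N = "{b \<in> carrier (free n). b j \<in> {\<zero>}}"
      have N: "submodule ?N R (free n)"
        by (intro submodule_preimage[OF free_left_module regular_left_module eval_hom[OF c(3)]]
            left_module.carrier_submodule free_left_module zero_submodule_reg)
      have "(\<lambda>c. p (q c)) ` ?N = carrier M" using free_drop[OF M pqh pqs c cj] by simp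
      then have "p ` (q ` ?N) = carrier M" by (simp add: image_image)
      then have e: "q ` ?N = carrier P" by (rule pe[OF submodule_image[OF free_left_module P qh N]])
      let ?e = "single n j \<one>"
      have ec: "?e \<in> carrier (free n)" using single_mem[of \<one> "carrier R"] by (simp add: free_module_simps)
      then have "q ?e \<in> q ` ?N" using e hom_closed[OF qh] by simp
      then have "?e \<in> ?N" using inj ec by (auto dest: inj_onD)
      then show False using c(3) one_notin_J J_zero by (auto simp: single_def)
    qed
  qed
  moreover have "miso R (free n) P q" using qh inj qs by (simp add: miso_def bij_betw_def)
  ultimately show ?thesis by blast
qed

lemma miso_inv:
  assumes M: "left_module R M" and f: "miso R M N f"
  shows "miso R N M (inv_into (carrier M) f)"
proof -
  interpret M: left_module R M by fact
  let ?g = "inv_into (carrier M) f"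
  have h: "f \<in> Hom M N" and b: "bij_betw f (carrier M) (carrier N)" using f by (auto simp: miso_def)
  have g: "?g x \<in> carrier M" "f (?g x) = x" if "x \<in> carrier N" for x
    using that b by (auto simp: bij_betw_def inv_into_into f_inv_into_f)
  have inj: "x = y" if "f x = f y" "x \<in> carrier M" "y \<in> carrier M" for x y
    using that b by (auto simp: bij_betw_def inj_on_def)
  have "?g \<in> Hom N M"
  proof (rule homI)
    fix x y assume xy: "x \<in> carrier N" "y \<in> carrier N"
    have "f (?g x \<oplus>\<^bsub>M\<^esub> ?g y) = x \<oplus>\<^bsub>N\<^esub> y" using xy g by (simp add: hom_add[OF h])
    then have "?g (x \<oplus>\<^bsub>N\<^esub> y) = ?g (f (?g x \<oplus>\<^bsub>M\<^esub> ?g y))" by simp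
    also have "\<dots> = ?g x \<oplus>\<^bsub>M\<^esub> ?g y" using xy g b by (simp add: bij_betw_def inv_into_f_f)
    finally show "?g (x \<oplus>\<^bsub>N\<^esub> y) = ?g x \<oplus>\<^bsub>M\<^esub> ?g y" .
  next
    fix a x assume ax: "a \<in> carrier R" "x \<in> carrier N"
    have "f (a \<odot>\<^bsub>M\<^esub> ?g x) = a \<odot>\<^bsub>N\<^esub> x" using ax g by (simp add: hom_smult[OF h])
    then have "?g (a \<odot>\<^bsub>N\<^esub> x) = ?g (f (a \<odot>\<^bsub>M\<^esub> ?g x))" by simp
    also have "\<dots> = a \<odot>\<^bsub>M\<^esub> ?g x" using ax g b by (simp add: bij_betw_def inv_into_f_f M.smult_closed)
    finally show "?g (a \<odot>\<^bsub>N\<^esub> x) = a \<odot>\<^bsub>M\<^esub> ?g x" .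
  qed (rule g)
  then show ?thesis using b by (simp add: miso_def bij_betw_inv_into)
qed

lemma miso_zero_iff:
  assumes "left_module R M" "left_module R N" "miso R M N f" "x \<in> carrier M"
  shows "f x = \<zero>\<^bsub>N\<^esub> \<longleftrightarrow> x = \<zero>\<^bsub>M\<^esub>"
  using assms hom_inj_iff[OF assms(1,2), of f] hom_zero[OF assms(1,2), of f]
  by (auto simp: miso_def bij_betw_def)

text \<open>A lift of one cover through the other is surjective by Nakayama, and its kernel is
  killed by \<pi>', hence lies in the radical, so \<open>split_inj\<close> applies.\<close>

lemma fcover_unique:
  assumes M: "left_module R M" and \<pi>: "fcover M n \<pi>" and \<pi>': "fcover M n' \<pi>'"
  shows "\<exists>\<phi>. miso R (free n') (free n) \<phi> \<and> (\<forall>c\<in>carrier (free n'). \<pi> (\<phi> c) = \<pi>' c)"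
proof -
  interpret M: left_module R M by fact
  interpret F: left_module R "free n" by (rule free_left_module)
  note h = fcover_hom[OF \<pi>] and h' = fcover_hom[OF \<pi>']
  have "\<exists>\<phi>\<in>Hom (free n') (free n). \<forall>c\<in>carrier (free n'). \<pi> (\<phi> c) = \<pi>' c"
    using hom_closed[OF h'] fcover_surj[OF \<pi>] by (intro free_lift[OF F.lm M h h']) auto
  then obtain \<phi> where \<phi>: "\<phi> \<in> Hom (free n') (free n)" "\<And>c. c \<in> carrier (free n') \<Longrightarrow> \<pi> (\<phi> c) = \<pi>' c" by blast
  have surj: "\<phi> ` carrier (free n') = carrier (free n)"
  proof (rule nakayama[OF F.lm submodule_image[OF free_left_module F.lm \<phi>(1) left_module.carrier_submodule[OF free_left_module]]])
    fix x assume x: "x \<in> carrier (free n)"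
    then have "\<pi> x \<in> \<pi>' ` carrier (free n')" using hom_closed[OF h x] fcover_surj[OF \<pi>'] by simp
    then obtain c where c: "c \<in> carrier (free n')" "\<pi>' c = \<pi> x" by auto
    have pc: "\<phi> c \<in> carrier (free n)" using hom_closed[OF \<phi>(1) c(1)] .
    have "\<pi> (x \<ominus>\<^bsub>free n\<^esub> \<phi> c) = \<zero>\<^bsub>M\<^esub>"
      using \<phi>(2)[OF c(1)] c hom_closed[OF h x] by (simp add: hom_diff[OF F.lm M h x pc] M.diff_zero_iff)
    then have "x \<ominus>\<^bsub>free n\<^esub> \<phi> c \<in> rmul R (free n) (carrier (free n))"
      using fcover_ker[OF \<pi>] x pc rmul_free_mem by simp
    then show "\<exists>y\<in>\<phi> ` carrier (free n'). x \<ominus>\<^bsub>free n\<^esub> y \<in> rmul R (free n) (carrier (free n))"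
      using c by blast
  qed
  have "c \<in> tuples n' J" if "c \<in> carrier (free n')" "\<phi> c = \<zero>\<^bsub>free n\<^esub>" for c
    using \<phi>(2)[OF that(1)] that hom_zero[OF F.lm M h] by (intro fcover_ker[OF \<pi>']) auto
  then have "inj_on \<phi> (carrier (free n'))" by (rule split_inj[OF free_projective \<phi>(1) surj])
  then have "miso R (free n') (free n) \<phi>" using \<phi>(1) surj by (simp add: miso_def bij_betw_def)
  then show ?thesis using \<phi>(2) by blast
qed

section \<open>Finite generation\<close>

lemma fin_gen_hom:
  assumes "fin_gen M" "f \<in> Hom M N" "f ` carrier M = carrier N"
  shows "fin_gen N"
proof -
  obtain n \<pi> where "\<pi> \<in> Hom (free n) M" "\<pi> ` carrier (free n) = carrier M"
    using assms(1) by (auto simp: fin_gen_def)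
  then have "(\<lambda>c. f (\<pi> c)) \<in> Hom (free n) N" "(\<lambda>c. f (\<pi> c)) ` carrier (free n) = carrier N"
    using hom_comp[OF _ assms(2)] assms(3) by (auto simp: image_image[symmetric])
  then show ?thesis unfolding fin_gen_def by blast
qed

lemma fcover_fin_gen: "fcover M n \<pi> \<Longrightarrow> fin_gen M"
  unfolding fin_gen_def fcover_def by blast

text \<open>A free module of finite rank has finite length n l + n e + n. A finitely generated
  submodule of N of greatest length must be N, because a further generator would lengthen
  it.\<close>

lemma fin_gen_free_submodule:
  assumes N: "submodule N R (free n)" shows "fin_gen (restrict_module (free n) N)"
proof -
  interpret F: left_module R "free n" by (rule free_left_module)
  let ?J = "tuples n J" and ?J2 = "tuples n J2"
  have J2: "submodule ?J2 R (free n)" by (rule power_submodule[OF J2_submodule])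
  have Js: "submodule ?J R (free n)" by (rule power_submodule[OF J_submodule])
  have le: "?J2 \<subseteq> ?J" "?J \<subseteq> carrier (free n)" "{\<zero>\<^bsub>free n\<^esub>} \<subseteq> ?J2" 
    using J2_J J_subset J2 by (auto simp: free_module_simps PiE_iff F.submodule_iff)
  have "ilen R (free n) {\<zero>\<^bsub>free n\<^esub>} ?J = enat (n * l) + enat (n * e)"
    using ilen_add[OF F.lm F.zero_submodule J2 Js le(3,1)] ilen_free_J ilen_free_J2 by simp
  then have "ilen R (free n) {\<zero>\<^bsub>free n\<^esub>} (carrier (free n)) = enat (n * l + n * e + n)"
    using ilen_add[OF F.lm F.zero_submodule Js F.carrier_submodule order_trans[OF le(3,1)] le(2)] ilen_free_top by simp
  then have fin: "ilen R (free n) {\<zero>\<^bsub>free n\<^esub>} N \<le> enat (n * l + n * e + n)"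
    using ilen_mono[of N "carrier (free n)"] N by (metis F.submodule_iff)
  \<comment> \<open>Some submodule of N with finitely many generators has length at least k; the
    finite length of the free module bounds such k.\<close>
  let ?P = "\<lambda>k. \<exists>m. \<exists>\<pi>\<in>Hom (free m) (free n). \<pi> ` carrier (free m) \<subseteq> N \<and>
      enat k \<le> ilen R (free n) {\<zero>\<^bsub>free n\<^esub>} (\<pi> ` carrier (free m))"
  have P0: "?P 0"
  proof -
    have "(\<lambda>_. \<zero>\<^bsub>free n\<^esub>) \<in> Hom (free 0) (free n)" by (rule homI) auto
    moreover have "(\<lambda>_. \<zero>\<^bsub>free n\<^esub>) ` carrier (free 0) \<subseteq> N" using N by (auto simp: F.submodule_iff)
    ultimately show ?thesis by (intro exI[of _ 0] bexI[of _ "\<lambda>_. \<zero>\<^bsub>free n\<^esub>"] conjI) (auto simp: zero_enat_def[symmetric])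
  qed
  have bd: "k \<le> n * l + n * e + n" if "?P k" for k
  proof -
    obtain m \<pi> where m: "\<pi> ` carrier (free m) \<subseteq> N" "enat k \<le> ilen R (free n) {\<zero>\<^bsub>free n\<^esub>} (\<pi> ` carrier (free m))"
      using \<open>?P k\<close> by blast
    have "enat k \<le> ilen R (free n) {\<zero>\<^bsub>free n\<^esub>} N" by (rule order_trans[OF m(2) ilen_mono[OF m(1)]])
    then have "enat k \<le> enat (n * l + n * e + n)" using fin by (rule order_trans)
    then show ?thesis by simp
  qed
  have "\<exists>k. ?P k \<and> (\<forall>k'. ?P k' \<longrightarrow> k' \<le> k)"
    by (rule Nat.ex_has_greatest_nat[of ?P 0 "n * l + n * e + n"], rule P0, intro allI impI, rule bd)
  then obtain k where k: "?P k \<and> (\<forall>k'. ?P k' \<longrightarrow> k' \<le> k)" by (rule exE)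
  from conjunct1[OF k] obtain m \<pi> where \<pi>: "\<pi> \<in> Hom (free m) (free n)" "\<pi> ` carrier (free m) \<subseteq> N"
      "enat k \<le> ilen R (free n) {\<zero>\<^bsub>free n\<^esub>} (\<pi> ` carrier (free m))" by blast
  have "N \<subseteq> \<pi> ` carrier (free m)"
  proof (rule ccontr)
    assume "\<not> N \<subseteq> \<pi> ` carrier (free m)"
    then obtain y where y: "y \<in> N" "y \<notin> \<pi> ` carrier (free m)" by blast
    have yc: "y \<in> carrier (free n)" using y(1) N by (auto simp: F.submodule_iff)
    \<comment> \<open>Adjoins y as one more generator to the image of \<pi>.\<close>
    let ?\<psi> = "\<lambda>c. \<pi> (trunc m c) \<oplus>\<^bsub>free n\<^esub> c m \<odot>\<^bsub>free n\<^esub> y"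
    have \<psi>: "?\<psi> \<in> Hom (free (Suc m)) (free n)" by (rule hom_free_Suc[OF F.lm \<pi>(1) yc])
    have t: "trunc m \<in> Hom (free (Suc m)) (free m)" by (rule trunc_hom) simp
    have sub: "?\<psi> ` carrier (free (Suc m)) \<subseteq> N"
    proof (rule image_subsetI)
      fix c assume c: "c \<in> carrier (free (Suc m))"
      then have "\<pi> (trunc m c) \<in> N" "c m \<in> carrier R"
        using \<pi>(2) hom_closed[OF t c] by (auto simp: free_module_simps)
      moreover have "c m \<odot>\<^bsub>free n\<^esub> y \<in> N" using N y(1) \<open>c m \<in> carrier R\<close> unfolding F.submodule_iff by blast
      ultimately show "?\<psi> c \<in> N" using N unfolding F.submodule_iff by blast
    qed
    have "\<pi> ` carrier (free m) \<subseteq> ?\<psi> ` carrier (free (Suc m))"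
    proof (rule image_subsetI)
      fix c assume c: "c \<in> carrier (free m)"
      have ec: "ext m (Suc m) c \<in> carrier (free (Suc m))" by (rule hom_closed[OF ext_hom c])
      have "trunc m (ext m (Suc m) c) = c"
        using c by (intro free_eqI[of _ m UNIV _ "carrier R"]) (auto simp: recoord_def free_module_simps)
      moreover have "ext m (Suc m) c m = \<zero>" by (simp add: recoord_def)
      ultimately have "\<pi> c = ?\<psi> (ext m (Suc m) c)" using yc hom_closed[OF \<pi>(1) c] by simp
      then show "\<pi> c \<in> ?\<psi> ` carrier (free (Suc m))" by (rule image_eqI[where f = ?\<psi>]) (rule ec)
    qed
    moreover have "y \<in> ?\<psi> ` carrier (free (Suc m))"
    proof -
      let ?e = "single (Suc m) m \<one>"
      have ec: "?e \<in> carrier (free (Suc m))" using single_mem[of \<one> "carrier R"] by (simp add: free_module_simps)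
      have "trunc m ?e = \<zero>\<^bsub>free m\<^esub>"
        by (intro free_eqI[of _ m UNIV _ "carrier R"]) (auto simp: recoord_def free_module_simps single_def)
      then have "y = ?\<psi> ?e"
        using yc hom_zero[OF free_left_module F.lm \<pi>(1)] by (simp add: single_def F.smult_one)
      then show ?thesis by (rule image_eqI[where f = ?\<psi>]) (rule ec)
    qed
    ultimately have "\<pi> ` carrier (free m) \<subset> ?\<psi> ` carrier (free (Suc m))" using y by blast
    moreover have s1: "submodule (\<pi> ` carrier (free m)) R (free n)"
      by (rule submodule_image[OF free_left_module F.lm \<pi>(1) left_module.carrier_submodule[OF free_left_module]])
    moreover have "submodule (?\<psi> ` carrier (free (Suc m))) R (free n)"
      by (rule submodule_image[OF free_left_module F.lm \<psi> left_module.carrier_submodule[OF free_left_module]])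
    moreover have "{\<zero>\<^bsub>free n\<^esub>} \<subseteq> \<pi> ` carrier (free m)" using s1 by (simp add: F.submodule_iff)
    ultimately have "ilen R (free n) {\<zero>\<^bsub>free n\<^esub>} (\<pi> ` carrier (free m)) + 1
        \<le> ilen R (free n) {\<zero>\<^bsub>free n\<^esub>} (?\<psi> ` carrier (free (Suc m)))"
      by (intro ilen_Suc F.zero_submodule)
    then have "enat k + 1 \<le> ilen R (free n) {\<zero>\<^bsub>free n\<^esub>} (?\<psi> ` carrier (free (Suc m)))"
      using \<pi>(3) by (meson add_right_mono order_trans)
    then have "enat (Suc k) \<le> ilen R (free n) {\<zero>\<^bsub>free n\<^esub>} (?\<psi> ` carrier (free (Suc m)))"
      by (simp add: eSuc_enat[symmetric] plus_1_eSuc)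
    then have "?P (Suc k)" using \<psi> sub by (intro exI[of _ "Suc m"] bexI[of _ ?\<psi>] conjI)
    then have "Suc k \<le> k" by (rule conjunct2[OF k, rule_format])
    then show False by simp
  qed
  then have "\<pi> ` carrier (free m) = N" using \<pi>(2) by blast
  moreover have "\<pi> \<in> Hom (free m) (restrict_module (free n) N)"
    using \<pi>(1,2) by (intro hom_into) auto
  ultimately show ?thesis unfolding fin_gen_def by (intro exI[of _ m] bexI[of _ \<pi>]) auto
qed

lemma fin_gen_submodule:
  assumes M: "left_module R M" and fg: "fin_gen M" and N: "submodule N R M"
  shows "fin_gen (restrict_module M N)"
proof -
  obtain n \<pi> where \<pi>: "\<pi> \<in> Hom (free n) M" "\<pi> ` carrier (free n) = carrier M"
    using fg by (auto simp: fin_gen_def)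
  let ?K = "{c \<in> carrier (free n). \<pi> c \<in> N}"
  have K: "submodule ?K R (free n)"
    by (intro submodule_preimage[OF free_left_module M \<pi>(1) left_module.carrier_submodule[OF free_left_module] N])
  have Nc: "N \<subseteq> carrier M" by (rule submodule_subset[OF M N])
  then have "\<pi> ` ?K = N" using \<pi>(2) by fastforce
  moreover then have "\<pi> \<in> Hom (restrict_module (free n) ?K) (restrict_module M N)"
    by (intro hom_restrict[OF \<pi>(1)]) auto
  ultimately show ?thesis by (intro fin_gen_hom[OF fin_gen_free_submodule[OF K]]) auto
qed

lemma fin_gen_kernel:
  assumes M: "left_module R M" and \<pi>: "\<pi> \<in> Hom (free n) M"
  shows "fin_gen (Syz n M \<pi>)"
  unfolding kernel_module_def
  by (intro fin_gen_free_submodule submodule_kernel[OF free_left_module M \<pi>])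

end

context short_local
begin

section \<open>Aligned covers\<close>

text \<open>In a cover the kernel lies in JP, so this inclusion amounts to the equation J K = J^2
  P.\<close>

definition aligned :: "('a, 'p) module \<Rightarrow> ('a, 'm) module \<Rightarrow> ('p \<Rightarrow> 'm) \<Rightarrow> bool" where
  "aligned P M p \<longleftrightarrow> rmul R P (rmul R P (carrier P)) \<subseteq> rmul R P (a_kernel P M p)"

text \<open>The depth is bounded to permit an induction on it that runs over all powers of J. The
  recursion forces one element type, that of submodules of free modules, so a module of another type
  enters only through its first kernel.\<close>

primrec koszul_upto :: "nat \<Rightarrow> ('a, nat \<Rightarrow> 'a) module \<Rightarrow> bool" where
  "koszul_upto 0 M \<longleftrightarrow> True"
| "koszul_upto (Suc k) M \<longleftrightarrow>
    (\<exists>n \<pi>. fcover M n \<pi> \<and> aligned (free n) M \<pi> \<and> koszul_upto k (Syz n M \<pi>))"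

lemma aligned_free: "aligned (free n) M \<pi> \<longleftrightarrow> tuples n J2 \<subseteq> rmul R (free n) (Ker n M \<pi>)"
  by (simp add: aligned_def rmul_free rmul_free_J)

lemma fcover_miso:
  assumes M: "left_module R M" and N: "left_module R N" and f: "miso R M N f" and \<pi>: "fcover M n \<pi>"
  shows "fcover N n (\<lambda>c. f (\<pi> c))" "Ker n N (\<lambda>c. f (\<pi> c)) = Ker n M \<pi>"
proof -
  have b: "f ` carrier M = carrier N" and h: "f \<in> Hom M N" using f by (auto simp: miso_def bij_betw_def)
  show k: "Ker n N (\<lambda>c. f (\<pi> c)) = Ker n M \<pi>"
    using miso_zero_iff[OF M N f] hom_closed[OF fcover_hom[OF \<pi>]] by (auto simp: a_kernel_eq)
  have "(\<lambda>c. f (\<pi> c)) ` carrier (free n) = carrier N"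
    using b fcover_surj[OF \<pi>] by (metis image_image)
  then show "fcover N n (\<lambda>c. f (\<pi> c))"
    using \<pi> k hom_comp[OF fcover_hom[OF \<pi>] h] by (simp add: fcover_def)
qed

lemma koszul_upto_miso:
  assumes M: "left_module R M" and N: "left_module R N" and f: "miso R M N f" and K: "koszul_upto k M"
  shows "koszul_upto k N"
proof (cases k)
  case (Suc j)
  then obtain n \<pi> where \<pi>: "fcover M n \<pi>" "aligned (free n) M \<pi>" "koszul_upto j (Syz n M \<pi>)"
    using K by auto
  note c = fcover_miso[OF M N f \<pi>(1)]
  have "aligned (free n) N (\<lambda>c. f (\<pi> c))" using \<pi>(2) c(2) by (simp add: aligned_def)
  moreover have "koszul_upto j (Syz n N (\<lambda>c. f (\<pi> c)))"
    using \<pi>(3) c(2) by (simp add: kernel_module_def)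
  ultimately show ?thesis using c(1) Suc by auto
qed simp

text \<open>An isomorphism lying over M matches the kernels and commutes with multiplication by J,
  so alignment is invariant under it.\<close>

lemma cover_transport:
  assumes P: "left_module R P" and Q: "left_module R Q" and M: "left_module R M"
    and p: "p \<in> Hom P M" and \<phi>: "miso R P Q \<phi>" and q: "\<And>x. x \<in> carrier P \<Longrightarrow> q (\<phi> x) = p x"
  shows "\<phi> ` a_kernel P M p = a_kernel Q M q"
    and "miso R (kernel_module P M p) (kernel_module Q M q) \<phi>"
    and "aligned P M p \<Longrightarrow> aligned Q M q"
proof -
  interpret P: left_module R P by fact
  have h: "\<phi> \<in> Hom P Q" and b: "\<phi> ` carrier P = carrier Q" and inj: "inj_on \<phi> (carrier P)"
    using \<phi> by (auto simp: miso_def bij_betw_def)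
  have kc: "a_kernel P M p \<subseteq> carrier P" by (auto simp: a_kernel_eq)
  show k: "\<phi> ` a_kernel P M p = a_kernel Q M q"
  proof
    show "\<phi> ` a_kernel P M p \<subseteq> a_kernel Q M q" using hom_closed[OF h] q by (auto simp: a_kernel_eq)
    show "a_kernel Q M q \<subseteq> \<phi> ` a_kernel P M p"
    proof
      fix y assume y: "y \<in> a_kernel Q M q"
      then have "y \<in> \<phi> ` carrier P" using b by (simp add: a_kernel_eq)
      then obtain x where "x \<in> carrier P" "y = \<phi> x" by blast
      then show "y \<in> \<phi> ` a_kernel P M p" using y q by (auto simp: a_kernel_eq)
    qed
  qed
  have "\<phi> \<in> Hom (kernel_module P M p) (kernel_module Q M q)"
    unfolding kernel_module_def using k by (intro hom_restrict[OF h kc]) simp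
  moreover have "inj_on \<phi> (a_kernel P M p)" using inj kc by (rule inj_on_subset)
  ultimately show "miso R (kernel_module P M p) (kernel_module Q M q) \<phi>"
    using k by (simp add: miso_def bij_betw_def kernel_module_def)
  assume "aligned P M p"
  then have "\<phi> ` rmul R P (rmul R P (carrier P)) \<subseteq> \<phi> ` rmul R P (a_kernel P M p)"
    unfolding aligned_def by (rule image_mono)
  then show "aligned Q M q"
    unfolding aligned_def
    by (simp add: rmul_hom[OF P Q h] rmul_carrier[OF P] kc b k)
qed

lemma fcover_any:
  assumes M: "left_module R M" and \<pi>: "fcover M n \<pi>" and \<pi>': "fcover M n' \<pi>'"
  shows "\<exists>\<phi>. miso R (Syz n M \<pi>) (Syz n' M \<pi>') \<phi>"
    and "aligned (free n) M \<pi> \<Longrightarrow> aligned (free n') M \<pi>'"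
proof -
  obtain \<phi> where \<phi>: "miso R (free n) (free n') \<phi>" "\<And>c. c \<in> carrier (free n) \<Longrightarrow> \<pi>' (\<phi> c) = \<pi> c"
    using fcover_unique[OF M \<pi>' \<pi>] by blast
  note t = cover_transport[OF free_left_module free_left_module M fcover_hom[OF \<pi>] \<phi>(1), of \<pi>', OF \<phi>(2)]
  show "\<exists>\<phi>. miso R (Syz n M \<pi>) (Syz n' M \<pi>') \<phi>"
    using t(2) by blast
  show "aligned (free n) M \<pi> \<Longrightarrow> aligned (free n') M \<pi>'" by (rule t(3))
qed

lemma kernel_fcover_left_module:
  "left_module R M \<Longrightarrow> fcover M n \<pi> \<Longrightarrow> left_module R (Syz n M \<pi>)"
  by (intro kernel_module_left_module free_left_module fcover_hom)

text \<open>Uniqueness of minimal covers lets the existential quantifier in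
  \<open>koszul_upto\<close> be read as a universal one.\<close>

lemma koszul_upto_SucD:
  assumes M: "left_module R M" and K: "koszul_upto (Suc k) M" and \<pi>: "fcover M n \<pi>"
  shows "aligned (free n) M \<pi>" "koszul_upto k (Syz n M \<pi>)"
proof -
  obtain n' \<pi>' where \<pi>': "fcover M n' \<pi>'" "aligned (free n') M \<pi>'" 
      "koszul_upto k (Syz n' M \<pi>')" using K by auto
  show "aligned (free n) M \<pi>" by (rule fcover_any(2)[OF M \<pi>'(1) \<pi> \<pi>'(2)])
  obtain \<phi> where "miso R (Syz n' M \<pi>') (Syz n M \<pi>) \<phi>"
    using fcover_any(1)[OF M \<pi>'(1) \<pi>] by blast
  then show "koszul_upto k (Syz n M \<pi>)"
    by (rule koszul_upto_miso[OF kernel_fcover_left_module[OF M \<pi>'(1)] kernel_fcover_left_module[OF M \<pi>] _ \<pi>'(3)])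
qed

section \<open>Extensions\<close>

text \<open>The last clause makes the sequence of tops exact, so that minimal covers of the two ends
  combine to a minimal cover of the middle.\<close>

definition ses :: "('a, 'u) module \<Rightarrow> ('a, 'v) module \<Rightarrow> ('a, 'w) module \<Rightarrow> ('u \<Rightarrow> 'v) \<Rightarrow> ('v \<Rightarrow> 'w) \<Rightarrow> bool" where
  "ses U V W f g \<longleftrightarrow> left_module R U \<and> left_module R V \<and> left_module R W \<and>
    f \<in> Hom U V \<and> g \<in> Hom V W \<and> inj_on f (carrier U) \<and> g ` carrier V = carrier W \<and>
    a_kernel V W g = f ` carrier U \<and>
    f ` carrier U \<inter> rmul R V (carrier V) \<subseteq> f ` rmul R U (carrier U)"

text \<open>A biproduct: f and \<tau> are the inclusions, \<rho> and g the projections. The maps are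
  kept explicit because the same coordinate maps have to split the sequence of kernels.\<close>

definition dsum :: "('a, 'u) module \<Rightarrow> ('a, 'v) module \<Rightarrow> ('a, 'w) module \<Rightarrow>
    ('u \<Rightarrow> 'v) \<Rightarrow> ('v \<Rightarrow> 'w) \<Rightarrow> ('v \<Rightarrow> 'u) \<Rightarrow> ('w \<Rightarrow> 'v) \<Rightarrow> bool" where
  "dsum U V W f g \<rho> \<tau> \<longleftrightarrow> left_module R U \<and> left_module R V \<and> left_module R W \<and>
    f \<in> Hom U V \<and> g \<in> Hom V W \<and> \<rho> \<in> Hom V U \<and> \<tau> \<in> Hom W V \<and>
    (\<forall>u\<in>carrier U. \<rho> (f u) = u \<and> g (f u) = \<zero>\<^bsub>W\<^esub>) \<and>
    (\<forall>w\<in>carrier W. g (\<tau> w) = w \<and> \<rho> (\<tau> w) = \<zero>\<^bsub>U\<^esub>) \<and>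
    (\<forall>v\<in>carrier V. v = f (\<rho> v) \<oplus>\<^bsub>V\<^esub> \<tau> (g v))"

lemma dsum_ses:
  assumes "dsum U V W f g \<rho> \<tau>" shows "ses U V W f g"
proof -
  have U: "left_module R U" and V: "left_module R V" and W: "left_module R W"
    and f: "f \<in> Hom U V" and g: "g \<in> Hom V W" and \<rho>: "\<rho> \<in> Hom V U" and \<tau>: "\<tau> \<in> Hom W V"
    and \<rho>f: "\<And>u. u \<in> carrier U \<Longrightarrow> \<rho> (f u) = u" and gf: "\<And>u. u \<in> carrier U \<Longrightarrow> g (f u) = \<zero>\<^bsub>W\<^esub>"
    and g\<tau>: "\<And>w. w \<in> carrier W \<Longrightarrow> g (\<tau> w) = w"
    and dec: "\<And>v. v \<in> carrier V \<Longrightarrow> v = f (\<rho> v) \<oplus>\<^bsub>V\<^esub> \<tau> (g v)"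
    using assms unfolding dsum_def by blast+
  interpret V: left_module R V by fact
  have inj: "inj_on f (carrier U)" by (rule inj_on_inverseI[of _ \<rho>]) (rule \<rho>f)
  have surj: "g ` carrier V = carrier W"
  proof
    show "g ` carrier V \<subseteq> carrier W" using hom_closed[OF g] by blast
    show "carrier W \<subseteq> g ` carrier V"
    proof
      fix w assume w: "w \<in> carrier W"
      show "w \<in> g ` carrier V" using g\<tau>[OF w] hom_closed[OF \<tau> w] by (metis imageI)
    qed
  qed
  have ker: "a_kernel V W g = f ` carrier U"
  proof
    show "f ` carrier U \<subseteq> a_kernel V W g" using hom_closed[OF f] gf by (auto simp: a_kernel_eq)
    show "a_kernel V W g \<subseteq> f ` carrier U"
    proof
      fix v assume v: "v \<in> a_kernel V W g"
      then have vc: "v \<in> carrier V" "g v = \<zero>\<^bsub>W\<^esub>" by (auto simp: a_kernel_eq)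
      have "\<tau> (g v) = \<zero>\<^bsub>V\<^esub>" using vc hom_zero[OF W V \<tau>] by simp
      then have "v = f (\<rho> v)" using dec[OF vc(1)] hom_closed[OF f hom_closed[OF \<rho> vc(1)]] by simp
      then show "v \<in> f ` carrier U" using hom_closed[OF \<rho> vc(1)] by blast
    qed
  qed
  \<comment> \<open>If f u lies in JV, the retraction gives u = \<rho> (f u) in JU.\<close>
  have top: "f ` carrier U \<inter> rmul R V (carrier V) \<subseteq> f ` rmul R U (carrier U)"
  proof
    fix v assume v: "v \<in> f ` carrier U \<inter> rmul R V (carrier V)"
    then obtain u where u: "u \<in> carrier U" "v = f u" by auto
    have im: "\<rho> ` carrier V \<subseteq> carrier U" using hom_closed[OF \<rho>] by blast
    have "\<rho> v \<in> \<rho> ` rmul R V (carrier V)" using v by blast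
    then have "\<rho> v \<in> rmul R U (carrier U)"
      using rmul_hom[OF V U \<rho> order_refl] rmul_mono[OF U order_refl im] by auto
    then have "u \<in> rmul R U (carrier U)" using u \<rho>f by simp
    then show "v \<in> f ` rmul R U (carrier U)" using u by blast
  qed
  show ?thesis using U V W f g inj surj ker top by (simp add: ses_def)
qed

abbreviation tail :: "nat \<Rightarrow> nat \<Rightarrow> (nat \<Rightarrow> 'a) \<Rightarrow> nat \<Rightarrow> 'a" where
  "tail p q \<equiv> recoord q (\<lambda>i. Some (p + i))"
abbreviation untail :: "nat \<Rightarrow> nat \<Rightarrow> (nat \<Rightarrow> 'a) \<Rightarrow> nat \<Rightarrow> 'a" where
  "untail p q \<equiv> recoord (p + q) (\<lambda>i. if i < p then None else Some (i - p))"

lemma free_dsum: "dsum (free p) (free (p + q)) (free q) (ext p (p + q)) (tail p q) (trunc p) (untail p q)"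
  unfolding dsum_def
proof (intro conjI ballI free_left_module recoord_hom)
  fix u assume "u \<in> carrier (free p)"
  then have u: "u \<in> tuples p (carrier R)" by (simp add: free_module_simps)
  show "trunc p (ext p (p + q) u) = u"
    by (rule free_eqI[OF _ u, of _ UNIV]) (auto simp: recoord_def)
  show "tail p q (ext p (p + q) u) = \<zero>\<^bsub>free q\<^esub>"
    by (auto simp: recoord_def free_module_simps)
next
  fix w assume "w \<in> carrier (free q)"
  then have w: "w \<in> tuples q (carrier R)" by (simp add: free_module_simps)
  show "tail p q (untail p q w) = w"
    by (rule free_eqI[OF _ w, of _ UNIV]) (auto simp: recoord_def)
  show "trunc p (untail p q w) = \<zero>\<^bsub>free p\<^esub>"
    by (auto simp: recoord_def free_module_simps)
next
  fix v assume "v \<in> carrier (free (p + q))"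
  then have v: "v \<in> tuples (p + q) (carrier R)" by (simp add: free_module_simps)
  show "v = ext p (p + q) (trunc p v) \<oplus>\<^bsub>free (p + q)\<^esub> untail p q (tail p q v)"
    using v by (intro free_eqI[OF v, of _ UNIV]) (auto simp: recoord_def free_module_simps PiE_iff)
qed (auto split: if_splits)

lemma dsum_restrict:
  assumes d: "dsum U V W f g \<rho> \<tau>" and A: "submodule A R U" and B: "submodule B R V" and C: "submodule C R W"
    and m: "f ` A \<subseteq> B" "g ` B \<subseteq> C" "\<rho> ` B \<subseteq> A" "\<tau> ` C \<subseteq> B"
  shows "dsum (restrict_module U A) (restrict_module V B) (restrict_module W C) f g \<rho> \<tau>"
proof -
  have U: "left_module R U" and V: "left_module R V" and W: "left_module R W"
    and f: "f \<in> Hom U V" and g: "g \<in> Hom V W" and \<rho>: "\<rho> \<in> Hom V U" and \<tau>: "\<tau> \<in> Hom W V"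
    using d unfolding dsum_def by blast+
  note s = submodule_subset[OF U A] submodule_subset[OF V B] submodule_subset[OF W C]
  show ?thesis unfolding dsum_def restrict_module_simps
    using d s unfolding dsum_def
    by (intro conjI restrict_left_module hom_restrict A B C m f g \<rho> \<tau>) blast+
qed

section \<open>The horseshoe construction with minimal covers\<close>

text \<open>The first p coordinates are mapped through the cover \<alpha> of the submodule, the last
  q through \<gamma>', a lift to V of the cover of the quotient.\<close>

definition horseshoe_cover :: "('a, 'v) module \<Rightarrow> ('u \<Rightarrow> 'v) \<Rightarrow> nat \<Rightarrow> nat \<Rightarrow> ((nat \<Rightarrow> 'a) \<Rightarrow> 'u) \<Rightarrow>
    ((nat \<Rightarrow> 'a) \<Rightarrow> 'v) \<Rightarrow> (nat \<Rightarrow> 'a) \<Rightarrow> 'v" where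
  "horseshoe_cover V f p q \<alpha> \<gamma>' b = f (\<alpha> (trunc p b)) \<oplus>\<^bsub>V\<^esub> \<gamma>' (tail p q b)"

text \<open>The data are bundled into one premise, so that each fact about the construction can be
  instantiated by a single theorem.\<close>

definition lifted_covers where
  "lifted_covers U V W f g p q \<alpha> \<gamma> \<gamma>' \<longleftrightarrow> ses U V W f g \<and> fcover U p \<alpha> \<and> fcover W q \<gamma> \<and>
     \<gamma>' \<in> Hom (free q) V \<and> (\<forall>d\<in>carrier (free q). g (\<gamma>' d) = \<gamma> d)"

context
  fixes U :: "('a, 'u) module" and V :: "('a, 'v) module" and W :: "('a, 'w) module" 
    and f :: "'u \<Rightarrow> 'v" and g :: "'v \<Rightarrow> 'w" and p q :: nat and \<alpha> \<gamma> \<gamma>'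
  assumes covers: "lifted_covers U V W f g p q \<alpha> \<gamma> \<gamma>'"
begin

lemma ses: "ses U V W f g" and \<alpha>: "fcover U p \<alpha>" and \<gamma>: "fcover W q \<gamma>" and \<gamma>': "\<gamma>' \<in> Hom (free q) V"
  using covers by (simp_all add: lifted_covers_def)

abbreviation "hc \<equiv> horseshoe_cover V f p q \<alpha> \<gamma>'"

lemma lift_eq: "d \<in> carrier (free q) \<Longrightarrow> g (\<gamma>' d) = \<gamma> d"
  using covers by (simp add: lifted_covers_def)

lemma sesD: "left_module R U" "left_module R V" "left_module R W"
    "f \<in> Hom U V" "g \<in> Hom V W" "inj_on f (carrier U)" "g ` carrier V = carrier W"
    "a_kernel V W g = f ` carrier U"
    "f ` carrier U \<inter> rmul R V (carrier V) \<subseteq> f ` rmul R U (carrier U)"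
  using ses unfolding ses_def by blast+

lemma f_zero_iff: "u \<in> carrier U \<Longrightarrow> f u = \<zero>\<^bsub>V\<^esub> \<longleftrightarrow> u = \<zero>\<^bsub>U\<^esub>"
  using hom_inj_iff[OF sesD(1,2,4)] hom_zero[OF sesD(1,2,4)] sesD(6) by auto

lemma gf_zero: "u \<in> carrier U \<Longrightarrow> g (f u) = \<zero>\<^bsub>W\<^esub>"
proof -
  assume "u \<in> carrier U"
  then have "f u \<in> a_kernel V W g" unfolding sesD(8) by blast
  then show ?thesis by (simp add: a_kernel_eq)
qed

lemma tr: "trunc p \<in> Hom (free (p + q)) (free p)" and tl: "tail p q \<in> Hom (free (p + q)) (free q)"
  and ex: "ext p (p + q) \<in> Hom (free p) (free (p + q))" and ut: "untail p q \<in> Hom (free q) (free (p + q))"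
  by (rule recoord_hom, auto split: if_splits)+

lemma parts:
  "c \<in> carrier (free p) \<Longrightarrow> trunc p (ext p (p + q) c) = c"
  "c \<in> carrier (free p) \<Longrightarrow> tail p q (ext p (p + q) c) = \<zero>\<^bsub>free q\<^esub>"
  "d \<in> carrier (free q) \<Longrightarrow> tail p q (untail p q d) = d"
  "d \<in> carrier (free q) \<Longrightarrow> trunc p (untail p q d) = \<zero>\<^bsub>free p\<^esub>"
  "b \<in> carrier (free (p + q)) \<Longrightarrow> ext p (p + q) (trunc p b) \<oplus>\<^bsub>free (p + q)\<^esub> untail p q (tail p q b) = b"
  using free_dsum[of p q] unfolding dsum_def by simp_all

lemma horseshoe_hom: "hc \<in> Hom (free (p + q)) V"
proof -
  interpret V: left_module R V by (rule sesD)
  have 1: "(\<lambda>b. f (\<alpha> (trunc p b))) \<in> Hom (free (p + q)) V"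
    by (rule hom_comp[OF hom_comp[OF tr fcover_hom[OF \<alpha>]] sesD(4)])
  have 2: "(\<lambda>b. \<gamma>' (tail p q b)) \<in> Hom (free (p + q)) V"
    by (rule hom_comp[OF tl \<gamma>'])
  note c = hom_closed[OF 1] hom_closed[OF 2]
  show ?thesis
  proof (rule homI)
    fix x y assume xy: "x \<in> carrier (free (p + q))" "y \<in> carrier (free (p + q))"
    show "hc (x \<oplus>\<^bsub>free (p + q)\<^esub> y) = hc x \<oplus>\<^bsub>V\<^esub> hc y"
      unfolding horseshoe_cover_def hom_add[OF 1 xy] hom_add[OF 2 xy]
      using c[OF xy(1)] c[OF xy(2)] by (simp add: V.M.a_ac)
  next
    fix a x assume x: "a \<in> carrier R" "x \<in> carrier (free (p + q))"
    show "hc (a \<odot>\<^bsub>free (p + q)\<^esub> x) = a \<odot>\<^bsub>V\<^esub> hc x"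
      unfolding horseshoe_cover_def hom_smult[OF 1 x] hom_smult[OF 2 x]
      using c[OF x(2)] x by (simp add: V.smult_r_distr)
  qed (simp add: horseshoe_cover_def c)
qed

lemma horseshoe_ext: "c \<in> carrier (free p) \<Longrightarrow> hc (ext p (p + q) c) = f (\<alpha> c)"
proof -
  interpret V: left_module R V by (rule sesD)
  assume c: "c \<in> carrier (free p)"
  then have "f (\<alpha> c) \<in> carrier V" using hom_closed[OF sesD(4)] hom_closed[OF fcover_hom[OF \<alpha>]] by blast
  then show ?thesis unfolding horseshoe_cover_def parts(1)[OF c] parts(2)[OF c]
    using hom_zero[OF free_left_module sesD(2) \<gamma>'] by simp
qed

lemma horseshoe_untail: "d \<in> carrier (free q) \<Longrightarrow> hc (untail p q d) = \<gamma>' d"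
proof -
  interpret V: left_module R V by (rule sesD)
  assume d: "d \<in> carrier (free q)"
  show ?thesis unfolding horseshoe_cover_def parts(3)[OF d] parts(4)[OF d]
    using hom_zero[OF free_left_module sesD(1) fcover_hom[OF \<alpha>]] hom_zero[OF sesD(1,2,4)] 
      hom_closed[OF \<gamma>' d] by simp
qed

lemma horseshoe_tail: "b \<in> carrier (free (p + q)) \<Longrightarrow> g (hc b) = \<gamma> (tail p q b)"
proof -
  interpret W: left_module R W by (rule sesD)
  assume b: "b \<in> carrier (free (p + q))"
  note c = hom_closed[OF tr b] hom_closed[OF tl b]
  have u: "\<alpha> (trunc p b) \<in> carrier U" using hom_closed[OF fcover_hom[OF \<alpha>]] c by blast
  show ?thesis unfolding horseshoe_cover_def
    using hom_add[OF sesD(5) hom_closed[OF sesD(4) u] hom_closed[OF \<gamma>' c(2)]] gf_zero[OF u] lift_eq[OF c(2)]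
      hom_closed[OF fcover_hom[OF \<gamma>] c(2)] by simp
qed

text \<open>Minimality is where exactness on tops enters. If (c, d) maps to 0, then d has entries in
  J, so \<gamma>' d and hence f (\<alpha> c) lie in JV. Exactness on tops moves \<alpha> c into JU =
  \<alpha> (J^p), and c differs from an element of J^p by an element of the kernel of \<alpha>,
  which lies in J^p as well.\<close>

lemma horseshoe_fcover: "fcover V (p + q) hc"
proof (rule fcoverI[OF horseshoe_hom])
  interpret V: left_module R V by (rule sesD)
  interpret W: left_module R W by (rule sesD)
  interpret F: left_module R "free (p + q)" by (rule free_left_module)
  {
    fix v assume v: "v \<in> carrier V"
    have "g v \<in> \<gamma> ` carrier (free q)" using hom_closed[OF sesD(5) v] fcover_surj[OF \<gamma>] by simp
    then obtain d where d: "d \<in> carrier (free q)" "g v = \<gamma> d" by blast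
    have gd: "\<gamma>' d \<in> carrier V" using hom_closed[OF \<gamma>' d(1)] .
    have "g (v \<ominus>\<^bsub>V\<^esub> \<gamma>' d) = \<zero>\<^bsub>W\<^esub>"
      using d lift_eq hom_closed[OF sesD(5) v] by (simp add: hom_diff[OF sesD(2,3,5) v gd] W.diff_zero_iff)
    then have "v \<ominus>\<^bsub>V\<^esub> \<gamma>' d \<in> f ` carrier U" using v gd sesD(8) by (auto simp: a_kernel_eq)
    then obtain u where u: "u \<in> carrier U" "v \<ominus>\<^bsub>V\<^esub> \<gamma>' d = f u" by blast
    then have "u \<in> \<alpha> ` carrier (free p)" using fcover_surj[OF \<alpha>] by simp
    then obtain c where c: "c \<in> carrier (free p)" "u = \<alpha> c" by blast
    note ec = hom_closed[OF ex c(1)] and ed = hom_closed[OF ut d(1)]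
    have "hc (ext p (p + q) c \<oplus>\<^bsub>free (p + q)\<^esub> untail p q d) = (v \<ominus>\<^bsub>V\<^esub> \<gamma>' d) \<oplus>\<^bsub>V\<^esub> \<gamma>' d"
      using u c d by (simp add: hom_add[OF horseshoe_hom ec ed] horseshoe_ext horseshoe_untail)
    also have "\<dots> = v" by (rule V.diff_add_cancel[OF v gd])
    finally have "hc (ext p (p + q) c \<oplus>\<^bsub>free (p + q)\<^esub> untail p q d) = v" .
    moreover have "ext p (p + q) c \<oplus>\<^bsub>free (p + q)\<^esub> untail p q d \<in> carrier (free (p + q))" using ec ed by simp
    ultimately show "\<exists>b\<in>carrier (free (p + q)). hc b = v" by blast
  }
  fix b i assume b: "b \<in> carrier (free (p + q))" "hc b = \<zero>\<^bsub>V\<^esub>" and i: "i < p + q"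
  let ?c = "trunc p b" and ?d = "tail p q b"
  note c = hom_closed[OF tr b(1)] and d = hom_closed[OF tl b(1)]
  have "\<gamma> ?d = \<zero>\<^bsub>W\<^esub>" using horseshoe_tail[OF b(1)] b(2) hom_zero[OF sesD(2,3,5)] by simp
  then have dJ: "?d \<in> tuples q J" by (rule fcover_ker[OF \<gamma> d])
  then have "?d \<in> rmul R (free q) (carrier (free q))" by (simp add: rmul_free)
  then have "\<gamma>' ?d \<in> \<gamma>' ` rmul R (free q) (carrier (free q))" by (rule imageI)
  moreover have "\<gamma>' ` carrier (free q) \<subseteq> carrier V" using hom_closed[OF \<gamma>'] by blast
  ultimately have g'd: "\<gamma>' ?d \<in> rmul R V (carrier V)"
    using rmul_hom[OF free_left_module sesD(2) \<gamma>' order_refl] rmul_mono[OF sesD(2) order_refl] by blast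
  have ac: "\<alpha> ?c \<in> carrier U" using hom_closed[OF fcover_hom[OF \<alpha>] c] .
  have fac: "f (\<alpha> ?c) \<in> carrier V" using hom_closed[OF sesD(4) ac] .
  have "f (\<alpha> ?c) \<oplus>\<^bsub>V\<^esub> \<gamma>' ?d = \<zero>\<^bsub>V\<^esub>" using b(2) by (simp add: horseshoe_cover_def)
  then have "f (\<alpha> ?c) = \<ominus>\<^bsub>V\<^esub> \<gamma>' ?d" using fac hom_closed[OF \<gamma>' d] by (simp add: V.M.minus_equality)
  then have "f (\<alpha> ?c) \<in> rmul R V (carrier V)"
    using V.submodule_minus[OF rmul_submodule[OF sesD(2) order_refl] g'd] by simp
  then have "f (\<alpha> ?c) \<in> f ` rmul R U (carrier U)" using sesD(9) ac by blast
  then obtain u where u: "u \<in> rmul R U (carrier U)" "f (\<alpha> ?c) = f u" by blast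
  then have "\<alpha> ?c = u" using sesD(6) ac rmul_carrier[OF sesD(1) order_refl] by (auto dest: inj_onD)
  then have "\<alpha> ?c \<in> \<alpha> ` rmul R (free p) (carrier (free p))"
    using u rmul_hom[OF free_left_module sesD(1) fcover_hom[OF \<alpha>] order_refl] fcover_surj[OF \<alpha>] by simp
  then obtain c' where c': "c' \<in> tuples p J" "\<alpha> ?c = \<alpha> c'" by (auto simp: rmul_free)
  have c'c: "c' \<in> carrier (free p)" using c' J_subset by (auto simp: free_module_simps PiE_iff)
  interpret U: left_module R U by (rule sesD)
  interpret Fp: left_module R "free p" by (rule free_left_module)
  have "\<alpha> (?c \<ominus>\<^bsub>free p\<^esub> c') = \<zero>\<^bsub>U\<^esub>"
    using c'(2) hom_closed[OF fcover_hom[OF \<alpha>] c'c] by (simp add: hom_diff[OF Fp.lm sesD(1) fcover_hom[OF \<alpha>] c c'c] U.diff_zero_iff)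
  then have "?c \<ominus>\<^bsub>free p\<^esub> c' \<in> tuples p J" using c c'c by (intro fcover_ker[OF \<alpha>]) auto
  moreover have sJ: "submodule (tuples p J) R (free p)" by (rule power_submodule[OF J_submodule])
  ultimately have "(?c \<ominus>\<^bsub>free p\<^esub> c') \<oplus>\<^bsub>free p\<^esub> c' \<in> tuples p J" using c'(1) unfolding Fp.submodule_iff by blast
  then have cJ: "?c \<in> tuples p J" using c c'c by (simp add: Fp.diff_add_cancel)
  show "b i \<in> J"
  proof (cases "i < p")
    case True then show ?thesis using PiE_mem[OF cJ, of i] by (simp add: recoord_def)
  next
    case False then show ?thesis using PiE_mem[OF dJ, of "i - p"] i by (simp add: recoord_def)
  qed
qed

abbreviation "KU \<equiv> Syz p U \<alpha>"
abbreviation "KV \<equiv> Syz (p + q) V hc"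
abbreviation "KW \<equiv> Syz q W \<gamma>"

lemma horseshoe_ker_maps:
  "ext p (p + q) ` Ker p U \<alpha> \<subseteq> Ker (p + q) V hc"
  "tail p q ` Ker (p + q) V hc \<subseteq> Ker q W \<gamma>"
proof -
  show "ext p (p + q) ` Ker p U \<alpha> \<subseteq> Ker (p + q) V hc"
    using horseshoe_ext hom_closed[OF ex] hom_zero[OF sesD(1,2,4)] by (auto simp: a_kernel_eq)
  show "tail p q ` Ker (p + q) V hc \<subseteq> Ker q W \<gamma>"
    using horseshoe_tail[symmetric] hom_closed[OF tl] hom_zero[OF sesD(2,3,5)] by (auto simp: a_kernel_eq)
qed

text \<open>The kernel part of the nine lemma: \<gamma>' d lies in the image of U whenever \<gamma>
  d vanishes, and can be compensated there.\<close>

lemma horseshoe_exact: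
  "tail p q ` Ker (p + q) V hc = Ker q W \<gamma>"
  "{b \<in> Ker (p + q) V hc. tail p q b = \<zero>\<^bsub>free q\<^esub>} = ext p (p + q) ` Ker p U \<alpha>"
proof -
  interpret V: left_module R V by (rule sesD)
  interpret U: left_module R U by (rule sesD)
  interpret F: left_module R "free (p + q)" by (rule free_left_module)
  interpret Fp: left_module R "free p" by (rule free_left_module)
  interpret Fq: left_module R "free q" by (rule free_left_module)
  have "d \<in> tail p q ` Ker (p + q) V hc" if d: "d \<in> carrier (free q)" "\<gamma> d = \<zero>\<^bsub>W\<^esub>" for d
  proof -
    have g'd: "\<gamma>' d \<in> carrier V" "g (\<gamma>' d) = \<zero>\<^bsub>W\<^esub>" using d lift_eq hom_closed[OF \<gamma>'] by auto
    then have "\<gamma>' d \<in> f ` carrier U" unfolding sesD(8)[symmetric] by (simp add: a_kernel_eq)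
    then obtain u where u: "u \<in> carrier U" "\<gamma>' d = f u" by blast
    \<comment> \<open>The sign makes the first p coordinates cancel the contribution of the lift of
      d.\<close>
    then have "\<ominus>\<^bsub>U\<^esub> u \<in> \<alpha> ` carrier (free p)" using fcover_surj[OF \<alpha>] by simp
    then obtain c where c: "c \<in> carrier (free p)" "\<alpha> c = \<ominus>\<^bsub>U\<^esub> u" by auto
    let ?b = "ext p (p + q) c \<oplus>\<^bsub>free (p + q)\<^esub> untail p q d"
    note ec = hom_closed[OF ex c(1)] and ed = hom_closed[OF ut d(1)]
    have "hc ?b = (\<ominus>\<^bsub>V\<^esub> f u) \<oplus>\<^bsub>V\<^esub> f u"
      using u c d by (simp add: hom_add[OF horseshoe_hom ec ed] horseshoe_ext horseshoe_untail hom_minus[OF sesD(1,2,4)])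
    then have "hc ?b = \<zero>\<^bsub>V\<^esub>" using hom_closed[OF sesD(4) u(1)] by (simp add: V.M.l_neg)
    moreover have "d = tail p q ?b"
      using parts(2)[OF c(1)] parts(3)[OF d(1)] d(1) by (simp add: hom_add[OF tl ec ed])
    moreover have "?b \<in> carrier (free (p + q))" using ec ed by simp
    ultimately have "?b \<in> Ker (p + q) V hc" by (simp add: a_kernel_eq)
    with \<open>d = tail p q ?b\<close> show ?thesis by (rule image_eqI)
  qed
  then show "tail p q ` Ker (p + q) V hc = Ker q W \<gamma>"
    using horseshoe_ker_maps(2) by (intro equalityI subsetI) (auto simp: a_kernel_eq)
  show "{b \<in> Ker (p + q) V hc. tail p q b = \<zero>\<^bsub>free q\<^esub>} = ext p (p + q) ` Ker p U \<alpha>"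
  proof (intro equalityI subsetI)
    fix b assume "b \<in> {b \<in> Ker (p + q) V hc. tail p q b = \<zero>\<^bsub>free q\<^esub>}"
    then have b: "b \<in> carrier (free (p + q))" "hc b = \<zero>\<^bsub>V\<^esub>" "tail p q b = \<zero>\<^bsub>free q\<^esub>"
      by (auto simp: a_kernel_eq)
    note c = hom_closed[OF tr b(1)]
    have e: "ext p (p + q) (trunc p b) = b"
      using parts(5)[OF b(1)] b(3) hom_zero[OF Fq.lm F.lm ut] hom_closed[OF ex c] by simp
    have "f (\<alpha> (trunc p b)) = \<zero>\<^bsub>V\<^esub>" using horseshoe_ext[OF c] e b(2) by simp
    then have "\<alpha> (trunc p b) = \<zero>\<^bsub>U\<^esub>" using f_zero_iff[OF hom_closed[OF fcover_hom[OF \<alpha>] c]] by simp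
    then have "trunc p b \<in> Ker p U \<alpha>" using c by (simp add: a_kernel_eq)
    then show "b \<in> ext p (p + q) ` Ker p U \<alpha>" using image_eqI[where f = "ext p (p + q)", OF e[symmetric]] by blast
  next
    fix b assume b: "b \<in> ext p (p + q) ` Ker p U \<alpha>"
    then have "b \<in> Ker (p + q) V hc" using horseshoe_ker_maps(1) by blast
    moreover have "tail p q b = \<zero>\<^bsub>free q\<^esub>" using b parts(2) by (auto simp: a_kernel_eq)
    ultimately show "b \<in> {b \<in> Ker (p + q) V hc. tail p q b = \<zero>\<^bsub>free q\<^esub>}" by simp
  qed
qed

lemma ker_subs: "submodule (Ker p U \<alpha>) R (free p)"
   "submodule (Ker (p + q) V hc) R (free (p + q))"
   "submodule (Ker q W \<gamma>) R (free q)"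
  by (intro submodule_kernel free_left_module sesD fcover_hom[OF \<alpha>] fcover_hom[OF \<gamma>] horseshoe_hom)+

lemma ker_le: "Ker p U \<alpha> \<subseteq> carrier (free p)"
   "Ker (p + q) V hc \<subseteq> carrier (free (p + q))"
   "Ker q W \<gamma> \<subseteq> carrier (free q)"
  by (auto simp: a_kernel_eq)

lemma rmul_ker_J2: "rmul R (free (p + q)) (Ker (p + q) V hc) \<subseteq> tuples (p + q) J2"
proof -
  have 1: "Ker (p + q) V hc \<subseteq> tuples (p + q) J" using horseshoe_fcover by (simp add: fcover_def)
  have 2: "tuples (p + q) J \<subseteq> carrier (free (p + q))" using J_subset by (auto simp: free_module_simps PiE_iff)
  show ?thesis using rmul_mono[OF free_left_module 2 1] by (simp add: rmul_free_J)
qed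

text \<open>Exactness on tops is inherited thanks to alignment at the left end: an element of KU in
  J KV has all entries in J^2, since KV lies in the radical, and alignment of U puts such elements
  of KU into J KU.\<close>

lemma horseshoe_ses:
  assumes "aligned (free p) U \<alpha>" shows "ses KU KV KW (ext p (p + q)) (tail p q)"
proof -
  have inj: "inj_on (ext p (p + q)) (Ker p U \<alpha>)"
    using ker_le(1) parts(1) by (intro inj_on_inverseI[of _ "trunc p"]) blast
  have top: "ext p (p + q) ` Ker p U \<alpha> \<inter> rmul R KV (carrier KV) \<subseteq> ext p (p + q) ` rmul R KU (carrier KU)"
  proof
    fix b assume b: "b \<in> ext p (p + q) ` Ker p U \<alpha> \<inter> rmul R KV (carrier KV)"
    then obtain c where c: "c \<in> Ker p U \<alpha>" "b = ext p (p + q) c" by blast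
    have "b \<in> rmul R (free (p + q)) (Ker (p + q) V hc)"
      using b rmul_restrict[OF free_left_module ker_subs(2) order_refl] by (simp add: kernel_module_def)
    then have bJ: "b \<in> tuples (p + q) J2" using rmul_ker_J2 by blast
    have "c \<in> tuples p J2"
    proof (rule PiE_I)
      fix i assume "i \<in> {..<p}"
      then show "c i \<in> J2" using PiE_mem[OF bJ, of i] c(2) by (simp add: recoord_def)
    next
      fix i assume "i \<notin> {..<p}"
      then show "c i = undefined" using c(1) by (auto simp: a_kernel_eq free_module_simps)
    qed
    then have "c \<in> rmul R (free p) (Ker p U \<alpha>)" using assms by (auto simp: aligned_free)
    then have "c \<in> rmul R KU (carrier KU)"
      using rmul_restrict[OF free_left_module ker_subs(1) order_refl] by (simp add: kernel_module_def)
    then show "b \<in> ext p (p + q) ` rmul R KU (carrier KU)" using c(2) by blast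
  qed
  have ker: "a_kernel KV KW (tail p q) = ext p (p + q) ` Ker p U \<alpha>"
    using horseshoe_exact(2) by (subst a_kernel_eq) (simp add: kernel_module_def)
  have m: "ext p (p + q) \<in> Hom KU KV" "tail p q \<in> Hom KV KW"
    unfolding kernel_module_def by (rule hom_restrict[OF ex ker_le(1) horseshoe_ker_maps(1)], rule hom_restrict[OF tl ker_le(2) horseshoe_ker_maps(2)])
  have car: "carrier KU = Ker p U \<alpha>" "carrier KV = Ker (p + q) V hc"
    "carrier KW = Ker q W \<gamma>" by (simp_all add: kernel_module_def)
  have lms: "left_module R KU" "left_module R KV" "left_module R KW"
    unfolding kernel_module_def by (intro restrict_left_module free_left_module ker_subs)+
  show ?thesis unfolding ses_def using inj top ker m lms horseshoe_exact(1) by (simp add: car)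
qed

text \<open>The tail of a vector with entries in J^2 lies in J KW and lifts to an element u of J KV.
  What remains has zero tail and still has entries in J^2, so it belongs to J KU, which maps into J
  KV.\<close>

lemma horseshoe_aligned:
  assumes au: "aligned (free p) U \<alpha>" and aw: "aligned (free q) W \<gamma>"
  shows "aligned (free (p + q)) V hc"
  unfolding aligned_free
proof
  interpret F: left_module R "free (p + q)" by (rule free_left_module)
  let ?KV = "Ker (p + q) V hc"
  have rs: "submodule (rmul R (free (p + q)) ?KV) R (free (p + q))"
    by (rule rmul_submodule[OF F.lm ker_le(2)])
  fix b assume b: "b \<in> tuples (p + q) J2"
  have J2c: "J2 \<subseteq> carrier R" using J2_J J_subset by blast
  have bc: "b \<in> carrier (free (p + q))" using b J2c by (auto simp: free_module_simps PiE_iff)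
  have "tail p q b \<in> tuples q J2" by (rule recoord_mem[OF _ b]) (use J2_submodule in \<open>auto simp: left_module.submodule_iff[OF regular_left_module]\<close>)
  then have "tail p q b \<in> rmul R (free q) (Ker q W \<gamma>)" using aw by (auto simp: aligned_free)
  then have "tail p q b \<in> tail p q ` rmul R (free (p + q)) ?KV"
    using rmul_hom[OF F.lm free_left_module tl ker_le(2)] horseshoe_exact(1) by simp
  then obtain u where u: "u \<in> rmul R (free (p + q)) ?KV" "tail p q b = tail p q u" by blast
  have uc: "u \<in> carrier (free (p + q))" using u rs by (auto simp: F.submodule_iff)
  let ?x = "b \<ominus>\<^bsub>free (p + q)\<^esub> u"
  have xJ: "?x \<in> tuples (p + q) J2"
    using F.submodule_diff[OF power_submodule[OF J2_submodule] b] u(1) rmul_ker_J2 by blast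
  have xc: "?x \<in> carrier (free (p + q))" using bc uc by simp
  interpret Fq: left_module R "free q" by (rule free_left_module)
  have "tail p q ?x = \<zero>\<^bsub>free q\<^esub>"
    using u(2) hom_closed[OF tl uc] by (simp add: hom_diff[OF F.lm Fq.lm tl bc uc] Fq.diff_zero_iff)
  then have xe: "ext p (p + q) (trunc p ?x) = ?x"
    using parts(5)[OF xc] hom_zero[OF Fq.lm F.lm ut] hom_closed[OF ex hom_closed[OF tr xc]] by simp
  have "trunc p ?x \<in> tuples p J2" by (rule recoord_mem[OF _ xJ]) (use J2_submodule in \<open>auto simp: left_module.submodule_iff[OF regular_left_module]\<close>)
  then have "trunc p ?x \<in> rmul R (free p) (Ker p U \<alpha>)" using au by (auto simp: aligned_free)
  then have "ext p (p + q) (trunc p ?x) \<in> ext p (p + q) ` rmul R (free p) (Ker p U \<alpha>)" by (rule imageI)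
  then have "?x \<in> rmul R (free (p + q)) (ext p (p + q) ` Ker p U \<alpha>)"
    unfolding xe using rmul_hom[OF free_left_module F.lm ex ker_le(1)] by simp
  then have "?x \<in> rmul R (free (p + q)) ?KV"
    using rmul_mono[OF F.lm ker_le(2) horseshoe_ker_maps(1)] by blast
  then have "u \<oplus>\<^bsub>free (p + q)\<^esub> ?x \<in> rmul R (free (p + q)) ?KV" using rs u(1) unfolding F.submodule_iff by blast
  then show "b \<in> rmul R (free (p + q)) ?KV" using F.add_diff_cancel[OF bc uc] by simp
qed

end

lemma ses_lift:
  assumes "ses U V W f g" "fcover W q \<gamma>"
  shows "\<exists>\<gamma>'\<in>Hom (free q) V. \<forall>d\<in>carrier (free q). g (\<gamma>' d) = \<gamma> d"
proof -
  have V: "left_module R V" and W: "left_module R W" and g: "g \<in> Hom V W" "g ` carrier V = carrier W"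
    using assms(1) unfolding ses_def by blast+
  show ?thesis using free_lift[OF V W g(1) fcover_hom[OF assms(2)]] hom_closed[OF fcover_hom[OF assms(2)]] g(2) by simp
qed

text \<open>The sequence of kernels is again exact on tops, so the induction hypothesis applies to
  it.\<close>

lemma koszul_upto_ses:
  assumes "ses U V W f g" "koszul_upto k U" "koszul_upto k W"
  shows "koszul_upto k V"
  using assms
proof (induction k arbitrary: U V W f g)
  case (Suc k)
  obtain p \<alpha> where \<alpha>: "fcover U p \<alpha>" "aligned (free p) U \<alpha>" "koszul_upto k (Syz p U \<alpha>)"
    using Suc.prems(2) by auto
  obtain q \<gamma> where \<gamma>: "fcover W q \<gamma>" "aligned (free q) W \<gamma>" "koszul_upto k (Syz q W \<gamma>)"
    using Suc.prems(3) by auto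
  obtain \<gamma>' where \<gamma>': "\<gamma>' \<in> Hom (free q) V" "\<forall>d\<in>carrier (free q). g (\<gamma>' d) = \<gamma> d"
    using ses_lift[OF Suc.prems(1) \<gamma>(1)] by blast
  have c: "lifted_covers U V W f g p q \<alpha> \<gamma> \<gamma>'"
    using Suc.prems(1) \<alpha>(1) \<gamma>(1) \<gamma>' by (simp add: lifted_covers_def)
  show ?case
    using horseshoe_fcover[OF c] horseshoe_aligned[OF c \<alpha>(2) \<gamma>(2)] Suc.IH[OF horseshoe_ses[OF c \<alpha>(2)] \<alpha>(3) \<gamma>(3)]
    by auto
qed simp

text \<open>Minimal covers of the summands add up to a cover of V, whose alignment may be used
  because it does not depend on the cover. Its kernel is the direct sum of the two kernels, and
  projection carries J KV onto J KW. Finite generation supplies the covers of U and W.\<close>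

lemma koszul_upto_dsum:
  fixes U :: "('a, nat \<Rightarrow> 'a) module"
  assumes "dsum U V W f g \<rho> \<tau>" "fin_gen U" "fin_gen W" "koszul_upto k V"
  shows "koszul_upto k W"
  using assms
proof (induction k arbitrary: U V W f g \<rho> \<tau>)
  case (Suc k)
  have U: "left_module R U" and V: "left_module R V" and W: "left_module R W"
    and f: "f \<in> Hom U V" and g: "g \<in> Hom V W" and \<rho>: "\<rho> \<in> Hom V U" and \<tau>: "\<tau> \<in> Hom W V"
    and \<rho>f: "\<And>u. u \<in> carrier U \<Longrightarrow> \<rho> (f u) = u" 
    and g\<tau>: "\<And>w. w \<in> carrier W \<Longrightarrow> g (\<tau> w) = w" and \<rho>\<tau>: "\<And>w. w \<in> carrier W \<Longrightarrow> \<rho> (\<tau> w) = \<zero>\<^bsub>U\<^esub>"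
    using Suc.prems(1) unfolding dsum_def by blast+
  obtain p \<alpha> where \<alpha>: "fcover U p \<alpha>" using fcover_exists[OF U Suc.prems(2)] by blast
  obtain q \<gamma> where \<gamma>: "fcover W q \<gamma>" using fcover_exists[OF W Suc.prems(3)] by blast
  \<comment> \<open>Lifting through the inclusion \<tau>, and not through an arbitrary lift, makes
    the sequence of kernels split by the coordinate maps.\<close>
  let ?\<gamma>' = "\<lambda>d. \<tau> (\<gamma> d)"
  have \<gamma>': "?\<gamma>' \<in> Hom (free q) V" "\<forall>d\<in>carrier (free q). g (?\<gamma>' d) = \<gamma> d"
    using hom_comp[OF fcover_hom[OF \<gamma>] \<tau>] g\<tau> hom_closed[OF fcover_hom[OF \<gamma>]] by auto
  have c: "lifted_covers U V W f g p q \<alpha> \<gamma> ?\<gamma>'"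
    using dsum_ses[OF Suc.prems(1)] \<alpha> \<gamma> \<gamma>' by (simp add: lifted_covers_def)
  let ?\<beta> = "horseshoe_cover V f p q \<alpha> ?\<gamma>'"
  note cov = horseshoe_fcover[OF c] and h = horseshoe_hom[OF c]
  have al: "aligned (free (p + q)) V ?\<beta>" and kv: "koszul_upto k (Syz (p + q) V ?\<beta>)"
    using koszul_upto_SucD[OF V Suc.prems(4) cov] by auto
  let ?KU = "Ker p U \<alpha>" and ?KV = "Ker (p + q) V ?\<beta>" and ?KW = "Ker q W \<gamma>"
  have ut: "untail p q \<in> Hom (free q) (free (p + q))" and tr: "trunc p \<in> Hom (free (p + q)) (free p)"
    and tl: "tail p q \<in> Hom (free (p + q)) (free q)"
    by (rule recoord_hom, auto split: if_splits)+
  interpret U: left_module R U by fact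
  have m1: "untail p q ` ?KW \<subseteq> ?KV"
    using horseshoe_untail[OF c] hom_closed[OF ut] hom_zero[OF W V \<tau>] by (auto simp: a_kernel_eq)
  have m2: "trunc p ` ?KV \<subseteq> ?KU"
  proof (rule image_subsetI)
    fix b assume "b \<in> ?KV"
    then have b: "b \<in> carrier (free (p + q))" "?\<beta> b = \<zero>\<^bsub>V\<^esub>" by (auto simp: a_kernel_eq)
    note tb = hom_closed[OF tr b(1)] and tlb = hom_closed[OF tl b(1)]
    have ab: "\<alpha> (trunc p b) \<in> carrier U" and gb: "\<gamma> (tail p q b) \<in> carrier W"
      using tb tlb hom_closed[OF fcover_hom[OF \<alpha>]] hom_closed[OF fcover_hom[OF \<gamma>]] by auto
    have "\<rho> (?\<beta> b) = \<alpha> (trunc p b)"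
      unfolding horseshoe_cover_def using ab gb
      by (simp add: hom_add[OF \<rho>] hom_closed[OF f] hom_closed[OF \<tau>] \<rho>f \<rho>\<tau>)
    then have "\<alpha> (trunc p b) = \<zero>\<^bsub>U\<^esub>" using b(2) hom_zero[OF V U \<rho>] by simp
    then show "trunc p b \<in> ?KU" using tb by (simp add: a_kernel_eq)
  qed
  have d: "dsum (Syz p U \<alpha>) (Syz (p + q) V ?\<beta>) (Syz q W \<gamma>)
      (ext p (p + q)) (tail p q) (trunc p) (untail p q)"
    unfolding kernel_module_def
    by (rule dsum_restrict[OF free_dsum ker_subs[OF c] horseshoe_ker_maps[OF c] m2 m1])
  have kw: "koszul_upto k (Syz q W \<gamma>)"
    by (rule Suc.IH[OF d fin_gen_kernel[OF U fcover_hom[OF \<alpha>]] fin_gen_kernel[OF W fcover_hom[OF \<gamma>]] kv])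
  have "aligned (free q) W \<gamma>" unfolding aligned_free
  proof
    fix d assume d: "d \<in> tuples q J2"
    have J2c: "J2 \<subseteq> carrier R" using J2_J J_subset by blast
    have dc: "d \<in> carrier (free q)" using d J2c by (auto simp: free_module_simps PiE_iff)
    have "untail p q d \<in> tuples (p + q) J2" 
      by (rule recoord_mem[OF _ d]) (use J2_submodule in \<open>auto simp: left_module.submodule_iff[OF regular_left_module] split: if_splits\<close>)
    then have "untail p q d \<in> rmul R (free (p + q)) ?KV" using al by (auto simp: aligned_free)
    then have "tail p q (untail p q d) \<in> tail p q ` rmul R (free (p + q)) ?KV" by (rule imageI)
    then show "d \<in> rmul R (free q) ?KW"
      using rmul_hom[OF free_left_module free_left_module tl ker_le(2)[OF c]] horseshoe_exact(1)[OF c] parts(3)[OF c dc] by simp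
  qed
  then show ?case using \<gamma> kw by auto
qed simp

end

context short_local
begin

section \<open>Powers of the radical\<close>

abbreviation "Jpow s \<equiv> restrict_module (free s) (tuples s J)"

lemma Jpow_submodule: "submodule (tuples s J) R (free s)"
  by (rule power_submodule[OF J_submodule])

lemma Jpow_fin_gen: "fin_gen (Jpow s)"
  by (rule fin_gen_free_submodule[OF Jpow_submodule])

lemma Jpow_left_module: "left_module R (Jpow s)"
  by (rule restrict_left_module[OF free_left_module Jpow_submodule])

lemma Jpow_dsum: "dsum (Jpow p) (Jpow (p + q)) (Jpow q) (ext p (p + q)) (tail p q) (trunc p) (untail p q)"
proof (rule dsum_restrict[OF free_dsum Jpow_submodule Jpow_submodule Jpow_submodule])
  have *: "recoord m s ` (tuples n J) \<subseteq> tuples m J" 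
    if "\<And>i j. i < m \<Longrightarrow> s i = Some j \<Longrightarrow> j < n" for m n s
    by (rule image_subsetI, rule recoord_mem[OF that _ J_zero])
  show "ext p (p + q) ` (tuples p J) \<subseteq> tuples (p + q) J" by (rule *) (simp split: if_splits)
  show "tail p q ` (tuples (p + q) J) \<subseteq> tuples q J" by (rule *) auto
  show "trunc p ` (tuples (p + q) J) \<subseteq> tuples p J" by (rule *) simp
  show "untail p q ` (tuples q J) \<subseteq> tuples (p + q) J" by (rule *) (auto split: if_splits)
qed

text \<open>If JW = 0, all of J F is sent to zero, so the kernel is J F itself and alignment reads J
  (J F) = J^2 F.\<close>

lemma semisimple_cover:
  assumes W: "left_module R W" and z: "rmul R W (carrier W) = {\<zero>\<^bsub>W\<^esub>}" and \<gamma>: "fcover W s \<gamma>"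
  shows "Ker s W \<gamma> = tuples s J" "aligned (free s) W \<gamma>" "Syz s W \<gamma> = Jpow s"
proof -
  have "tuples s J \<subseteq> Ker s W \<gamma>"
  proof
    fix c assume c: "c \<in> tuples s J"
    then have "\<gamma> c \<in> \<gamma> ` rmul R (free s) (carrier (free s))" by (simp add: rmul_free)
    also have "\<dots> = rmul R W (carrier W)"
      using rmul_hom[OF free_left_module W fcover_hom[OF \<gamma>] order_refl] fcover_surj[OF \<gamma>] by simp
    finally have "\<gamma> c = \<zero>\<^bsub>W\<^esub>" using z by simp
    then show "c \<in> Ker s W \<gamma>" using c J_subset by (auto simp: a_kernel_eq free_module_simps PiE_iff)
  qed
  then show k: "Ker s W \<gamma> = tuples s J" using \<gamma> by (auto simp: fcover_def)
  show "aligned (free s) W \<gamma>" by (simp add: aligned_free k rmul_free_J)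
  show "Syz s W \<gamma> = Jpow s" by (simp add: kernel_module_def k)
qed

text \<open>The cover is restricted to J F, whose image is JM and which contains the whole kernel K.
  Exactness on tops asks that the elements of K in J^2 F lie in J K, which is alignment.\<close>

lemma cover_ses:
  assumes M: "left_module R M" and \<pi>: "fcover M t \<pi>" and al: "aligned (free t) M \<pi>"
  shows "ses (Syz t M \<pi>) (Jpow t) (restrict_module M (rmul R M (carrier M))) (\<lambda>x. x) \<pi>"
proof -
  let ?K = "Ker t M \<pi>" and ?JM = "rmul R M (carrier M)"
  have Ks: "submodule ?K R (free t)" by (rule submodule_kernel[OF free_left_module M fcover_hom[OF \<pi>]])
  have KJ: "?K \<subseteq> tuples t J" using \<pi> by (simp add: fcover_def)
  have Jc: "tuples t J \<subseteq> carrier (free t)" using submodule_subset[OF free_left_module Jpow_submodule] .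
  have JMs: "submodule ?JM R M" by (rule rmul_submodule[OF M order_refl])
  have im: "\<pi> ` (tuples t J) = ?JM"
    using rmul_hom[OF free_left_module M fcover_hom[OF \<pi>] order_refl] fcover_surj[OF \<pi>] by (simp add: rmul_free)
  have 1: "(\<lambda>x. x) \<in> Hom (Syz t M \<pi>) (Jpow t)"
    unfolding kernel_module_def using KJ Jc by (intro hom_restrict hom_id) auto
  have 2: "\<pi> \<in> Hom (Jpow t) (restrict_module M ?JM)"
    using im by (intro hom_restrict[OF fcover_hom[OF \<pi>] Jc]) simp
  have 3: "a_kernel (Jpow t) (restrict_module M ?JM) \<pi> = ?K"
    using KJ Jc by (auto simp: a_kernel_eq)
  have 4: "rmul R (Jpow t) (tuples t J) = tuples t J2"
    using rmul_restrict[OF free_left_module Jpow_submodule order_refl] by (simp add: rmul_free_J)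
  have 5: "rmul R (Syz t M \<pi>) ?K = rmul R (free t) ?K"
    unfolding kernel_module_def by (rule rmul_restrict[OF free_left_module Ks order_refl])
  have K: "left_module R (Syz t M \<pi>)" by (rule kernel_fcover_left_module[OF M \<pi>])
  have car: "carrier (Syz t M \<pi>) = ?K" by (simp add: kernel_module_def)
  show ?thesis unfolding ses_def car using 1 2 3 4 5 K Jpow_left_module restrict_left_module[OF M JMs] im al
    by (auto simp: aligned_free)
qed

text \<open>The exponent \<open>s\<close> is arbitrary in the induction on \<open>k\<close>, because
  the semisimple module JM has syzygy J^r with an exponent r unrelated to t.\<close>

lemma koszul_upto_Jpow:
  assumes M: "left_module R M" and \<pi>: "fcover M t \<pi>" "aligned (free t) M \<pi>"
    and K: "\<And>k. koszul_upto k (Syz t M \<pi>)"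
    and M2: "rmul R M (rmul R M (carrier M)) = {\<zero>\<^bsub>M\<^esub>}" and t: "t \<noteq> 0"
  shows "koszul_upto k (Jpow s)"
proof (induction k arbitrary: s)
  case (Suc k)
  let ?U = "Syz t M \<pi>" and ?W = "restrict_module M (rmul R M (carrier M))"
  note ses = cover_ses[OF M \<pi>]
  have JMs: "submodule (rmul R M (carrier M)) R M" by (rule rmul_submodule[OF M order_refl])
  have W: "left_module R ?W" by (rule restrict_left_module[OF M JMs])
  have U: "left_module R ?U" by (rule kernel_fcover_left_module[OF M \<pi>(1)])
  have fgW: "fin_gen ?W" by (rule fin_gen_submodule[OF M fcover_fin_gen[OF \<pi>(1)] JMs])
  obtain r \<gamma> where \<gamma>: "fcover ?W r \<gamma>" using fcover_exists[OF W fgW] by blast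
  have W0: "rmul R ?W (carrier ?W) = {\<zero>\<^bsub>?W\<^esub>}"
    using M2 rmul_restrict[OF M JMs order_refl] by simp
  note sem = semisimple_cover[OF W W0 \<gamma>]
  obtain p \<alpha> where \<alpha>: "fcover ?U p \<alpha>" "aligned (free p) ?U \<alpha>" "koszul_upto k (Syz p ?U \<alpha>)"
    using K[of "Suc k"] by auto
  obtain \<gamma>' where \<gamma>': "\<gamma>' \<in> Hom (free r) (Jpow t)" "\<forall>d\<in>carrier (free r). \<pi> (\<gamma>' d) = \<gamma> d"
    using ses_lift[OF ses \<gamma>] by blast
  have c: "lifted_covers ?U (Jpow t) ?W (\<lambda>x. x) \<pi> p r \<alpha> \<gamma> \<gamma>'"
    using ses \<alpha>(1) \<gamma> \<gamma>' by (simp add: lifted_covers_def)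
  \<comment> \<open>Depth k for J^r; the left end of the sequence of kernels has it by assumption on
    the kernels over M. Together with the aligned horseshoe cover this yields depth k + 1 for
    J^t.\<close>
  have "koszul_upto k (Syz r ?W \<gamma>)" using Suc.IH sem(3) by simp
  then have main: "koszul_upto (Suc k) (Jpow t)"
    using horseshoe_fcover[OF c] horseshoe_aligned[OF c \<alpha>(2) sem(2)] koszul_upto_ses[OF horseshoe_ses[OF c \<alpha>(2)] \<alpha>(3)] by auto
  \<comment> \<open>J^q with q at most t is a direct summand of J^t.\<close>
  have ret: "koszul_upto (Suc k) (Jpow q)" if "q \<le> t" for q
  proof -
    have "t - q + q = t" using that by simp
    from koszul_upto_dsum[OF Jpow_dsum[of "t - q" q] Jpow_fin_gen Jpow_fin_gen, unfolded this, OF main]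
    show ?thesis .
  qed
  show ?case
  proof (induction s)
    case 0 show ?case by (rule ret) simp
  next
    case (Suc s)
    \<comment> \<open>Here t is non-zero, so J itself is a summand; larger powers are then built by
      adding one copy of J at a time.\<close>
    have "koszul_upto (Suc k) (Jpow 1)" using t by (intro ret) simp
    with koszul_upto_ses[OF dsum_ses[OF Jpow_dsum[of s 1]] Suc] show ?case by simp
  qed
qed simp

section \<open>Arbitrary projective covers\<close>

lemma miso_trans:
  assumes "miso R M N f" "miso R N K g" shows "miso R M K (\<lambda>x. g (f x))"
  using assms hom_comp[of f R M N g K] bij_betw_trans[of f "carrier M" "carrier N" g "carrier K"]
  by (simp add: miso_def comp_def)

text \<open>Resolutions are made of unspecified projective modules; this replaces such a cover by
  one from a free module with isomorphic kernel, on which lengths and coordinates are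
  available.\<close>

lemma cover_to_fcover:
  assumes M: "left_module R M" and p: "projective_cover R P M p"
  shows "\<exists>n \<pi> \<phi>. fcover M n \<pi> \<and> (aligned P M p \<longrightarrow> aligned (free n) M \<pi>) \<and>
    miso R (kernel_module P M p) (Syz n M \<pi>) \<phi>"
proof -
  have P: "left_module R P" and ph: "p \<in> Hom P M" using p by (auto simp: projective_cover_def projective_module_def)
  obtain n q where q: "miso R (free n) P q" "fcover M n (\<lambda>c. p (q c))" using cover_free[OF M p] by blast
  let ?\<phi> = "inv_into (carrier (free n)) q"
  have i: "miso R P (free n) ?\<phi>" by (rule miso_inv[OF free_left_module q(1)])
  have "p (q (?\<phi> x)) = p x" if "x \<in> carrier P" for x
    using q(1) that by (simp add: miso_def bij_betw_def f_inv_into_f)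
  note t = cover_transport[OF P free_left_module M ph i, of "\<lambda>c. p (q c)", OF this]
  show ?thesis using q(2) t(2,3) by blast
qed

lemma cover_kernel_subset:
  assumes M: "left_module R M" and p: "projective_cover R P M p"
  shows "a_kernel P M p \<subseteq> rmul R P (carrier P)"
proof
  fix x assume x: "x \<in> a_kernel P M p"
  have P: "left_module R P" using p by (auto simp: projective_cover_def projective_module_def)
  obtain n q where q: "miso R (free n) P q" "fcover M n (\<lambda>c. p (q c))" using cover_free[OF M p] by blast
  have qh: "q \<in> Hom (free n) P" and qs: "q ` carrier (free n) = carrier P"
    using q(1) by (auto simp: miso_def bij_betw_def)
  have "x \<in> q ` carrier (free n)" using x qs by (simp add: a_kernel_eq)
  then obtain c where c: "c \<in> carrier (free n)" "x = q c" by blast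
  have "c \<in> tuples n J" using x c by (intro fcover_ker[OF q(2)]) (auto simp: a_kernel_eq)
  then have "x \<in> q ` rmul R (free n) (carrier (free n))" using c by (simp add: rmul_free)
  then show "x \<in> rmul R P (carrier P)" using rmul_hom[OF free_left_module P qh order_refl] qs by simp
qed

text \<open>\<open>syzygy\<close> is a choice among the kernels of all projective covers, so nothing
  but its isomorphism class can be used.\<close>

lemma syzygy_miso:
  assumes M: "left_module R M" and \<pi>: "fcover M n \<pi>"
  shows "left_module R (syzygy R M) \<and> (\<exists>\<phi>. miso R (Syz n M \<pi>) (syzygy R M) \<phi>)"
proof -
  have "\<exists>N. \<exists>(P :: ('a, nat \<Rightarrow> 'a) module) p. projective_cover R P M p \<and> N = kernel_module P M p"
    using fcover_projective_cover[OF M \<pi>] by blast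
  from someI_ex[OF this] obtain P :: "('a, nat \<Rightarrow> 'a) module" and p
    where p: "projective_cover R P M p" and s: "syzygy R M = kernel_module P M p"
    unfolding syzygy_def by blast
  have P: "left_module R P" and ph: "p \<in> Hom P M" using p by (auto simp: projective_cover_def projective_module_def)
  have sl: "left_module R (syzygy R M)" unfolding s by (rule kernel_module_left_module[OF P M ph])
  obtain n' \<pi>' \<phi> where \<pi>': "fcover M n' \<pi>'" and \<phi>: "miso R (syzygy R M) (Syz n' M \<pi>') \<phi>"
    using cover_to_fcover[OF M p] s by auto
  obtain \<psi> where \<psi>: "miso R (Syz n M \<pi>) (Syz n' M \<pi>') \<psi>"
    using fcover_any(1)[OF M \<pi> \<pi>'] by blast
  show ?thesis using sl miso_trans[OF \<psi> miso_inv[OF sl \<phi>]] by blast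
qed

section \<open>Lengths of tops and radicals\<close>

text \<open>Kept in \<open>enat\<close>, since \<open>the_enat\<close> in \<open>top_length\<close>
  is informative for finite values alone.\<close>

definition tlen :: "('a, 'm) module \<Rightarrow> enat" where
  "tlen M = ilen R M (rmul R M (carrier M)) (carrier M)"

definition rlen :: "('a, 'm) module \<Rightarrow> enat" where
  "rlen M = ilen R M {\<zero>\<^bsub>M\<^esub>} (rmul R M (carrier M))"

lemma top_length_tlen:
  assumes M: "left_module R M" shows "top_length R M = the_enat (tlen M)"
  using module_length_quotient[OF M rmul_submodule[OF M order_refl]]
  by (simp add: top_length_def tlen_def rad_power_Suc)

lemma miso_lens:
  assumes M: "left_module R M" and N: "left_module R N" and f: "miso R M N f"
  shows "tlen M = tlen N" "rlen M = rlen N"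
proof -
  have h: "f \<in> Hom M N" and b: "f ` carrier M = carrier N" and inj: "inj_on f (carrier M)"
    using f by (auto simp: miso_def bij_betw_def)
  let ?JM = "rmul R M (carrier M)" and ?JN = "rmul R N (carrier N)"
  have Jc: "?JM \<subseteq> carrier M" "?JN \<subseteq> carrier N" using rmul_carrier M N by blast+
  have im: "f ` ?JM = ?JN" using rmul_hom[OF M N h order_refl] b by simp
  have pre: "{x \<in> carrier M. f x \<in> ?JN} = ?JM"
  proof (intro equalityI subsetI)
    fix x assume x: "x \<in> {x \<in> carrier M. f x \<in> ?JN}"
    then have "f x \<in> f ` ?JM" using im by simp
    then obtain y where "y \<in> ?JM" "f x = f y" by blast
    then show "x \<in> ?JM" using inj x Jc(1) by (auto dest: inj_onD)
  next
    fix x assume "x \<in> ?JM"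
    then show "x \<in> {x \<in> carrier M. f x \<in> ?JN}" using im Jc(1) by blast
  qed
  show "tlen M = tlen N"
    using ilen_hom[OF M N h left_module.carrier_submodule[OF M] rmul_submodule[OF N order_refl]] Jc(2)
    by (simp add: tlen_def b pre)
  have z: "\<zero>\<^bsub>N\<^esub> \<in> ?JN" "\<zero>\<^bsub>M\<^esub> \<in> ?JM" 
    using rmul_submodule[OF N order_refl] rmul_submodule[OF M order_refl]
    by (simp_all add: left_module.submodule_iff[OF M] left_module.submodule_iff[OF N])
  have "{x \<in> ?JM. f x \<in> {\<zero>\<^bsub>N\<^esub>}} = {\<zero>\<^bsub>M\<^esub>}"
    using miso_zero_iff[OF M N f] Jc(1) z(2) by blast
  then show "rlen M = rlen N"
    using ilen_hom[OF M N h rmul_submodule[OF M order_refl] left_module.zero_submodule[OF N]] z(1) im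
    by (simp add: rlen_def)
qed

text \<open>JM is the image of J F, and the kernel lies in J F; so J F is the full preimage of JM
  and M/JM has the length of F/JF.\<close>

lemma fcover_tlen:
  assumes M: "left_module R M" and \<pi>: "fcover M n \<pi>" shows "tlen M = enat n"
proof -
  interpret M: left_module R M by fact
  interpret F: left_module R "free n" by (rule free_left_module)
  note h = fcover_hom[OF \<pi>] and s = fcover_surj[OF \<pi>]
  have im: "\<pi> ` (tuples n J) = rmul R M (carrier M)"
    using rmul_hom[OF F.lm M h order_refl] s by (simp add: rmul_free)
  have Jc: "tuples n J \<subseteq> carrier (free n)" using submodule_subset[OF free_left_module Jpow_submodule] .
  have "{c \<in> carrier (free n). \<pi> c \<in> rmul R M (carrier M)} = tuples n J"
  proof (intro equalityI subsetI)
    fix c assume c: "c \<in> {c \<in> carrier (free n). \<pi> c \<in> rmul R M (carrier M)}"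
    then have cc: "c \<in> carrier (free n)" by simp
    have "\<pi> c \<in> \<pi> ` (tuples n J)" using c im by simp
    then obtain c' where c': "c' \<in> tuples n J" "\<pi> c = \<pi> c'" by blast
    have c'c: "c' \<in> carrier (free n)" using c'(1) Jc by blast
    have "\<pi> (c \<ominus>\<^bsub>free n\<^esub> c') = \<zero>\<^bsub>M\<^esub>"
      using c'(2) hom_closed[OF h c'c] by (simp add: hom_diff[OF F.lm M h cc c'c] M.diff_zero_iff)
    then have "c \<ominus>\<^bsub>free n\<^esub> c' \<in> tuples n J" using cc c'c by (intro fcover_ker[OF \<pi>]) auto
    then have "c' \<oplus>\<^bsub>free n\<^esub> (c \<ominus>\<^bsub>free n\<^esub> c') \<in> tuples n J"
      using Jpow_submodule[of n] c'(1) unfolding F.submodule_iff by blast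
    then show "c \<in> tuples n J" using F.add_diff_cancel[OF cc c'c] by simp
  next
    fix c assume c: "c \<in> tuples n J"
    then have "\<pi> c \<in> rmul R M (carrier M)" unfolding im[symmetric] by blast
    then show "c \<in> {c \<in> carrier (free n). \<pi> c \<in> rmul R M (carrier M)}" using c Jc by blast
  qed
  then show ?thesis
    using ilen_hom[OF F.lm M h F.carrier_submodule rmul_submodule[OF M order_refl]] s rmul_carrier[OF M order_refl]
      ilen_free_top[of n] by (simp add: tlen_def)
qed

text \<open>Both lengths come from J^2F = JK \<subseteq> K \<subseteq> JF, where JF/K is JM. The
  first identity is additive, which avoids subtraction in \<open>enat\<close> and forces both
  summands to be finite.\<close>

lemma aligned_lens:
  assumes M: "left_module R M" and \<pi>: "fcover M n \<pi>" and al: "aligned (free n) M \<pi>"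
  shows "tlen (Syz n M \<pi>) + rlen M = enat (n * e)"
    and "rlen (Syz n M \<pi>) = enat (n * l)"
proof -
  interpret M: left_module R M by fact
  interpret F: left_module R "free n" by (rule free_left_module)
  note h = fcover_hom[OF \<pi>] and s = fcover_surj[OF \<pi>]
  let ?K = "Ker n M \<pi>" and ?J = "tuples n J" and ?J2 = "tuples n J2"
  have Ks: "submodule ?K R (free n)" by (rule submodule_kernel[OF F.lm M h])
  have KJ: "?K \<subseteq> ?J" using \<pi> by (simp add: fcover_def)
  have Jc: "?J \<subseteq> carrier (free n)" using submodule_subset[OF free_left_module Jpow_submodule] .
  have J2s: "submodule ?J2 R (free n)" by (rule power_submodule[OF J2_submodule])
  have rK: "rmul R (free n) ?K = ?J2"
    using al rmul_mono[OF F.lm Jc KJ] by (simp add: aligned_free rmul_free_J equalityI)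
  have rK': "rmul R (Syz n M \<pi>) (carrier (Syz n M \<pi>)) = ?J2"
    unfolding kernel_module_def using rmul_restrict[OF F.lm Ks order_refl] rK by simp
  have J2K: "?J2 \<subseteq> ?K" using rmul_subset[OF F.lm Ks] rK by simp
  have z: "{\<zero>\<^bsub>free n\<^esub>} \<subseteq> ?J2" using J2s by (simp add: F.submodule_iff)
  have zK: "{\<zero>\<^bsub>free n\<^esub>} \<subseteq> ?K" using Ks by (simp add: F.submodule_iff)
  have tK: "tlen (Syz n M \<pi>) = ilen R (free n) ?J2 ?K"
    using ilen_restrict[OF F.lm Ks J2s Ks J2K order_refl] rK' by (simp add: tlen_def kernel_module_def)
  have "rlen (Syz n M \<pi>) = ilen R (free n) {\<zero>\<^bsub>free n\<^esub>} ?J2"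
    using ilen_restrict[OF F.lm Ks F.zero_submodule J2s z J2K] rK' by (simp add: rlen_def kernel_module_def)
  then show "rlen (Syz n M \<pi>) = enat (n * l)" by (simp add: ilen_free_J2)
  have im: "\<pi> ` ?J = rmul R M (carrier M)"
    using rmul_hom[OF F.lm M h order_refl] s by (simp add: rmul_free)
  have "{c \<in> ?J. \<pi> c \<in> {\<zero>\<^bsub>M\<^esub>}} = ?K" using KJ Jc by (auto simp: a_kernel_eq)
  moreover have "{\<zero>\<^bsub>M\<^esub>} \<subseteq> \<pi> ` ?J" unfolding im using rmul_submodule[OF M order_refl] by (simp add: M.submodule_iff)
  ultimately have "ilen R (free n) ?K ?J = rlen M"
    using ilen_hom[OF F.lm M h Jpow_submodule M.zero_submodule] im by (simp add: rlen_def)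
  moreover have "ilen R (free n) ?J2 ?J = ilen R (free n) ?J2 ?K + ilen R (free n) ?K ?J"
    by (rule ilen_add[OF F.lm J2s Ks Jpow_submodule J2K KJ])
  ultimately show "tlen (Syz n M \<pi>) + rlen M = enat (n * e)"
    using tK ilen_free_J[of n] by simp
qed

section \<open>Betti numbers\<close>

text \<open>The first cover is split off from \<open>koszul_upto\<close>, so a module of any element
  type qualifies; all depths are demanded over one and the same cover.\<close>

definition koszul_type :: "('a, 'm) module \<Rightarrow> bool" where
  "koszul_type M \<longleftrightarrow> left_module R M \<and>
    (\<exists>n \<pi>. fcover M n \<pi> \<and> aligned (free n) M \<pi> \<and> (\<forall>k. koszul_upto k (Syz n M \<pi>)))"

lemma koszul_typeI:
  assumes M: "left_module R M" and K: "\<And>k. koszul_upto k M"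
  shows "koszul_type M"
proof -
  obtain n \<pi> where \<pi>: "fcover M n \<pi>" using K[of "Suc 0"] by auto
  then show ?thesis unfolding koszul_type_def using koszul_upto_SucD[OF M K \<pi>] M by blast
qed

lemma koszul_type_syzygy:
  assumes "koszul_type M"
  shows "koszul_type (syzygy R M)"
    and "\<exists>u. rlen M = enat u \<and> top_length R (syzygy R M) + u = e * top_length R M"
    and "rlen (syzygy R M) = enat (l * top_length R M)"
proof -
  have M: "left_module R M" using assms by (simp add: koszul_type_def)
  obtain n \<pi> where \<pi>: "fcover M n \<pi>" "aligned (free n) M \<pi>" "\<And>k. koszul_upto k (Syz n M \<pi>)"
    using assms by (auto simp: koszul_type_def)
  let ?K = "Syz n M \<pi>"
  have K: "left_module R ?K" by (rule kernel_fcover_left_module[OF M \<pi>(1)])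
  obtain \<phi> where S: "left_module R (syzygy R M)" and \<phi>: "miso R ?K (syzygy R M) \<phi>"
    using syzygy_miso[OF M \<pi>(1)] by blast
  show "koszul_type (syzygy R M)"
    by (rule koszul_typeI[OF S koszul_upto_miso[OF K S \<phi> \<pi>(3)]])
  have n: "top_length R M = n" using fcover_tlen[OF M \<pi>(1)] by (simp add: top_length_tlen[OF M])
  note lens = aligned_lens[OF M \<pi>(1,2)] miso_lens[OF K S \<phi>]
  show "rlen (syzygy R M) = enat (l * top_length R M)" using lens(2,4) n by (simp add: mult.commute)
  have s: "tlen (syzygy R M) + rlen M = enat (n * e)" using lens(1,3) by simp
  then obtain a b where ab: "tlen (syzygy R M) = enat a" "rlen M = enat b"
    by (cases "tlen (syzygy R M)"; cases "rlen M") auto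
  then show "\<exists>u. rlen M = enat u \<and> top_length R (syzygy R M) + u = e * top_length R M"
    using s n by (simp add: top_length_tlen[OF S] mult.commute)
qed

text \<open>The length formula is applied to a syzygy, whose radical has length l times the
  preceding Betti number. Stage 0 is treated apart because M has its own element type.\<close>

lemma betti_recurrence:
  assumes "koszul_type M"
  shows "syzygy_top R M (Suc (Suc i)) + l * syzygy_top R M i = e * syzygy_top R M (Suc i)"
proof -
  have K: "koszul_type ((syzygy R ^^ i) (syzygy R M))" for i
    by (induction i) (use assms koszul_type_syzygy(1) in auto)
  have *: "top_length R (syzygy R (syzygy R N)) + l * top_length R N = e * top_length R (syzygy R N)"
    if "koszul_type N" for N :: "('a, 'n) module"
    using koszul_type_syzygy(3)[OF that] koszul_type_syzygy(2)[OF koszul_type_syzygy(1)[OF that]] by auto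
  show ?thesis
  proof (cases i)
    case 0 then show ?thesis using *[OF assms] by simp
  next
    case (Suc j)
    have "top_length R (syzygy R (syzygy R ((syzygy R ^^ j) (syzygy R M)))) + l * top_length R ((syzygy R ^^ j) (syzygy R M))
       = e * top_length R (syzygy R ((syzygy R ^^ j) (syzygy R M)))"
      using koszul_type_syzygy(3)[OF K[of j]] koszul_type_syzygy(2)[OF koszul_type_syzygy(1)[OF K[of j]]] by auto
    then show ?thesis using Suc by simp
  qed
qed

end

section \<open>Graded pieces\<close>

lemma graded_piece_simps:
  "carrier (graded_piece R P i) = (\<lambda>x. rad_power R P (Suc i) +>\<^bsub>P\<^esub> x) ` rad_power R P i"
  "\<zero>\<^bsub>graded_piece R P i\<^esub> = rad_power R P (Suc i)"
  by (simp_all add: graded_piece_def coset_eq)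

context short_local
begin

lemma rad_power_submodule: "left_module R M \<Longrightarrow> submodule (rad_power R M i) R M"
  by (induction i) (simp_all add: rad_power_Suc rmul_submodule submodule_subset left_module.carrier_submodule)

lemma rad_power_carrier: "left_module R M \<Longrightarrow> rad_power R M i \<subseteq> carrier M"
  using rad_power_submodule submodule_subset by blast

lemma rad_power_Suc_subset: "left_module R M \<Longrightarrow> rad_power R M (Suc i) \<subseteq> rad_power R M i"
  unfolding rad_power_Suc by (rule rmul_subset[OF _ rad_power_submodule])

lemma rad_power_ge3:
  assumes M: "left_module R M" and "3 \<le> i" shows "rad_power R M i = {\<zero>\<^bsub>M\<^esub>}"
proof -
  have "i = Suc (Suc (Suc (i - 3)))" using assms(2) by simp
  moreover have "rad_power R M (Suc (Suc (Suc (i - 3)))) = {\<zero>\<^bsub>M\<^esub>}"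
    unfolding rad_power_Suc by (rule rmul3[OF M rad_power_carrier[OF M]])
  ultimately show ?thesis by metis
qed

lemma rad_power_hom:
  assumes P: "left_module R P" and N: "left_module R N" and f: "f \<in> Hom P N" and s: "f ` carrier P = rad_power R N j"
  shows "f ` rad_power R P i = rad_power R N (i + j)"
proof (induction i)
  case (Suc i)
  then show ?case using rmul_hom[OF P N f rad_power_carrier[OF P]] by (simp add: rad_power_Suc)
qed (use s in simp)

lemma rad_power_hom_subset:
  assumes P: "left_module R P" and N: "left_module R N" and f: "f \<in> Hom P N" and s: "f ` carrier P \<subseteq> rad_power R N j"
  shows "f ` rad_power R P i \<subseteq> rad_power R N (i + j)"
proof (induction i)
  case (Suc i)
  have "f ` rad_power R P (Suc i) = rmul R N (f ` rad_power R P i)"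
    unfolding rad_power_Suc by (rule rmul_hom[OF P N f rad_power_carrier[OF P]])
  also have "\<dots> \<subseteq> rmul R N (rad_power R N (i + j))" by (rule rmul_mono[OF N rad_power_carrier[OF N] Suc])
  finally show ?case by (simp add: rad_power_Suc)
qed (use s in simp)

lemma graded_map_coset:
  assumes P: "left_module R P" and N: "left_module R N" and f: "f \<in> Hom P N"
    and "f ` rad_power R P (Suc i) \<subseteq> rad_power R N (Suc j)" and "x \<in> carrier P"
  shows "graded_map R N j f (rad_power R P (Suc i) +>\<^bsub>P\<^esub> x) = rad_power R N (Suc j) +>\<^bsub>N\<^esub> f x"
  unfolding graded_map_def
  by (rule coset_image_union[OF P N f rad_power_submodule[OF P] rad_power_submodule[OF N] assms(4,5)])

text \<open>As J^(j+1) N = 0, the kernel on graded pieces consists of the cosets of honest kernel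
  elements, so exactness can be tested on elements. It is used with N a projective term and j = i +
  2, and with N = M when JM = 0.\<close>

lemma graded_exact:
  assumes P': "left_module R P'" and P: "left_module R P" and N: "left_module R N"
    and d: "d \<in> Hom P' P" and f: "f \<in> Hom P N"
    and d1: "d ` carrier P' \<subseteq> rad_power R P 1"
    and f1: "f ` rad_power R P (Suc (Suc i)) \<subseteq> rad_power R N (Suc j)"
    and z: "rad_power R N (Suc j) = {\<zero>\<^bsub>N\<^esub>}"
    and fd: "\<And>x. x \<in> carrier P' \<Longrightarrow> f (d x) = \<zero>\<^bsub>N\<^esub>"
    and ex: "\<And>x. x \<in> rad_power R P (Suc i) \<Longrightarrow> f x = \<zero>\<^bsub>N\<^esub> \<Longrightarrow> x \<in> d ` rad_power R P' i"
  shows "graded_map R P (Suc i) d ` carrier (graded_piece R P' i) =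
    a_kernel (graded_piece R P (Suc i)) (graded_piece R N j) (graded_map R N j f)"
proof -
  interpret N: left_module R N by fact
  have c: "x \<in> rad_power R M i \<Longrightarrow> x \<in> carrier M" if "left_module R M" for M :: "('a, 'w) module" and x i
    using rad_power_carrier[OF that] by blast
  have dm: "d ` rad_power R P' i \<subseteq> rad_power R P (Suc i)" for i
    using rad_power_hom_subset[OF P' P d d1, of i] by simp
  have gd: "graded_map R P (Suc i) d (rad_power R P' (Suc i) +>\<^bsub>P'\<^esub> x) = rad_power R P (Suc (Suc i)) +>\<^bsub>P\<^esub> d x"
    if "x \<in> rad_power R P' i" for x
    by (rule graded_map_coset[OF P' P d dm]) (use that rad_power_carrier[OF P'] in blast)
  have gf: "graded_map R N j f (rad_power R P (Suc (Suc i)) +>\<^bsub>P\<^esub> x) = rad_power R N (Suc j) +>\<^bsub>N\<^esub> f x"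
    if "x \<in> rad_power R P (Suc i)" for x
    by (rule graded_map_coset[OF P N f f1]) (use that rad_power_carrier[OF P] in blast)
  have gf0: "graded_map R N j f (rad_power R P (Suc (Suc i)) +>\<^bsub>P\<^esub> x) = rad_power R N (Suc j) \<longleftrightarrow> f x = \<zero>\<^bsub>N\<^esub>"
    if "x \<in> rad_power R P (Suc i)" for x
  proof -
    have "f x \<in> carrier N" using that rad_power_carrier[OF P] hom_closed[OF f] by blast
    then show ?thesis unfolding gf[OF that] using N.coset_zero_iff[OF rad_power_submodule[OF N], of "f x" "Suc j"] z by simp
  qed
  show ?thesis
  proof (intro equalityI subsetI)
    fix C assume "C \<in> graded_map R P (Suc i) d ` carrier (graded_piece R P' i)"
    then obtain x where x: "x \<in> rad_power R P' i" "C = rad_power R P (Suc (Suc i)) +>\<^bsub>P\<^esub> d x"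
      using gd by (auto simp: graded_piece_simps)
    have dx: "d x \<in> rad_power R P (Suc i)" using dm x(1) by blast
    have "f (d x) = \<zero>\<^bsub>N\<^esub>" using fd x(1) rad_power_carrier[OF P'] by blast
    then show "C \<in> a_kernel (graded_piece R P (Suc i)) (graded_piece R N j) (graded_map R N j f)"
      using dx gf0[OF dx] x(2) by (simp add: a_kernel_eq graded_piece_simps)
  next
    fix C assume "C \<in> a_kernel (graded_piece R P (Suc i)) (graded_piece R N j) (graded_map R N j f)"
    then obtain x where x: "x \<in> rad_power R P (Suc i)" "C = rad_power R P (Suc (Suc i)) +>\<^bsub>P\<^esub> x"
        "graded_map R N j f C = rad_power R N (Suc j)"
      by (auto simp: a_kernel_eq graded_piece_simps)
    then have "f x = \<zero>\<^bsub>N\<^esub>" using gf0 by simp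
    then obtain y where y: "y \<in> rad_power R P' i" "x = d y" using ex[OF x(1)] by blast
    have "C = graded_map R P (Suc i) d (rad_power R P' (Suc i) +>\<^bsub>P'\<^esub> y)" using gd[OF y(1)] x(2) y(2) by simp
    then show "C \<in> graded_map R P (Suc i) d ` carrier (graded_piece R P' i)"
      using y(1) by (simp add: graded_piece_simps)
  qed
qed

text \<open>J^3 P = 0 and f vanishes on J^2 P, so exactness at this spot says that J^2 P is the
  image of J P', that is, J times the image of d.\<close>

lemma exact_aligned:
  assumes P': "left_module R P'" and P: "left_module R P" and N: "left_module R N"
    and d: "d \<in> Hom P' P" and f: "f \<in> Hom P N"
    and d1: "d ` carrier P' \<subseteq> rad_power R P 1"
    and f2: "\<And>x. x \<in> rad_power R P 2 \<Longrightarrow> f x = \<zero>\<^bsub>N\<^esub>"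
    and e: "graded_map R P 2 d ` carrier (graded_piece R P' 1) =
      a_kernel (graded_piece R P 2) (graded_piece R N j) (graded_map R N j f)"
  shows "rad_power R P 2 \<subseteq> rmul R P (d ` carrier P')"
proof
  fix x assume x: "x \<in> rad_power R P 2"
  interpret P: left_module R P by fact
  interpret N: left_module R N by fact
  note [simp] = numeral_2_eq_2 
  have P3: "rad_power R P 3 = {\<zero>\<^bsub>P\<^esub>}" by (rule rad_power_ge3[OF P]) simp
  then have P3': "rad_power R P (Suc 2) = {\<zero>\<^bsub>P\<^esub>}" by (simp add: numeral_3_eq_3)
  have xc: "x \<in> carrier P" using x rad_power_carrier[OF P] by blast
  have sub: "submodule (rad_power R N (Suc j)) R N" by (rule rad_power_submodule[OF N])
  have "graded_map R N j f (rad_power R P (Suc 2) +>\<^bsub>P\<^esub> x) = rad_power R N (Suc j) +>\<^bsub>N\<^esub> f x"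
  proof (rule graded_map_coset[OF P N f _ xc])
    show "f ` rad_power R P (Suc 2) \<subseteq> rad_power R N (Suc j)"
      unfolding P3' using hom_zero[OF P N f] sub by (simp add: N.submodule_iff)
  qed
  also have "\<dots> = rad_power R N (Suc j)"
    using N.coset_zero_iff[OF sub, of "f x"] f2[OF x] sub by (simp add: N.submodule_iff)
  finally have "rad_power R P (Suc 2) +>\<^bsub>P\<^esub> x \<in> a_kernel (graded_piece R P 2) (graded_piece R N j) (graded_map R N j f)"
    using x unfolding a_kernel_eq graded_piece_simps by blast
  then have "rad_power R P (Suc 2) +>\<^bsub>P\<^esub> x \<in> graded_map R P 2 d ` carrier (graded_piece R P' 1)"
    using e by simp
  then obtain y where y: "y \<in> rad_power R P' 1"
      "rad_power R P (Suc 2) +>\<^bsub>P\<^esub> x = graded_map R P 2 d (rad_power R P' (Suc 1) +>\<^bsub>P'\<^esub> y)"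
    unfolding graded_piece_simps by blast
  have yc: "y \<in> carrier P'" using y rad_power_carrier[OF P'] by blast
  have "graded_map R P 2 d (rad_power R P' (Suc 1) +>\<^bsub>P'\<^esub> y) = rad_power R P (Suc 2) +>\<^bsub>P\<^esub> d y"
    by (rule graded_map_coset[OF P' P d _ yc]) (use rad_power_hom_subset[OF P' P d d1, of "Suc 1"] in simp)
  then have "x \<ominus>\<^bsub>P\<^esub> d y \<in> rad_power R P (Suc 2)"
    using y(2) P.coset_eq_iff[OF rad_power_submodule[OF P] xc hom_closed[OF d yc]] by metis
  then have "x = d y" using P3' P.diff_zero_iff[OF xc hom_closed[OF d yc]] by simp
  then have "x \<in> d ` rmul R P' (carrier P')" using y(1) by (simp add: rad_power_Suc)
  then show "x \<in> rmul R P (d ` carrier P')" by (simp add: rmul_hom[OF P' P d])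
qed

section \<open>Minimal resolutions\<close>

context
  fixes M :: "('a, 'm) module" and P :: "nat \<Rightarrow> ('a, nat \<Rightarrow> 'a) module" and d p
  assumes M: "left_module R M" and res: "minimal_projective_resolution R M P d p"
begin

abbreviation "\<Omega> \<equiv> resolution_kernel M P d p"

lemma res_cover: "projective_cover R (P 0) M p" "projective_cover R (P (Suc n)) (\<Omega> n) (d n)"
  using res by (auto simp: minimal_projective_resolution_def)

lemma res_left_module: "left_module R (P n)"
  using res_cover by (cases n) (auto simp: projective_cover_def projective_module_def)

lemma res_p: "p \<in> Hom (P 0) M" "p ` carrier (P 0) = carrier M"
  using res_cover(1) by (auto simp: projective_cover_def)

lemma res_d: "d n \<in> Hom (P (Suc n)) (\<Omega> n)" "d n ` carrier (P (Suc n)) = carrier (\<Omega> n)"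
  using res_cover(2)[of n] by (auto simp: projective_cover_def)

text \<open>The cover \<open>d n\<close> has target \<open>\<Omega> n\<close>, while exactness
  treats it as a map into \<open>P n\<close>. Passing between the two needs
  \<open>\<Omega> n\<close> to be a restriction of \<open>P n\<close>, which in turn depends on the
  previous kernel.\<close>

lemma res_sub:
  "submodule (carrier (\<Omega> n)) R (P n) \<and> \<Omega> n = restrict_module (P n) (carrier (\<Omega> n))"
proof (induction n)
  case 0
  show ?case using submodule_kernel[OF res_left_module[of 0] M res_p(1)]
    by (simp add: kernel_module_def)
next
  case (Suc n)
  have "carrier (\<Omega> n) \<subseteq> carrier (P n)" using Suc submodule_subset[OF res_left_module] by blast
  then have "d n \<in> Hom (P (Suc n)) (P n)" using Suc res_d(1)[of n] by (metis hom_restrict2)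
  then show ?case using submodule_kernel[OF res_left_module[of "Suc n"] res_left_module[of n]]
    by (simp add: kernel_module_def)
qed

lemma Omega_left_module: "left_module R (\<Omega> n)"
  using res_sub[of n] restrict_left_module[OF res_left_module[of n], of "carrier (\<Omega> n)"] by metis

lemma Omega_subset: "carrier (\<Omega> n) \<subseteq> carrier (P n)"
  using res_sub submodule_subset[OF res_left_module] by blast

lemma Omega_zero: "\<zero>\<^bsub>\<Omega> n\<^esub> = \<zero>\<^bsub>P n\<^esub>"
  using res_sub[of n] by (metis restrict_module_simps(3))

lemma res_d_hom: "d n \<in> Hom (P (Suc n)) (P n)"
  using res_sub[of n] res_d(1)[of n] Omega_subset by (metis hom_restrict2)

lemma Omega_Suc: "\<Omega> (Suc n) = kernel_module (P (Suc n)) (\<Omega> n) (d n)"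
  by (simp add: kernel_module_def a_kernel_eq Omega_zero)

lemma Omega_carrier: "carrier (\<Omega> 0) = a_kernel (P 0) M p" "carrier (\<Omega> (Suc n)) = a_kernel (P (Suc n)) (P n) (d n)"
  by (simp_all add: kernel_module_def)

lemma Omega_rad: "carrier (\<Omega> n) \<subseteq> rad_power R (P n) 1"
proof (cases n)
  case 0
  then show ?thesis using cover_kernel_subset[OF M res_cover(1)] by (simp add: kernel_module_def rad_power_Suc)
next
  case (Suc m)
  have "carrier (\<Omega> n) = a_kernel (P (Suc m)) (\<Omega> m) (d m)"
    unfolding Suc Omega_Suc by (simp add: kernel_module_def)
  then show ?thesis using cover_kernel_subset[OF Omega_left_module res_cover(2)] Suc by (simp add: rad_power_Suc)
qed

lemma res_d_rad: "d n ` carrier (P (Suc n)) \<subseteq> rad_power R (P n) 1"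
  using Omega_rad res_d(2) by simp

lemma res_dd: "x \<in> carrier (P (Suc (Suc n))) \<Longrightarrow> d n (d (Suc n) x) = \<zero>\<^bsub>P n\<^esub>"
proof -
  assume "x \<in> carrier (P (Suc (Suc n)))"
  then have "d (Suc n) x \<in> carrier (\<Omega> (Suc n))" using res_d(2)[of "Suc n"] by blast
  then show ?thesis unfolding Omega_carrier by (simp add: a_kernel_eq)
qed

lemma res_pd: "x \<in> carrier (P (Suc 0)) \<Longrightarrow> p (d 0 x) = \<zero>\<^bsub>M\<^esub>"
proof -
  assume "x \<in> carrier (P (Suc 0))"
  then have "d 0 x \<in> carrier (\<Omega> 0)" using res_d(2)[of 0] by blast
  then show ?thesis unfolding Omega_carrier by (simp add: a_kernel_eq)
qed

text \<open>One instance of exactness per projective is used, that at J^2 P_n. The outgoing map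
  vanishes there: for n = 0 because J^2 M = 0, otherwise because the differential maps into the
  radical and J^3 = 0.\<close>

lemma koszul_exact_aligned:
  assumes ke: "\<And>n. koszul_exact R M P d p n" and M2: "rad_power R M 2 = {\<zero>\<^bsub>M\<^esub>}"
  shows "rad_power R (P n) 2 \<subseteq> rmul R (P n) (carrier (\<Omega> n))"
proof (cases n)
  case 0
  have e: "graded_map R (P 0) 2 (d 0) ` carrier (graded_piece R (P 1) 1) =
      a_kernel (graded_piece R (P 0) 2) (graded_piece R M 2) (graded_map R M 2 p)"
    using ke[of 2] by (simp add: koszul_exact_def numeral_2_eq_2)
  have "p x = \<zero>\<^bsub>M\<^esub>" if "x \<in> rad_power R (P 0) 2" for x
    using rad_power_hom_subset[OF res_left_module M res_p(1), of 0 2] res_p(2) M2 that by auto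
  from exact_aligned[OF res_left_module res_left_module M res_d_hom res_p(1) res_d_rad this, of 2] e
  show ?thesis using 0 res_d(2)[of 0] by simp
next
  case (Suc m)
  have e: "graded_map R (P (Suc m)) 2 (d (Suc m)) ` carrier (graded_piece R (P (Suc (Suc m))) 1) =
      a_kernel (graded_piece R (P (Suc m)) 2) (graded_piece R (P m) 3) (graded_map R (P m) 3 (d m))"
    using ke[of "1 + m + 2"] unfolding koszul_exact_def
    by (elim conjE allE[of _ 1] allE[of _ m]) (simp add: numeral_2_eq_2 numeral_3_eq_3)
  have "d m x = \<zero>\<^bsub>P m\<^esub>" if "x \<in> rad_power R (P (Suc m)) 2" for x
  proof -
    have "d m x \<in> rad_power R (P m) (2 + 1)"
      using rad_power_hom_subset[OF res_left_module res_left_module res_d_hom[of m] res_d_rad[of m], of 2]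
        imageI[OF that, of "d m"] by (rule subsetD)
    then show ?thesis using rad_power_ge3[OF res_left_module, of "2 + 1" m] by simp
  qed
  from exact_aligned[OF res_left_module res_left_module res_left_module res_d_hom res_d_hom res_d_rad this, of "3"] e
  show ?thesis using Suc res_d(2)[of "Suc m"] by simp
qed

lemma koszul_upto_Omega:
  assumes al: "\<And>n. rad_power R (P n) 2 \<subseteq> rmul R (P n) (carrier (\<Omega> n))"
  shows "koszul_upto k (\<Omega> n)"
proof (induction k arbitrary: n)
  case (Suc k)
  have "aligned (P (Suc n)) (\<Omega> n) (d n)"
    using al[of "Suc n"] unfolding Omega_Suc aligned_def
    by (simp add: kernel_module_def numeral_2_eq_2 rad_power_Suc)
  then obtain r \<pi> \<phi> where \<pi>: "fcover (\<Omega> n) r \<pi>" "aligned (free r) (\<Omega> n) \<pi>"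
      and \<phi>: "miso R (\<Omega> (Suc n)) (Syz r (\<Omega> n) \<pi>) \<phi>"
    using cover_to_fcover[OF Omega_left_module res_cover(2)[of n]] unfolding Omega_Suc by blast
  have "koszul_upto k (Syz r (\<Omega> n) \<pi>)"
    by (rule koszul_upto_miso[OF Omega_left_module kernel_fcover_left_module[OF Omega_left_module \<pi>(1)] \<phi> Suc])
  then show ?case using \<pi> by auto
qed simp

lemma koszul_type_resolution:
  assumes al: "\<And>n. rad_power R (P n) 2 \<subseteq> rmul R (P n) (carrier (\<Omega> n))"
  shows "koszul_type M"
proof -
  have "aligned (P 0) M p"
    using al[of 0] by (simp add: aligned_def kernel_module_def numeral_2_eq_2 rad_power_Suc)
  then obtain r \<pi> \<phi> where \<pi>: "fcover M r \<pi>" "aligned (free r) M \<pi>"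
      and \<phi>: "miso R (\<Omega> 0) (Syz r M \<pi>) \<phi>"
    using cover_to_fcover[OF M res_cover(1)] by auto
  have "koszul_upto k (Syz r M \<pi>)" for k
    by (rule koszul_upto_miso[OF Omega_left_module kernel_fcover_left_module[OF M \<pi>(1)] \<phi> koszul_upto_Omega[OF al]])
  then show ?thesis using M \<pi> unfolding koszul_type_def by blast
qed

text \<open>The radical filtration that \<open>P n\<close> induces on the kernel is the shifted
  filtration of the next projective. Degree i = 0 is surjectivity onto the kernel, i = 1 is
  alignment, and for larger i everything is zero.\<close>

lemma Omega_rad_power:
  assumes al: "\<And>n. rad_power R (P n) 2 \<subseteq> rmul R (P n) (carrier (\<Omega> n))"
    and x: "x \<in> carrier (\<Omega> n)" "x \<in> rad_power R (P n) (Suc i)"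
  shows "x \<in> d n ` rad_power R (P (Suc n)) i"
proof -
  consider "i = 0" | "i = 1" | "2 \<le> i" by linarith
  then show ?thesis
  proof cases
    case 1 then show ?thesis using x(1) res_d(2)[of n] by simp
  next
    case 2
    then have "x \<in> rmul R (P n) (carrier (\<Omega> n))" using x(2) al[of n] by (auto simp: numeral_2_eq_2)
    then have "x \<in> d n ` rmul R (P (Suc n)) (carrier (P (Suc n)))"
      using rmul_hom[OF res_left_module res_left_module res_d_hom order_refl, of n] res_d(2)[of n] by simp
    then show ?thesis using 2 by (simp add: rad_power_Suc)
  next
    case 3
    then have "x = \<zero>\<^bsub>P n\<^esub>" using x(2) rad_power_ge3[OF res_left_module, of "Suc i" n] by simp
    then have "x = d n \<zero>\<^bsub>P (Suc n)\<^esub>" using hom_zero[OF res_left_module res_left_module res_d_hom, of n] by simp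
    moreover have "\<zero>\<^bsub>P (Suc n)\<^esub> \<in> rad_power R (P (Suc n)) i"
      using rad_power_submodule[OF res_left_module, of "Suc n" i] by (simp add: left_module.submodule_iff[OF res_left_module])
    ultimately show ?thesis by (rule image_eqI)
  qed
qed

text \<open>A converse of \<open>koszul_exact_aligned\<close> for semisimple M, as needed for the
  simple module. With JM = 0 and J^3 = 0 the targets of the graded maps in the middle have zero
  denominators, so \<open>graded_exact\<close> applies.\<close>

lemma aligned_koszul_exact:
  assumes al: "\<And>n. rad_power R (P n) 2 \<subseteq> rmul R (P n) (carrier (\<Omega> n))"
    and M1: "rad_power R M 1 = {\<zero>\<^bsub>M\<^esub>}"
  shows "koszul_exact R M P d p n"
proof -
  have Mz: "rad_power R M (Suc i) = {\<zero>\<^bsub>M\<^esub>}" for i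
  proof (induction i)
    case (Suc i)
    have "rad_power R M (Suc (Suc i)) \<subseteq> {\<zero>\<^bsub>M\<^esub>}"
      using rad_power_Suc_subset[OF M, of "Suc i"] Suc by simp
    moreover have "\<zero>\<^bsub>M\<^esub> \<in> rad_power R M (Suc (Suc i))"
      using rad_power_submodule[OF M, of "Suc (Suc i)"] by (simp add: left_module.submodule_iff[OF M])
    ultimately show ?case by blast
  qed (use M1 in simp)
  have pm: "p ` rad_power R (P 0) i = rad_power R M i" for i
    using rad_power_hom[OF res_left_module M res_p(1), of 0 i] res_p(2) by simp
  have gp: "graded_map R M i p (rad_power R (P 0) (Suc i) +>\<^bsub>P 0\<^esub> x) = rad_power R M (Suc i) +>\<^bsub>M\<^esub> p x"
    if "x \<in> carrier (P 0)" for i x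
    by (rule graded_map_coset[OF res_left_module M res_p(1) _ that]) (simp add: pm)
  have inj0: "inj_on (graded_map R M 0 p) (carrier (graded_piece R (P 0) 0))"
  proof (rule inj_onI)
    interpret P0: left_module R "P 0" by (rule res_left_module)
    interpret M: left_module R M by (rule M)
    fix C D assume "C \<in> carrier (graded_piece R (P 0) 0)" "D \<in> carrier (graded_piece R (P 0) 0)"
      and e: "graded_map R M 0 p C = graded_map R M 0 p D"
    then obtain x y where x: "x \<in> carrier (P 0)" "C = rad_power R (P 0) (Suc 0) +>\<^bsub>P 0\<^esub> x"
      and y: "y \<in> carrier (P 0)" "D = rad_power R (P 0) (Suc 0) +>\<^bsub>P 0\<^esub> y" by (auto simp: graded_piece_simps)
    have "p x \<ominus>\<^bsub>M\<^esub> p y \<in> rad_power R M (Suc 0)"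
      using e x y gp M.coset_eq_iff[OF rad_power_submodule[OF M]] hom_closed[OF res_p(1)] by simp
    then have "p (x \<ominus>\<^bsub>P 0\<^esub> y) = \<zero>\<^bsub>M\<^esub>" using Mz by (simp add: hom_diff[OF P0.lm M res_p(1) x(1) y(1)])
    then have "x \<ominus>\<^bsub>P 0\<^esub> y \<in> carrier (\<Omega> 0)" using x y by (simp add: Omega_carrier a_kernel_eq del: resolution_kernel.simps)
    then have "x \<ominus>\<^bsub>P 0\<^esub> y \<in> rad_power R (P 0) (Suc 0)" using Omega_rad[of 0] by auto
    then show "C = D" using x y P0.coset_eq_iff[OF rad_power_submodule[OF P0.lm]] by simp
  qed
  have dm: "d m ` rad_power R (P (Suc m)) i \<subseteq> rad_power R (P m) (Suc i)" for m i
    using rad_power_hom_subset[OF res_left_module res_left_module res_d_hom[of m] res_d_rad[of m], of i] by simp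
  have injS: "inj_on (graded_map R (P m) 1 (d m)) (carrier (graded_piece R (P (Suc m)) 0))" for m
  proof (rule inj_onI)
    interpret P1: left_module R "P (Suc m)" by (rule res_left_module)
    interpret P0: left_module R "P m" by (rule res_left_module)
    fix C D assume "C \<in> carrier (graded_piece R (P (Suc m)) 0)" "D \<in> carrier (graded_piece R (P (Suc m)) 0)"
      and e: "graded_map R (P m) 1 (d m) C = graded_map R (P m) 1 (d m) D"
    then obtain x y where x: "x \<in> carrier (P (Suc m))" "C = rad_power R (P (Suc m)) (Suc 0) +>\<^bsub>P (Suc m)\<^esub> x"
      and y: "y \<in> carrier (P (Suc m))" "D = rad_power R (P (Suc m)) (Suc 0) +>\<^bsub>P (Suc m)\<^esub> y"
      by (auto simp: graded_piece_simps)
    have gd: "graded_map R (P m) 1 (d m) (rad_power R (P (Suc m)) (Suc 0) +>\<^bsub>P (Suc m)\<^esub> x)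
        = rad_power R (P m) (Suc 1) +>\<^bsub>P m\<^esub> d m x" if "x \<in> carrier (P (Suc m))" for x
      by (rule graded_map_coset[OF P1.lm P0.lm res_d_hom _ that]) (use dm[of m "Suc 0"] in simp)
    have s: "x \<ominus>\<^bsub>P (Suc m)\<^esub> y \<in> carrier (P (Suc m))" using x y by simp
    have "d m x \<ominus>\<^bsub>P m\<^esub> d m y \<in> rad_power R (P m) (Suc 1)"
      using e gd x y P0.coset_eq_iff[OF rad_power_submodule[OF P0.lm]] hom_closed[OF res_d_hom] by simp
    then have "d m (x \<ominus>\<^bsub>P (Suc m)\<^esub> y) \<in> rad_power R (P m) (Suc 1)"
      by (simp add: hom_diff[OF P1.lm P0.lm res_d_hom x(1) y(1)])
    moreover have "d m (x \<ominus>\<^bsub>P (Suc m)\<^esub> y) \<in> carrier (\<Omega> m)" using res_d(2) s by blast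
    \<comment> \<open>Alignment in degree 1: d (x - y) lies in J^2 P_m and in the kernel there, so
      it already comes from an element z of the radical. Then x - y - z is killed by d, and
      minimality puts it into the radical too.\<close>
    ultimately obtain z where z: "z \<in> rad_power R (P (Suc m)) 1" "d m (x \<ominus>\<^bsub>P (Suc m)\<^esub> y) = d m z"
      using Omega_rad_power[OF al] by blast
    have zc: "z \<in> carrier (P (Suc m))" using z rad_power_carrier[OF P1.lm] by blast
    let ?w = "(x \<ominus>\<^bsub>P (Suc m)\<^esub> y) \<ominus>\<^bsub>P (Suc m)\<^esub> z"
    have "d m ?w = \<zero>\<^bsub>P m\<^esub>"
      using z(2) hom_closed[OF res_d_hom zc] by (simp add: hom_diff[OF P1.lm P0.lm res_d_hom s zc] P0.diff_zero_iff)
    then have "?w \<in> carrier (\<Omega> (Suc m))" using s zc by (simp add: Omega_carrier a_kernel_eq del: resolution_kernel.simps)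
    then have "?w \<in> rad_power R (P (Suc m)) 1" using Omega_rad by blast
    then have "z \<oplus>\<^bsub>P (Suc m)\<^esub> ?w \<in> rad_power R (P (Suc m)) 1"
      using z(1) rad_power_submodule[OF P1.lm, of 1] unfolding P1.submodule_iff by blast
    then have "x \<ominus>\<^bsub>P (Suc m)\<^esub> y \<in> rad_power R (P (Suc m)) (Suc 0)" using P1.add_diff_cancel[OF s zc] by simp
    then show "C = D" using x y P1.coset_eq_iff[OF rad_power_submodule[OF P1.lm]] by simp
  qed
  have ex2: "graded_map R (P (m + 1)) (i + 1) (d (m + 1)) ` carrier (graded_piece R (P (m + 2)) i) =
       a_kernel (graded_piece R (P (m + 1)) (i + 1)) (graded_piece R (P m) (i + 2))
         (graded_map R (P m) (i + 2) (d m))" for i m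
  proof -
    have "graded_map R (P (Suc m)) (Suc i) (d (Suc m)) ` carrier (graded_piece R (P (Suc (Suc m))) i) =
       a_kernel (graded_piece R (P (Suc m)) (Suc i)) (graded_piece R (P m) (Suc (Suc i)))
         (graded_map R (P m) (Suc (Suc i)) (d m))"
    proof (rule graded_exact[OF res_left_module res_left_module res_left_module res_d_hom res_d_hom res_d_rad dm])
      show "rad_power R (P m) (Suc (Suc (Suc i))) = {\<zero>\<^bsub>P m\<^esub>}" by (rule rad_power_ge3[OF res_left_module]) simp
      fix x assume x: "x \<in> rad_power R (P (Suc m)) (Suc i)" "d m x = \<zero>\<^bsub>P m\<^esub>"
      then have "x \<in> carrier (\<Omega> (Suc m))" using rad_power_carrier[OF res_left_module]
        unfolding Omega_carrier a_kernel_eq by blast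
      then show "x \<in> d (Suc m) ` rad_power R (P (Suc (Suc m))) i" using x(1) by (rule Omega_rad_power[OF al])
    qed (rule res_dd)
    then show ?thesis by simp
  qed
  have ex3: "graded_map R (P 0) (Suc m) (d 0) ` carrier (graded_piece R (P 1) m) =
       a_kernel (graded_piece R (P 0) (Suc m)) (graded_piece R M (Suc m)) (graded_map R M (Suc m) p)" for m
  proof -
    have "graded_map R (P 0) (Suc m) (d 0) ` carrier (graded_piece R (P (Suc 0)) m) =
       a_kernel (graded_piece R (P 0) (Suc m)) (graded_piece R M (Suc m)) (graded_map R M (Suc m) p)"
    proof (rule graded_exact[OF res_left_module res_left_module M res_d_hom res_p(1) res_d_rad])
      show "p ` rad_power R (P 0) (Suc (Suc m)) \<subseteq> rad_power R M (Suc (Suc m))" by (simp add: pm)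
      fix x assume x: "x \<in> rad_power R (P 0) (Suc m)" "p x = \<zero>\<^bsub>M\<^esub>"
      then have "x \<in> carrier (\<Omega> 0)" using rad_power_carrier[OF res_left_module]
        unfolding Omega_carrier a_kernel_eq by blast
      then show "x \<in> d 0 ` rad_power R (P (Suc 0)) m" using x(1) by (rule Omega_rad_power[OF al])
    qed (rule Mz res_pd; assumption?)+
    then show ?thesis by simp
  qed
  have surj: "graded_map R M n p ` carrier (graded_piece R (P 0) n) = carrier (graded_piece R M n)"
  proof -
    have "graded_map R M n p ` carrier (graded_piece R (P 0) n) = (\<lambda>x. rad_power R M (Suc n) +>\<^bsub>M\<^esub> p x) ` rad_power R (P 0) n"
      unfolding graded_piece_simps image_image
      by (rule image_cong[OF refl gp]) (use rad_power_carrier[OF res_left_module] in blast)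
    also have "\<dots> = (\<lambda>x. rad_power R M (Suc n) +>\<^bsub>M\<^esub> x) ` (p ` rad_power R (P 0) n)" by (simp add: image_image)
    finally show ?thesis by (simp add: pm graded_piece_simps)
  qed
  show ?thesis unfolding koszul_exact_def
    using inj0 injS ex2 ex3 surj by (cases n) auto
qed

end

lemma koszul_module_type:
  assumes M: "left_module R M" and K: "koszul_module R M" and M2: "rad_power R M 2 = {\<zero>\<^bsub>M\<^esub>}"
  shows "koszul_type M"
proof -
  obtain P :: "nat \<Rightarrow> ('a, nat \<Rightarrow> 'a) module" and d p where r: "minimal_projective_resolution R M P d p" "\<And>n. koszul_exact R M P d p n"
    using K unfolding koszul_module_def by blast
  show ?thesis by (rule koszul_type_resolution[OF M r(1) koszul_exact_aligned[OF M r M2]])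
qed

section \<open>Building a Koszul resolution from alignment at every depth\<close>

text \<open>\<open>koszul_upto\<close> provides a finite resolution for each depth,
  \<open>koszul_module\<close> wants a single infinite one; a fixed choice of covers produces
  it.\<close>

definition chosen_cover :: "('a, nat \<Rightarrow> 'a) module \<Rightarrow> nat \<times> ((nat \<Rightarrow> 'a) \<Rightarrow> nat \<Rightarrow> 'a)" where
  "chosen_cover N = (SOME c. fcover N (fst c) (snd c))"

primrec iter_kernel :: "('a, nat \<Rightarrow> 'a) module \<Rightarrow> nat \<Rightarrow> ('a, nat \<Rightarrow> 'a) module" where
  "iter_kernel N 0 = N"
| "iter_kernel N (Suc i) = kernel_module (free (fst (chosen_cover (iter_kernel N i)))) (iter_kernel N i)
     (snd (chosen_cover (iter_kernel N i)))"

text \<open>Since the depth property holds for every cover, the kernels of the chosen covers keep it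
  at all depths, and each chosen cover is aligned.\<close>

lemma koszul_type_module:
  assumes K: "koszul_type M" and M1: "rad_power R M 1 = {\<zero>\<^bsub>M\<^esub>}"
  shows "koszul_module R M"
proof -
  have M: "left_module R M" using K by (simp add: koszul_type_def)
  obtain t \<pi> where \<pi>: "fcover M t \<pi>" "aligned (free t) M \<pi>" "\<And>k. koszul_upto k (Syz t M \<pi>)"
    using K unfolding koszul_type_def by blast
  define N0 where "N0 = Syz t M \<pi>"
  let ?N = "iter_kernel N0"
  define r where "r i = fst (chosen_cover (?N i))" for i
  define d where "d i = snd (chosen_cover (?N i))" for i
  have N: "left_module R (?N i) \<and> (\<forall>k. koszul_upto k (?N i)) \<and> fcover (?N i) (r i) (d i)" for i
  proof (induction i)
    case 0
    have 1: "left_module R (?N 0)" using kernel_fcover_left_module[OF M \<pi>(1)] by (simp add: N0_def)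
    moreover obtain n \<gamma> where "fcover (?N 0) n \<gamma>" using \<pi>(3)[of "Suc 0"] unfolding N0_def by auto
    then have "fcover (?N 0) (r 0) (d 0)" unfolding r_def d_def chosen_cover_def
      by (intro someI[of "\<lambda>c. fcover (?N 0) (fst c) (snd c)" "(n, \<gamma>)"]) simp
    ultimately show ?case using \<pi>(3) by (simp add: N0_def)
  next
    case (Suc i)
    have e: "?N (Suc i) = Syz (r i) (?N i) (d i)" by (simp add: r_def d_def)
    have c: "fcover (?N i) (r i) (d i)" and lm: "left_module R (?N i)" using Suc by auto
    have 1: "left_module R (?N (Suc i))" unfolding e by (rule kernel_fcover_left_module[OF lm c])
    have 2: "koszul_upto k (?N (Suc i))" for k
      unfolding e using Suc koszul_upto_SucD(2)[OF lm _ c] by blast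
    obtain n \<gamma> where "fcover (?N (Suc i)) n \<gamma>" using 2[of "Suc 0"] by auto
    then have "fcover (?N (Suc i)) (r (Suc i)) (d (Suc i))" unfolding r_def d_def chosen_cover_def
      by (intro someI[of "\<lambda>c. fcover (?N (Suc i)) (fst c) (snd c)" "(n, \<gamma>)"]) simp
    then show ?case using 1 2 by blast
  qed
  have Na: "aligned (free (r i)) (?N i) (d i)" for i
    using N koszul_upto_SucD(1)[of "?N i" 0] by blast
  \<comment> \<open>Index shift: term 0 covers M, and term i + 1 covers the i-th iterated
    kernel.\<close>
  define P where "P i = (case i of 0 \<Rightarrow> free t | Suc j \<Rightarrow> free (r j))" for i
  have P: "P 0 = free t" "P (Suc i) = free (r i)" for i by (simp_all add: P_def)
  have zero: "\<zero>\<^bsub>?N i\<^esub> = \<zero>\<^bsub>P i\<^esub>" for i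
    by (cases i) (simp_all add: P kernel_module_def r_def N0_def)
  have rk: "resolution_kernel M P d \<pi> i = ?N i" for i
  proof (cases i)
    case (Suc j)
    show ?thesis unfolding Suc using zero[of j]
      by (simp add: kernel_module_def P a_kernel_eq r_def d_def)
  qed (simp add: P N0_def)
  have res: "minimal_projective_resolution R M P d \<pi>"
    unfolding minimal_projective_resolution_def rk P
    using fcover_projective_cover[OF M \<pi>(1)] fcover_projective_cover N by blast
  have al: "rad_power R (P n) 2 \<subseteq> rmul R (P n) (carrier (resolution_kernel M P d \<pi> n))" for n
  proof (cases n)
    case 0 then show ?thesis using \<pi>(2) 
      by (simp add: N0_def rk P aligned_def rad_power_Suc numeral_2_eq_2 kernel_module_def)
  next
    case (Suc j) then show ?thesis using Na[of j]
      by (simp add: rk P aligned_def rad_power_Suc numeral_2_eq_2 kernel_module_def r_def d_def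
          del: resolution_kernel.simps)
  qed
  show ?thesis unfolding koszul_module_def using res aligned_koszul_exact[OF M res al M1] by blast
qed

end

section \<open>Growth of solutions of the recurrence\<close>

text \<open>Both sides are read off from the power series with coefficients t n: its radius of
  convergence is the inverse of the limsup of roots by definition, and 1/L by the ratio
  test.\<close>

lemma limsup_root_ratio:
  fixes t :: "nat \<Rightarrow> nat"
  assumes nz: "eventually (\<lambda>n. t n \<noteq> 0) sequentially"
    and lim: "(\<lambda>n. real (t (Suc n)) / real (t n)) \<longlonglongrightarrow> L" and L: "L > 0"
  shows "limsup (\<lambda>n. ereal (root n (real (t n)))) = ereal L"
proof -
  have "(\<lambda>n. inverse (real (t (Suc n)) / real (t n))) \<longlonglongrightarrow> inverse L"
    by (rule tendsto_inverse[OF lim]) (use L in simp)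
  then have "conv_radius (\<lambda>n. real (t n)) = ereal (inverse L)"
    using nz by (intro conv_radius_ratio_limit[OF refl]) simp_all
  then have "inverse (limsup (\<lambda>n. ereal (root n (real (t n))))) = ereal (inverse L)"
    by (simp add: conv_radius_def)
  then show ?thesis using L
    by (cases "limsup (\<lambda>n. ereal (root n (real (t n))))") (auto split: if_splits)
qed

lemma limsup_root_zero:
  fixes t :: "nat \<Rightarrow> nat"
  assumes "eventually (\<lambda>n. t n = 0) sequentially"
  shows "limsup (\<lambda>n. ereal (root n (real (t n)))) = 0"
proof -
  have "limsup (\<lambda>n. ereal (root n (real (t n)))) = limsup (\<lambda>n. 0 :: ereal)"
    by (rule Limsup_eq) (use assms in \<open>auto elim: eventually_mono simp: zero_ereal_def\<close>)
  then show ?thesis by (simp add: Limsup_const)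
qed

context
  fixes t :: "nat \<Rightarrow> nat" and e l :: nat
  assumes rec: "\<And>i. t (Suc (Suc i)) + l * t i = e * t (Suc i)" and t0: "t 0 > 0" and l: "l > 0"
begin

text \<open>If a term vanished after a positive one, the recurrence would make the positive number
  \<open>l * t i\<close> vanish.\<close>

lemma recurrence_pos: "t i > 0"
proof (induction i)
  case (Suc i)
  have "0 < e * t (Suc i)" using rec[of i] Suc l by (metis add_gr_0 nat_0_less_mult_iff)
  then show ?case by simp
qed (rule t0)

lemma recurrence_ratio: "real (t (Suc (Suc i))) / real (t (Suc i)) = real e - real l / (real (t (Suc i)) / real (t i))"
proof -
  have "real (t (Suc (Suc i))) + real l * real (t i) = real e * real (t (Suc i))"
    using rec[of i] by (metis of_nat_add of_nat_mult)
  then have "real (t (Suc (Suc i))) = real e * real (t (Suc i)) - real l * real (t i)" by simp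
  then show ?thesis using recurrence_pos[of "Suc i"] recurrence_pos[of i] by (simp add: field_simps)
qed

lemma recurrence_limit:
  "\<exists>L>0. (\<lambda>n. real (t (Suc n)) / real (t n)) \<longlonglongrightarrow> L \<and> L^2 - real e * L + real l = 0"
proof -
  define r where "r n = real (t (Suc n)) / real (t n)" for n
  have pos: "r n > 0" for n unfolding r_def using recurrence_pos by simp
  have step: "r (Suc n) = real e - real l / r n" for n unfolding r_def by (rule recurrence_ratio)
  \<comment> \<open>The map x to e - l/x increases on positive numbers, so the direction of the
    first step persists and the ratios are monotone either way.\<close>
  have mono: "r (Suc m) \<le> r (Suc n)" if "r m \<le> r n" for m n
    unfolding step using that pos[of m] l by (simp add: frac_le)
  have "monoseq r"
  proof (cases "r 0 \<le> r 1")
    case True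
    have "r n \<le> r (Suc n)" for n by (induction n) (use True mono in auto)
    then show ?thesis by (simp add: monoseq_Suc)
  next
    case False
    have "r (Suc n) \<le> r n" for n by (induction n) (use False mono in auto)
    then show ?thesis by (simp add: monoseq_Suc)
  qed
  moreover have "Bseq r"
  proof (rule BseqI')
    fix n show "norm (r n) \<le> max (r 0) (real e)"
    proof (cases n)
      case (Suc m)
      have "r n \<le> real e" unfolding Suc step using pos[of m] by simp
      then show ?thesis using pos[of n] by simp
    qed (use pos[of 0] in simp)
  qed
  ultimately obtain L where L: "r \<longlonglongrightarrow> L" using Bseq_monoseq_convergent unfolding convergent_def by blast
  \<comment> \<open>Multiplying out avoids a division by the limit, which is not yet known to be
    non-zero; for L = 0 the limit equation would give l = 0.\<close>
  have "r (Suc n) * r n = real e * r n - real l" for n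
    using pos[of n] by (simp add: step field_simps)
  moreover have "(\<lambda>n. r (Suc n) * r n) \<longlonglongrightarrow> L * L" by (intro tendsto_mult LIMSEQ_Suc L)
  moreover have "(\<lambda>n. real e * r n - real l) \<longlonglongrightarrow> real e * L - real l" by (intro tendsto_intros L)
  ultimately have eq: "L * L = real e * L - real l" using LIMSEQ_unique by simp
  have "L \<ge> 0" using LIMSEQ_le_const[OF L, of 0] pos less_imp_le by blast
  moreover have "L \<noteq> 0" using eq l by auto
  ultimately have "L > 0" by simp
  then show ?thesis using L eq unfolding r_def by (intro exI[of _ L]) (simp add: power2_eq_square)
qed

text \<open>The limit of the ratios is a real root of x^2 - e x + l, which completes the
  discriminant to a square.\<close>

lemma discriminant: "4 * real l \<le> (real e)^2"
proof -
  obtain L where "L^2 - real e * L + real l = 0" using recurrence_limit by blast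
  then have "(real e)^2 - 4 * real l = (2 * L - real e)^2" by (simp add: power2_eq_square algebra_simps)
  then show ?thesis using zero_le_power2[of "2 * L - real e"] by linarith
qed

lemma recurrence_growth:
  "limsup (\<lambda>n. ereal (root n (real (t n)))) = ereal (1/2 * (real e + sqrt ((real e)^2 - 4 * real l))) \<or>
   limsup (\<lambda>n. ereal (root n (real (t n)))) = ereal (1/2 * (real e - sqrt ((real e)^2 - 4 * real l)))"
proof -
  obtain L where L: "L > 0" "(\<lambda>n. real (t (Suc n)) / real (t n)) \<longlonglongrightarrow> L" "L^2 - real e * L + real l = 0"
    using recurrence_limit by blast
  have "eventually (\<lambda>n. t n \<noteq> 0) sequentially" using recurrence_pos by (simp add: order_less_imp_not_eq2)
  then have g: "limsup (\<lambda>n. ereal (root n (real (t n)))) = ereal L" using L by (intro limsup_root_ratio)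
  have "(real e)^2 - 4 * real l = (2 * L - real e)^2" using L(3) by (simp add: power2_eq_square algebra_simps)
  then have "sqrt ((real e)^2 - 4 * real l) = \<bar>2 * L - real e\<bar>" by simp
  then have "L = 1/2 * (real e + sqrt ((real e)^2 - 4 * real l)) \<or> L = 1/2 * (real e - sqrt ((real e)^2 - 4 * real l))"
    by (auto simp: abs_if)
  then show ?thesis using g by metis
qed

text \<open>The larger root \<rho> is a fixed point of the increasing map x to e - l/x, and the
  first ratio e is at least \<rho>; all ratios therefore stay above \<rho>, and a root of the
  polynomial cannot exceed it.\<close>

lemma recurrence_growth_max:
  assumes "t 0 = 1" "t 1 = e"
  shows "limsup (\<lambda>n. ereal (root n (real (t n)))) = ereal (1/2 * (real e + sqrt ((real e)^2 - 4 * real l)))"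
proof -
  obtain L where L: "L > 0" "(\<lambda>n. real (t (Suc n)) / real (t n)) \<longlonglongrightarrow> L" "L^2 - real e * L + real l = 0"
    using recurrence_limit by blast
  define D where "D = sqrt ((real e)^2 - 4 * real l)"
  define \<rho> where "\<rho> = 1/2 * (real e + D)"
  have D: "D \<ge> 0" "D^2 = (real e)^2 - 4 * real l" "D \<le> real e"
  proof -
    show "D \<ge> 0" "D^2 = (real e)^2 - 4 * real l" unfolding D_def using discriminant by auto
    show "D \<le> real e" unfolding D_def by (rule real_le_lsqrt) auto
  qed
  have e: "e > 0" using recurrence_pos[of 1] assms by simp
  have \<rho>: "\<rho> > 0" "\<rho>^2 = real e * \<rho> - real l"
  proof -
    show "\<rho> > 0" using D e by (simp add: \<rho>_def)
    have "4 * \<rho>^2 = (real e)^2 + 2 * real e * D + D^2" by (simp add: \<rho>_def power2_eq_square field_simps)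
    also have "\<dots> = 4 * (real e * \<rho> - real l)" unfolding D(2) by (simp add: \<rho>_def power2_eq_square field_simps)
    finally show "\<rho>^2 = real e * \<rho> - real l" by simp
  qed
  \<comment> \<open>The bound starts from \<rho> \<le> e, which holds because D is at most
    e.\<close>
  have ge: "\<rho> \<le> real (t (Suc n)) / real (t n)" for n
  proof (induction n)
    case 0 then show ?case using assms D by (simp add: \<rho>_def)
  next
    case (Suc n)
    have "\<rho> = real e - real l / \<rho>" using \<rho> by (simp add: field_simps power2_eq_square)
    also have "\<dots> \<le> real e - real l / (real (t (Suc n)) / real (t n))"
      using Suc \<rho>(1) recurrence_pos[of n] recurrence_pos[of "Suc n"]
      by (intro diff_left_mono divide_left_mono) auto
    finally show ?case using recurrence_ratio[of n] by simp
  qed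
  then have "\<rho> \<le> L" using LIMSEQ_le_const[OF L(2)] by blast
  moreover have "L \<le> \<rho>"
  proof -
    have "(2 * L - real e)^2 = D^2" using L(3) D(2) by (simp add: power2_eq_square algebra_simps)
    then have "2 * L - real e \<le> D" using D(1) by (metis abs_le_square_iff abs_of_nonneg abs_ge_self order_trans order_refl)
    then show ?thesis by (simp add: \<rho>_def)
  qed
  ultimately have "L = \<rho>" by simp
  moreover have "eventually (\<lambda>n. t n \<noteq> 0) sequentially" using recurrence_pos by (simp add: order_less_imp_not_eq2)
  ultimately show ?thesis using limsup_root_ratio[OF _ L(2,1)] by (simp add: \<rho>_def D_def)
qed

end

text \<open>The case l = 0, where t is geometric with ratio e from index 1 on. The value at index 0
  imposes nothing, so t may drop to zero at index 1; then the root limsup is 0 instead of e.\<close>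

lemma recurrence_degenerate:
  fixes t :: "nat \<Rightarrow> nat"
  assumes rec: "\<And>i. t (Suc (Suc i)) = e * t (Suc i)"
  shows "limsup (\<lambda>n. ereal (root n (real (t n)))) = ereal (if t 1 = 0 then 0 else real e)"
proof (cases "t 1 = 0 \<or> e = 0")
  case True
  have "t (Suc (Suc i)) = 0" for i by (induction i) (use True rec in auto)
  then have "t n = 0" if "n \<ge> 2" for n using that by (metis add_2_eq_Suc le_Suc_ex)
  then have "eventually (\<lambda>n. t n = 0) sequentially" unfolding eventually_sequentially by blast
  then show ?thesis using limsup_root_zero True by (auto simp: zero_ereal_def)
next
  case False
  have pos: "t (Suc i) \<noteq> 0" for i by (induction i) (use False rec in auto)
  have "t n \<noteq> 0" if "n \<ge> 1" for n using that pos[of "n - 1"] by simp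
  then have nz: "eventually (\<lambda>n. t n \<noteq> 0) sequentially" unfolding eventually_sequentially by blast
  have "(\<lambda>n. real (t (Suc (Suc n))) / real (t (Suc n))) \<longlonglongrightarrow> real e"
    using pos by (simp add: rec)
  then have "(\<lambda>n. real (t (Suc n)) / real (t n)) \<longlonglongrightarrow> real e"
    by (simp only: filterlim_sequentially_Suc[of "\<lambda>n. real (t (Suc n)) / real (t n)"])
  then show ?thesis using limsup_root_ratio[OF nz] False by simp
qed

section \<open>Short local rings\<close>

context short_local
begin

lemma simple_top_cover:
  "left_module R (simple_top R)" "rmul R (simple_top R) (carrier (simple_top R)) = {\<zero>\<^bsub>simple_top R\<^esub>}"
  "\<exists>\<pi>. fcover (simple_top R) 1 \<pi>"
proof -
  let ?S = "simple_top R"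
  show S: "left_module R ?S" unfolding simple_top_def by (rule quotient_left_module[OF regular_left_module J_submodule])
  interpret S: left_module R ?S by fact
  have q: "(\<lambda>x. J +>\<^bsub>reg\<^esub> x) \<in> Hom reg ?S"
    unfolding simple_top_def by (rule quotient_hom[OF regular_left_module J_submodule])
  have zero_iff: "J +>\<^bsub>reg\<^esub> x = \<zero>\<^bsub>?S\<^esub> \<longleftrightarrow> x \<in> J" if "x \<in> carrier R" for x
    using left_module.coset_zero_iff[OF regular_left_module J_submodule] that by (simp add: simple_top_def)
  have ev: "(\<lambda>c. c 0) \<in> Hom (free 1) reg" by (rule eval_hom) simp
  have "fcover ?S 1 (\<lambda>c. J +>\<^bsub>reg\<^esub> c 0)"
  proof (rule fcoverI[OF hom_comp[OF ev q]])
    fix x assume "x \<in> carrier ?S"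
    then obtain r where r: "r \<in> carrier R" "x = J +>\<^bsub>reg\<^esub> r" by (auto simp: simple_top_def)
    then show "\<exists>c\<in>carrier (free 1). J +>\<^bsub>reg\<^esub> c 0 = x"
      by (intro bexI[of _ "\<lambda>i\<in>{..<1}. r"]) (auto simp: free_module_simps)
  next
    fix c :: "nat \<Rightarrow> 'a" and i :: nat assume "c \<in> carrier (free 1)" "J +>\<^bsub>reg\<^esub> c 0 = \<zero>\<^bsub>?S\<^esub>" "i < 1"
    then show "c i \<in> J" using zero_iff[of "c 0"] by (auto simp: free_module_simps)
  qed
  then show "\<exists>\<pi>. fcover ?S 1 \<pi>" by blast
  have "rmul R ?S (carrier ?S) \<subseteq> {\<zero>\<^bsub>?S\<^esub>}"
  proof (rule rmul_least[OF S order_refl S.zero_submodule])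
    fix a x assume a: "a \<in> J" and "x \<in> carrier ?S"
    then obtain r where r: "r \<in> carrier R" "x = J +>\<^bsub>reg\<^esub> r" by (auto simp: simple_top_def)
    have "a \<odot>\<^bsub>?S\<^esub> x = J +>\<^bsub>reg\<^esub> (a \<otimes> r)"
      using hom_smult[OF q, of a r] a r J_carrier by simp
    then show "a \<odot>\<^bsub>?S\<^esub> x \<in> {\<zero>\<^bsub>?S\<^esub>}" using zero_iff[of "a \<otimes> r"] a r J_carrier J_mult_right by simp
  qed
  then show "rmul R ?S (carrier ?S) = {\<zero>\<^bsub>?S\<^esub>}"
    using rmul_submodule[OF S order_refl] by (auto simp: S.submodule_iff)
qed

lemma fcover_rank_pos:
  assumes M: "left_module R M" and \<pi>: "fcover M n \<pi>" and nz: "carrier M \<noteq> {\<zero>\<^bsub>M\<^esub>}"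
  shows "n \<noteq> 0"
proof
  assume "n = 0"
  then have "carrier (free n) = {\<zero>\<^bsub>free n\<^esub>}" by (simp add: free_module_simps restrict_def)
  then have "carrier M = {\<zero>\<^bsub>M\<^esub>}"
    using fcover_surj[OF \<pi>] hom_zero[OF free_left_module M fcover_hom[OF \<pi>]] by auto
  then show False using nz by simp
qed

lemma koszul_type_top_pos:
  assumes K: "koszul_type M" and nz: "carrier M \<noteq> {\<zero>\<^bsub>M\<^esub>}"
  shows "top_length R M > 0"
proof -
  obtain n \<pi> where M: "left_module R M" and \<pi>: "fcover M n \<pi>" using K unfolding koszul_type_def by blast
  show ?thesis using fcover_rank_pos[OF M \<pi> nz] fcover_tlen[OF M \<pi>] by (simp add: top_length_tlen[OF M])
qed

text \<open>The rank one cover of the simple module has kernel J, the first power of J, and is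
  aligned because the module is semisimple; all further kernels are governed by
  \<open>koszul_upto_Jpow\<close>.\<close>

lemma koszul_type_simple_top:
  assumes K: "koszul_type M" and nz: "carrier M \<noteq> {\<zero>\<^bsub>M\<^esub>}" and M2: "rad_power R M 2 = {\<zero>\<^bsub>M\<^esub>}"
  shows "koszul_type (simple_top R)"
proof -
  obtain n \<pi> where M: "left_module R M" and \<pi>: "fcover M n \<pi>" "aligned (free n) M \<pi>"
      "\<And>k. koszul_upto k (Syz n M \<pi>)" using K unfolding koszul_type_def by blast
  have M2': "rmul R M (rmul R M (carrier M)) = {\<zero>\<^bsub>M\<^esub>}" using M2 by (simp add: numeral_2_eq_2 rad_power_Suc)
  note J = koszul_upto_Jpow[OF M \<pi> M2' fcover_rank_pos[OF M \<pi>(1) nz]]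
  obtain \<gamma> where \<gamma>: "fcover (simple_top R) 1 \<gamma>" using simple_top_cover(3) by blast
  note s = semisimple_cover[OF simple_top_cover(1,2) \<gamma>]
  show ?thesis unfolding koszul_type_def using simple_top_cover(1) \<gamma> s(2) s(3) J by metis
qed

text \<open>As the simple module has zero radical, the length formula loses its correction term.
  These values start the ratios at e, which selects the larger root.\<close>

lemma simple_top_betti:
  assumes "koszul_type (simple_top R)"
  shows "syzygy_top R (simple_top R) 0 = 1" "syzygy_top R (simple_top R) (Suc 0) = e"
proof -
  let ?S = "simple_top R"
  obtain \<gamma> where \<gamma>: "fcover ?S 1 \<gamma>" using simple_top_cover(3) by blast
  show 0: "syzygy_top R ?S 0 = 1"
    using fcover_tlen[OF simple_top_cover(1) \<gamma>] by (simp add: top_length_tlen[OF simple_top_cover(1)])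
  have "rlen ?S = enat 0" using simple_top_cover(2) by (simp add: rlen_def zero_enat_def[symmetric])
  then show "syzygy_top R ?S (Suc 0) = e" using koszul_type_syzygy(2)[OF assms] 0 by auto
qed

text \<open>A syzygy with zero top is zero by Nakayama, so the minimal free cover is an
  isomorphism.\<close>

lemma koszul_type_projective:
  assumes K: "koszul_type M" and t: "top_length R (syzygy R M) = 0"
  shows "projective_module R M"
proof -
  obtain n \<pi> where M: "left_module R M" and \<pi>: "fcover M n \<pi>" "aligned (free n) M \<pi>"
    using K unfolding koszul_type_def by blast
  let ?K = "Syz n M \<pi>"
  have KM: "left_module R ?K" by (rule kernel_fcover_left_module[OF M \<pi>(1)])
  interpret K: left_module R ?K by fact
  obtain \<phi> where S: "left_module R (syzygy R M)" and \<phi>: "miso R ?K (syzygy R M) \<phi>"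
    using syzygy_miso[OF M \<pi>(1)] by blast
  \<comment> \<open>Finiteness comes first: \<open>top_length\<close> being 0 says something about
    the length only when that length is finite.\<close>
  have "tlen ?K \<le> enat (n * e)" using aligned_lens(1)[OF M \<pi>] by (metis le_iff_add)
  then obtain b where b: "tlen ?K = enat b" by (cases "tlen ?K") auto
  have "tlen (syzygy R M) = enat b" using miso_lens(1)[OF KM S \<phi>] b by simp
  then have "b = 0" using t by (simp add: top_length_tlen[OF S])
  then have "ilen R ?K (rmul R ?K (carrier ?K)) (carrier ?K) = 0" using b by (simp add: tlen_def zero_enat_def)
  then have top: "rmul R ?K (carrier ?K) = carrier ?K"
    by (rule ilen_eq_0[OF rmul_submodule[OF KM order_refl] K.carrier_submodule rmul_carrier[OF KM order_refl]])
  have "{\<zero>\<^bsub>?K\<^esub>} = carrier ?K"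
  proof (rule nakayama[OF KM K.zero_submodule])
    fix x assume "x \<in> carrier ?K"
    then show "\<exists>y\<in>{\<zero>\<^bsub>?K\<^esub>}. x \<ominus>\<^bsub>?K\<^esub> y \<in> rmul R ?K (carrier ?K)" unfolding top by simp
  qed
  then have "Ker n M \<pi> = {\<zero>\<^bsub>free n\<^esub>}" by (simp add: kernel_module_def)
  then have "inj_on \<pi> (carrier (free n))"
    using hom_inj_iff[OF free_left_module M fcover_hom[OF \<pi>(1)]] by (auto simp: a_kernel_eq)
  then have iso: "miso R (free n) M \<pi>" using \<pi>(1) by (simp add: miso_def bij_betw_def fcover_def)
  let ?s = "inv_into (carrier (free n)) \<pi>"
  have s: "?s \<in> Hom M (free n)" using miso_inv[OF free_left_module iso] by (simp add: miso_def)
  have "\<pi> (?s x) = x" if "x \<in> carrier M" for x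
    using iso that by (simp add: miso_def bij_betw_def f_inv_into_f)
  then show ?thesis unfolding projective_module_def
    using M by (intro conjI exI[of _ n] bexI[OF _ fcover_hom[OF \<pi>(1)]] bexI[OF _ s]) auto
qed

text \<open>The ratio argument needs l > 0, hence the case distinction. For l = 0 the bound is
  trivial, the roots are e and 0, and the smaller one belongs to a vanishing first Betti
  number.\<close>

theorem koszul_growth:
  assumes M: "left_module R M" and nz: "carrier M \<noteq> {\<zero>\<^bsub>M\<^esub>}" and K: "koszul_module R M"
    and M2: "rad_power R M 2 = {\<zero>\<^bsub>M\<^esub>}"
  shows "koszul_module R (simple_top R)
    \<and> real l \<le> 1/4 * (real e)^2
    \<and> growth R (simple_top R) = ereal (1/2 * (real e + sqrt ((real e)^2 - 4 * real l)))
    \<and> (growth R M = growth R (simple_top R)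
        \<or> (0 < l \<or> projective_module R M)
          \<and> growth R M = ereal (1/2 * (real e - sqrt ((real e)^2 - 4 * real l))))"
proof -
  have KM: "koszul_type M" by (rule koszul_module_type[OF M K M2])
  have KS: "koszul_type (simple_top R)" by (rule koszul_type_simple_top[OF KM nz M2])
  have "rad_power R (simple_top R) 1 = {\<zero>\<^bsub>simple_top R\<^esub>}"
    using simple_top_cover(2) by (simp add: rad_power_Suc)
  then have 1: "koszul_module R (simple_top R)" by (rule koszul_type_module[OF KS])
  note recM = betti_recurrence[OF KM] and recS = betti_recurrence[OF KS] and S = simple_top_betti[OF KS]
  have t0: "syzygy_top R M 0 > 0" using koszul_type_top_pos[OF KM nz] by simp
  show ?thesis
  proof (cases "l = 0")
    case False
    have S0: "syzygy_top R (simple_top R) 0 > 0" using S by simp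
    have "real l \<le> 1/4 * (real e)^2" using discriminant[OF recM t0] False by simp
    moreover have "growth R (simple_top R) = ereal (1/2 * (real e + sqrt ((real e)^2 - 4 * real l)))"
      unfolding growth_def using recurrence_growth_max[OF recS S0 _ S(1)] S(2) False by simp
    moreover have "growth R M = ereal (1/2 * (real e + sqrt ((real e)^2 - 4 * real l))) \<or>
        growth R M = ereal (1/2 * (real e - sqrt ((real e)^2 - 4 * real l)))"
      unfolding growth_def using recurrence_growth[OF recM t0] False by simp
    ultimately show ?thesis using 1 False by auto
  next
    case True
    \<comment> \<open>The first Betti number of the simple module is e, so both branches of the
      degenerate formula give e.\<close>
    have gS: "growth R (simple_top R) = ereal (real e)"
      unfolding growth_def using recurrence_degenerate[of "syzygy_top R (simple_top R)" e] recS S True by auto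
    have gM: "growth R M = ereal (if syzygy_top R M 1 = 0 then 0 else real e)"
      unfolding growth_def using recurrence_degenerate[of "syzygy_top R M" e] recM True by auto
    have "projective_module R M" if "syzygy_top R M 1 = 0"
      using koszul_type_projective[OF KM] that by simp
    then show ?thesis using 1 True gS gM by auto
  qed
qed

end

section \<open>From short local algebras to the abstract setting\<close>

text \<open>The condition A/J = k gives A = k 1 + J with central scalars. Hence the left ideal J is
  also a right ideal, and an element outside J is a non-zero scalar plus an element of J, which can
  be inverted by a finite geometric series.\<close>

lemma short_local_algebra_cube_zero:
  assumes "short_local_algebra k A" shows "cube_zero_local A"
proof -
  let ?J = "jradical A"
  have alg: "fin_dim_algebra k A" and loc: "\<exists>!I. maximal_left_ideal A I"
    and J3: "rad_power A (regular_module A) 3 = {\<zero>\<^bsub>A\<^esub>}"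
    and bij: "bij_betw (\<lambda>c. ?J +>\<^bsub>A\<^esub> (c \<odot>\<^bsub>A\<^esub> \<one>\<^bsub>A\<^esub>)) (carrier k) (a_rcosets\<^bsub>A\<^esub> ?J)"
    using assms by (auto simp: short_local_algebra_def local_ring_def)
  have field: "field k" and ring: "ring A" and mod: "Module.module k A"
    and sm: "\<And>c x y. c \<in> carrier k \<Longrightarrow> x \<in> carrier A \<Longrightarrow> y \<in> carrier A \<Longrightarrow>
       (c \<odot>\<^bsub>A\<^esub> x) \<otimes>\<^bsub>A\<^esub> y = c \<odot>\<^bsub>A\<^esub> (x \<otimes>\<^bsub>A\<^esub> y) \<and> x \<otimes>\<^bsub>A\<^esub> (c \<odot>\<^bsub>A\<^esub> y) = c \<odot>\<^bsub>A\<^esub> (x \<otimes>\<^bsub>A\<^esub> y)"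
    using alg unfolding fin_dim_algebra_def by blast+
  interpret k: field k by fact
  interpret A: ring A by fact
  interpret V: Module.module k A by fact
  interpret reg: left_module A "regular_module A" by (rule A.regular_left_module)
  obtain I where I: "maximal_left_ideal A I" "{I. maximal_left_ideal A I} = {I}" using loc by blast
  have "I \<subseteq> carrier A" using I(1) by (simp add: maximal_left_ideal_def reg.submodule_iff)
  then have JI: "?J = I" using I(2) by (auto simp: jradical_def)
  have Js: "submodule ?J A (regular_module A)" and Jne: "?J \<noteq> carrier A"
    using I(1) by (auto simp: maximal_left_ideal_def JI)
  have Jc: "x \<in> carrier A" if "x \<in> ?J" for x using Js that by (auto simp: reg.submodule_iff)
  have Jl: "a \<otimes>\<^bsub>A\<^esub> x \<in> ?J" if "a \<in> carrier A" "x \<in> ?J" for a x using Js that by (simp add: reg.submodule_iff)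
  have Ja: "x \<oplus>\<^bsub>A\<^esub> y \<in> ?J" if "x \<in> ?J" "y \<in> ?J" for x y using Js that by (simp add: reg.submodule_iff)
  have one: "\<one>\<^bsub>A\<^esub> \<notin> ?J"
  proof
    assume "\<one>\<^bsub>A\<^esub> \<in> ?J"
    then have "x \<in> ?J" if "x \<in> carrier A" for x using Jl[OF that] that by force
    then show False using Jne Jc by blast
  qed
  \<comment> \<open>Surjectivity of the structure map from k to A/J supplies the scalar c.\<close>
  have dec: "\<exists>c\<in>carrier k. \<exists>j\<in>?J. x = j \<oplus>\<^bsub>A\<^esub> (c \<odot>\<^bsub>A\<^esub> \<one>\<^bsub>A\<^esub>)" if x: "x \<in> carrier A" for x
  proof -
    have "?J +>\<^bsub>A\<^esub> x \<in> a_rcosets\<^bsub>A\<^esub> ?J" using x by (auto simp: cosets_eq)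
    then obtain c where c: "c \<in> carrier k" "?J +>\<^bsub>A\<^esub> x = ?J +>\<^bsub>A\<^esub> (c \<odot>\<^bsub>A\<^esub> \<one>\<^bsub>A\<^esub>)"
      using bij unfolding bij_betw_def by blast
    have "\<zero>\<^bsub>A\<^esub> \<in> ?J" using Js by (simp add: reg.submodule_iff)
    then have "x \<in> ?J +>\<^bsub>A\<^esub> x" using x image_eqI[of x "\<lambda>n. n \<oplus>\<^bsub>A\<^esub> x" "\<zero>\<^bsub>A\<^esub>" ?J] by (simp add: coset_eq)
    then show ?thesis using c by (auto simp: coset_eq)
  qed
  have scal: "(c \<odot>\<^bsub>A\<^esub> \<one>\<^bsub>A\<^esub>) \<otimes>\<^bsub>A\<^esub> x = c \<odot>\<^bsub>A\<^esub> x" "x \<otimes>\<^bsub>A\<^esub> (c \<odot>\<^bsub>A\<^esub> \<one>\<^bsub>A\<^esub>) = c \<odot>\<^bsub>A\<^esub> x"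
    if "c \<in> carrier k" "x \<in> carrier A" for c x using sm[of c "\<one>\<^bsub>A\<^esub>" x] sm[of c x "\<one>\<^bsub>A\<^esub>"] that by simp_all
  have Jk: "c \<odot>\<^bsub>A\<^esub> x \<in> ?J" if "c \<in> carrier k" "x \<in> ?J" for c x
    using Jl[of "c \<odot>\<^bsub>A\<^esub> \<one>\<^bsub>A\<^esub>" x] scal(1)[of c x] that Jc by simp
  have cube: "a \<otimes>\<^bsub>A\<^esub> (b \<otimes>\<^bsub>A\<^esub> c) = \<zero>\<^bsub>A\<^esub>" if "a \<in> ?J" "b \<in> ?J" "c \<in> ?J" for a b c
  proof -
    \<comment> \<open>\<open>rad_power\<close> starts with the whole module at index 0, so c is
      written as c 1 and the triple product reaches index 3.\<close>
    have "c \<odot>\<^bsub>regular_module A\<^esub> \<one>\<^bsub>A\<^esub> \<in> rad_power A (regular_module A) 1"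
      using rmul_smult[OF that(3), of "\<one>\<^bsub>A\<^esub>" "carrier A" "regular_module A"] by (simp add: rad_power_Suc)
    then have "a \<odot>\<^bsub>regular_module A\<^esub> (b \<odot>\<^bsub>regular_module A\<^esub> (c \<odot>\<^bsub>regular_module A\<^esub> \<one>\<^bsub>A\<^esub>)) \<in> rad_power A (regular_module A) (Suc (Suc 1))"
      unfolding rad_power_Suc using that by (intro rmul_smult)
    then show ?thesis using J3 that Jc by (simp add: numeral_3_eq_3)
  qed
  show ?thesis
  proof (intro cube_zero_local.intro cube_zero_local_axioms.intro ring Js one cube)
    fix a b assume ab: "a \<in> ?J" "b \<in> carrier A"
    obtain c j where c: "c \<in> carrier k" "j \<in> ?J" "b = j \<oplus>\<^bsub>A\<^esub> (c \<odot>\<^bsub>A\<^esub> \<one>\<^bsub>A\<^esub>)" using dec[OF ab(2)] by blast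
    have "a \<otimes>\<^bsub>A\<^esub> b = a \<otimes>\<^bsub>A\<^esub> j \<oplus>\<^bsub>A\<^esub> c \<odot>\<^bsub>A\<^esub> a" using ab c Jc by (simp add: A.r_distr scal)
    then show "a \<otimes>\<^bsub>A\<^esub> b \<in> ?J" using Ja Jl Jk ab c Jc by simp
  next
    fix x assume x: "x \<in> carrier A" "x \<notin> ?J"
    obtain c j where c: "c \<in> carrier k" "j \<in> ?J" "x = j \<oplus>\<^bsub>A\<^esub> (c \<odot>\<^bsub>A\<^esub> \<one>\<^bsub>A\<^esub>)" using dec[OF x(1)] by blast
    have "c \<noteq> \<zero>\<^bsub>k\<^esub>"
    proof
      assume "c = \<zero>\<^bsub>k\<^esub>" then have "x = j" using c Jc by simp
      then show False using x c by simp
    qed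
    then have "c \<in> Units k" using c(1) by (simp add: k.field_Units)
    then obtain c' where c': "c' \<in> carrier k" "c' \<otimes>\<^bsub>k\<^esub> c = \<one>\<^bsub>k\<^esub>" unfolding Units_def by blast
    let ?i = "c' \<odot>\<^bsub>A\<^esub> j"
    have i: "?i \<in> ?J" "?i \<in> carrier A" using Jk c' c Jc by auto
    have ux: "(c' \<odot>\<^bsub>A\<^esub> \<one>\<^bsub>A\<^esub>) \<otimes>\<^bsub>A\<^esub> x = ?i \<oplus>\<^bsub>A\<^esub> \<one>\<^bsub>A\<^esub>"
      using c c' x Jc by (simp add: scal V.smult_r_distr V.smult_assoc1[symmetric])
    \<comment> \<open>The truncated geometric series 1 - i + i^2: multiplied by i + 1 it gives 1 +
      i^3, and i^3 = 0.\<close>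
    let ?v = "(\<one>\<^bsub>A\<^esub> \<ominus>\<^bsub>A\<^esub> ?i) \<oplus>\<^bsub>A\<^esub> ?i \<otimes>\<^bsub>A\<^esub> ?i"
    have "?v \<otimes>\<^bsub>A\<^esub> (?i \<oplus>\<^bsub>A\<^esub> \<one>\<^bsub>A\<^esub>) = \<one>\<^bsub>A\<^esub> \<oplus>\<^bsub>A\<^esub> ?i \<otimes>\<^bsub>A\<^esub> (?i \<otimes>\<^bsub>A\<^esub> ?i)"
      using i(2) by (algebra, simp add: A.r_neg1 A.r_neg2)
    then have "?v \<otimes>\<^bsub>A\<^esub> (?i \<oplus>\<^bsub>A\<^esub> \<one>\<^bsub>A\<^esub>) = \<one>\<^bsub>A\<^esub>" using cube[OF i(1) i(1) i(1)] by simp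
    then have "(?v \<otimes>\<^bsub>A\<^esub> (c' \<odot>\<^bsub>A\<^esub> \<one>\<^bsub>A\<^esub>)) \<otimes>\<^bsub>A\<^esub> x = \<one>\<^bsub>A\<^esub>"
      using ux i(2) c'(1) x(1) by (simp add: A.m_assoc)
    moreover have "?v \<otimes>\<^bsub>A\<^esub> (c' \<odot>\<^bsub>A\<^esub> \<one>\<^bsub>A\<^esub>) \<in> carrier A" using i c' by simp
    ultimately show "\<exists>u\<in>carrier A. u \<otimes>\<^bsub>A\<^esub> x = \<one>\<^bsub>A\<^esub>" by blast
  qed
qed

lemma short_local_algebra_short_local:
  assumes "short_local_algebra k A" "hilbert_type A e a"
  shows "short_local A e a"
proof -
  interpret cube_zero_local A by (rule short_local_algebra_cube_zero[OF assms(1)])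
  interpret reg: left_module A reg by (rule regular_left_module)
  have zs: "submodule {\<zero>\<^bsub>A\<^esub>} A reg" using reg.zero_submodule by simp
  have r2: "rad_power A reg 2 = J2" by (simp add: numeral_2_eq_2 rad_power_Suc rmul_reg)
  have J: "left_module A (restrict_module reg J)" by (rule restrict_left_module[OF reg.lm J_submodule])
  have J2: "submodule J2 A (restrict_module reg J)"
    using submodule_restrict[OF reg.lm J_submodule] J2_submodule J2_J by blast
  have "module_length A (quotient_module (restrict_module reg J) J2) = ilen A reg J2 J"
    using module_length_quotient[OF J J2] ilen_restrict[OF reg.lm J_submodule J2_submodule J_submodule J2_J order_refl] by simp
  moreover have "{\<zero>\<^bsub>A\<^esub>} \<subseteq> J2" using J2_submodule by (simp add: reg.submodule_iff)
  then have "module_length A (restrict_module reg J2) = ilen A reg {\<zero>\<^bsub>A\<^esub>} J2"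
    using module_length_ilen[OF restrict_left_module[OF reg.lm J2_submodule]]
      ilen_restrict[OF reg.lm J2_submodule zs J2_submodule _ order_refl] by simp
  ultimately show ?thesis using assms(2) unfolding hilbert_type_def r2
    by unfold_locales simp_all
qed

text \<open>The alternative \<open>projective_module A M\<close> covers a genuine case: for a = 0
  and e > 0 the regular module is Koszul of Loewy length at most 2 and has growth 0, while the
  simple module has growth e.\<close>

theorem theorem2:
  fixes k :: "('k, 'l) ring_scheme"
    and A :: "('k, 'a) module"
    and M :: "('a, 'm) module"
    and e a :: nat
  assumes "short_local_algebra k A"
    and "hilbert_type A e a"
    and "finite_length_module A M"
    and "carrier M \<noteq> {\<zero>\<^bsub>M\<^esub>}"
    and "koszul_module A M"
    and "loewy_length A M \<le> 2"
  shows "left_koszul_algebra A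
    \<and> real a \<le> 1/4 * (real e)^2
    \<and> growth A (simple_top A) = ereal (1/2 * (real e + sqrt ((real e)^2 - 4 * real a)))
    \<and> (growth A M = growth A (simple_top A)
        \<or> (0 < a \<or> projective_module A M)
          \<and> growth A M = ereal (1/2 * (real e - sqrt ((real e)^2 - 4 * real a))))"
proof -
  interpret short_local A e a by (rule short_local_algebra_short_local[OF assms(1,2)])
  have M: "left_module A M" using assms(3) by (simp add: finite_length_module_def)
  have zero: "\<zero>\<^bsub>M\<^esub> \<in> rad_power A M i" for i
    using rad_power_submodule[OF M, of i] by (simp add: left_module.submodule_iff[OF M])
  \<comment> \<open>As J^3 M = 0, the minimum defining \<open>loewy_length\<close> is attained; the
    powers remain zero from there on, in particular at exponent 2.\<close>
  have "rad_power A M (loewy_length A M) = {\<zero>\<^bsub>M\<^esub>}"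
    unfolding loewy_length_def by (rule LeastI[of _ 3]) (simp add: rad_power_ge3[OF M])
  then have "rad_power A M (loewy_length A M + i) = {\<zero>\<^bsub>M\<^esub>}" for i
  proof (induction i)
    case (Suc i)
    then show ?case using rad_power_Suc_subset[OF M, of "loewy_length A M + i"] zero[of "Suc (loewy_length A M + i)"] by auto
  qed simp
  from this[of "2 - loewy_length A M"] have "rad_power A M 2 = {\<zero>\<^bsub>M\<^esub>}" using assms(6) by simp
  from koszul_growth[OF M assms(4,5) this] show ?thesis unfolding left_koszul_algebra_def .
qed

end
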